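(* Let $\Gamma$ be a nonelementary hyperbolic group, let $S\subset\Gamma$ be a finite symmetric set generating $\Gamma$, and let $\lambda\in[-1,1]\mapsto\mu_\lambda\in\mathcal{P}_s(S)$ be a curve such that for every $a\in S$ the function $\lambda\mapsto\log\mu_\lambda(a)$ has a derivative at $\lambda=0$, denoted $\nu(a)$. Then the function $\lambda\mapsto h(\mu_\lambda)$ has a derivative at $\lambda=0$, which satisfies $$\frac{d}{d\lambda}\Big|_{\lambda=0}h(\mu_\lambda)=\sigma(\nu,\mu_0;d_G^0),$$ where $d_G^0=d_G^{\mu_0}$ is the Green metric associated to $\mu_0$.
   Context: $\Gamma$ is an infinite, finitely generated (countable, discrete) group with neutral element $\mathrm{id}$. It is hyperbolic (in the sense of Gromov) and nonelementary (i.e. nonamenable; equivalently not a finite extension of $\mathbb{Z}$). A set $S$ is symmetric if $x\in S\Rightarrow x^{-1}\in S$. $\mathcal{P}_s(S)$ is the set of probability measures $\mu$ on $\Gamma$ with support exactly $S$ and $\mu(x^{-1})=\mu(x)$ for all $x$. $\mu^n$ denotes the $n$th convolution power of $\mu$. The asymptotic entropy is $h(\mu)=\lim_{n\to\infty}\frac1n\sum_{x\in\Gamma}(-\log\mu^n(x))\mu^n(x)$ (with $0\log 0=0$). For $\mu\in\mathcal{P}_s(S)$ the Green function is $G^\mu(x)=\sum_{n\ge0}\mu^n(x)$ (finite since $\Gamma$ is nonamenable), and the Green metric is $d_G^\mu(x,y)=\log G^\mu(\mathrm{id})-\log G^\mu(x^{-1}y)$, a left-invariant metric on $\Gamma$.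 $\mathbb{P}^\mu$ (expectation $\mathbb{E}^\mu$) is the law of the random walk: $Z_0=\mathrm{id}$ and the increments $X_n=Z_{n-1}^{-1}Z_n$, $n\ge1$, are i.i.d. with law $\mu$; $\mathbb{E}^0=\mathbb{E}^{\mu_0}$. $M_0=0$ and $M_n=\sum_{j=1}^n\nu(X_j)$ for $n\ge1$. One has $\sum_{a\in S}\nu(a)\mu_0(a)=0$. The asymptotic covariance, for a metric $d$, is $\sigma(\nu,\mu_0;d)=\lim_{n\to\infty}\frac1n\mathbb{E}^0[\,d(\mathrm{id},Z_n)\,M_n]$; for $d=d_G^0$ this limit exists under the present hypotheses. *)

theory Defs
  imports "HOL-Probability.Probability" "HOL-Algebra.Generated_Groups"
begin

definition word_length :: "('a, 'b) monoid_scheme \<Rightarrow> 'a set \<Rightarrow> 'a \<Rightarrow> nat" where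
  "word_length G S x =
    (LEAST n. \<exists>ws. length ws = n \<and> set ws \<subseteq> S \<union> m_inv G ` S \<and> foldr (mult G) ws \<one>\<^bsub>G\<^esub> = x)"

definition word_dist :: "('a, 'b) monoid_scheme \<Rightarrow> 'a set \<Rightarrow> 'a \<Rightarrow> 'a \<Rightarrow> real" where
  "word_dist G S x y = real (word_length G S (inv\<^bsub>G\<^esub> x \<otimes>\<^bsub>G\<^esub> y))"

definition gromov_product :: "('a \<Rightarrow> 'a \<Rightarrow> real) \<Rightarrow> 'a \<Rightarrow> 'a \<Rightarrow> 'a \<Rightarrow> real" where
  "gromov_product d w x y = (d w x + d w y - d x y) / 2"

definition gromov_hyperbolic_on :: "'a set \<Rightarrow> ('a \<Rightarrow> 'a \<Rightarrow> real) \<Rightarrow> bool" where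
  "gromov_hyperbolic_on A d \<longleftrightarrow>
    (\<exists>\<delta>. \<forall>w\<in>A. \<forall>x\<in>A. \<forall>y\<in>A. \<forall>z\<in>A.
      gromov_product d w x z \<ge> min (gromov_product d w x y) (gromov_product d w y z) - \<delta>)"

definition hyperbolic_group :: "('a, 'b) monoid_scheme \<Rightarrow> bool" where
  "hyperbolic_group G \<longleftrightarrow> group G \<and>
    (\<exists>S. finite S \<and> S \<subseteq> carrier G \<and> generate G S = carrier G \<and>
      gromov_hyperbolic_on (carrier G) (word_dist G S))"

text \<open>Amenability of a discrete group in von Neumann's sense: existence of a finitely additive,
  left-invariant probability measure defined on all subsets.\<close>

definition amenable_group :: "('a, 'b) monoid_scheme \<Rightarrow> bool" where
  "amenable_group G \<longleftrightarrow> group G \<and>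
    (\<exists>m :: 'a set \<Rightarrow> real.
      m (carrier G) = 1 \<and>
      (\<forall>A \<subseteq> carrier G. m A \<ge> 0) \<and>
      (\<forall>A \<subseteq> carrier G. \<forall>B \<subseteq> carrier G. A \<inter> B = {} \<longrightarrow> m (A \<union> B) = m A + m B) \<and>
      (\<forall>x\<in>carrier G. \<forall>A \<subseteq> carrier G. m (x <#\<^bsub>G\<^esub> A) = m A))"

text \<open>A hyperbolic group is nonelementary iff it is nonamenable; equivalently, it is neither finite
  nor a finite extension of the integers. The former is taken as the definition.\<close>

definition nonelementary_hyperbolic_group :: "('a, 'b) monoid_scheme \<Rightarrow> bool" where
  "nonelementary_hyperbolic_group G \<longleftrightarrow>
    hyperbolic_group G \<and> infinite (carrier G) \<and> \<not> amenable_group G"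

definition symmetric_set :: "('a, 'b) monoid_scheme \<Rightarrow> 'a set \<Rightarrow> bool" where
  "symmetric_set G S \<longleftrightarrow> (\<forall>x\<in>S. inv\<^bsub>G\<^esub> x \<in> S)"

definition sym_prob_measures :: "('a, 'b) monoid_scheme \<Rightarrow> 'a set \<Rightarrow> 'a pmf set" where
  "sym_prob_measures G S =
    {\<mu>. set_pmf \<mu> = S \<and> (\<forall>x\<in>carrier G. pmf \<mu> (inv\<^bsub>G\<^esub> x) = pmf \<mu> x)}"

definition convolution_pmf ::
    "('a, 'b) monoid_scheme \<Rightarrow> 'a pmf \<Rightarrow> 'a pmf \<Rightarrow> 'a pmf" where
  "convolution_pmf G \<mu> \<mu>' = map_pmf (\<lambda>(x, y). x \<otimes>\<^bsub>G\<^esub> y) (pair_pmf \<mu> \<mu>')"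

primrec convolution_power :: "('a, 'b) monoid_scheme \<Rightarrow> 'a pmf \<Rightarrow> nat \<Rightarrow> 'a pmf" where
  "convolution_power G \<mu> 0 = return_pmf \<one>\<^bsub>G\<^esub>"
| "convolution_power G \<mu> (Suc n) = convolution_pmf G (convolution_power G \<mu> n) \<mu>"

definition asymptotic_entropy :: "('a, 'b) monoid_scheme \<Rightarrow> 'a pmf \<Rightarrow> real" where
  "asymptotic_entropy G \<mu> =
    lim (\<lambda>n. 1 / real n *
      (\<Sum>\<^sub>\<infinity>x\<in>carrier G. - ln (pmf (convolution_power G \<mu> n) x) * pmf (convolution_power G \<mu> n) x))"

definition green_function :: "('a, 'b) monoid_scheme \<Rightarrow> 'a pmf \<Rightarrow> 'a \<Rightarrow> real" where
  "green_function G \<mu> x = (\<Sum>n. pmf (convolution_power G \<mu> n) x)"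

definition green_metric :: "('a, 'b) monoid_scheme \<Rightarrow> 'a pmf \<Rightarrow> 'a \<Rightarrow> 'a \<Rightarrow> real" where
  "green_metric G \<mu> x y =
    ln (green_function G \<mu> \<one>\<^bsub>G\<^esub>) - ln (green_function G \<mu> (inv\<^bsub>G\<^esub> x \<otimes>\<^bsub>G\<^esub> y))"

text \<open>The law of the i.i.d. increments; a point \<open>\<omega>\<close> of the space is the sequence of increments
  \<open>\<omega> 1, \<omega> 2, \<dots>\<close>. Each factor is restricted to the carrier, which is countable for a finitely
  generated group: if the ambient type were very large, the product of the full discrete
  sigma-algebras on it would not make the group multiplication measurable.\<close>

definition increments_law ::
    "('a, 'b) monoid_scheme \<Rightarrow> 'a pmf \<Rightarrow> (nat \<Rightarrow> 'a) measure" where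
  "increments_law G \<mu> = Pi\<^sub>M {1..} (\<lambda>_. restrict_space (measure_pmf \<mu>) (carrier G))"

primrec walk :: "('a, 'b) monoid_scheme \<Rightarrow> nat \<Rightarrow> (nat \<Rightarrow> 'a) \<Rightarrow> 'a" where
  "walk G 0 \<omega> = \<one>\<^bsub>G\<^esub>"
| "walk G (Suc n) \<omega> = walk G n \<omega> \<otimes>\<^bsub>G\<^esub> \<omega> (Suc n)"

definition walk_martingale :: "('a \<Rightarrow> real) \<Rightarrow> nat \<Rightarrow> (nat \<Rightarrow> 'a) \<Rightarrow> real" where
  "walk_martingale \<nu> n \<omega> = (\<Sum>j=1..n. \<nu> (\<omega> j))"

definition mean_covariance :: "('a, 'b) monoid_scheme \<Rightarrow> ('a \<Rightarrow> real) \<Rightarrow> 'a pmf \<Rightarrow>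
    ('a \<Rightarrow> 'a \<Rightarrow> real) \<Rightarrow> nat \<Rightarrow> real" where
  "mean_covariance G \<nu> \<mu> d n =
    1 / real n * (\<integral>\<omega>. d \<one>\<^bsub>G\<^esub> (walk G n \<omega>) * walk_martingale \<nu> n \<omega> \<partial>increments_law G \<mu>)"

definition asymptotic_covariance :: "('a, 'b) monoid_scheme \<Rightarrow> ('a \<Rightarrow> real) \<Rightarrow> 'a pmf \<Rightarrow>
    ('a \<Rightarrow> 'a \<Rightarrow> real) \<Rightarrow> real" where
  "asymptotic_covariance G \<nu> \<mu> d = lim (mean_covariance G \<nu> \<mu> d)"

end

theory Submission
  imports Defs "HOL-Real_Asymp.Real_Asymp"
begin

text \<open>
  Write \<open>\<ell>(p, q)\<close> for the rate of escape of the walk with law \<open>p\<close> in the Green metric of \<open>q\<close>. Since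
  \<open>G\<^sup>p \<ge> p\<^sup>n\<close>, and by Gibbs' inequality against the Green function of \<open>q\<close>, whose mass on the
  support of \<open>p\<^sup>n\<close> is \<open>O(n)\<close>, one has \<open>h(p) = \<ell>(p, p) \<le> \<ell>(p, q)\<close>. Hence \<open>h(\<mu>\<^sub>t) - h(\<mu>\<^sub>0)\<close> lies between
  \<open>\<ell>(\<mu>\<^sub>t, q) - \<ell>(\<mu>\<^sub>0, q)\<close> for \<open>q = \<mu>\<^sub>t\<close> and for \<open>q = \<mu>\<^sub>0\<close>.

  Ancona's inequality is only needed up to a logarithm. Step probabilities decay exponentially
  (Kesten), so the mass of \<open>G(xy)\<close> is carried by paths of length \<open>O(N)\<close>, and a path of polynomial
  length cannot stay farther than \<open>O(log N)\<close> from a geodesic with the same end points; a typical path of the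
  walk does not return towards its starting point. This bounds the second moment of the defect
  \<open>d(1, X) + d(1, Y) - d(1, XY)\<close>, for independent \<open>X\<close> and \<open>Y\<close> with at most \<open>N\<close> steps in all, by \<open>O(N\<^sup>\<half>)\<close>,
  uniformly for \<open>p\<close> and \<open>q\<close> near \<open>\<mu>\<^sub>0\<close>. So the means are additive up to \<open>O(N\<^sup>1\<^sup>/\<^sup>4)\<close>, the covariances with
  the martingale up to \<open>O(N\<^sup>3\<^sup>/\<^sup>4)\<close>, and the variance is linear along powers of two. Comparing the \<open>n\<close>-step
  laws of \<open>\<mu>\<^sub>t\<close> and \<open>\<mu>\<^sub>0\<close> to first order in the density, with \<open>n\<close> of order \<open>\<bar>t\<bar>\<^sup>-\<^sup>3\<^sup>/\<^sup>2\<close>, makes every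
  error \<open>o(t)\<close>.
\<close>

section \<open>Expectations over words with independent letters\<close>

text \<open>Three errors fix the scale. At time N, after division by N and with t the size of the
  perturbation, the means cost N^(-3/4), the covariance t N^(-1/4), and the second-order part of the
  density sqrt(N) t^2. All are o(t) when N is much larger than |t|^(-4/3) and much smaller than
  |t|^(-2); |t|^(-3/2) is one choice. The window is open because the standard deviation is O(sqrt
  N): with the trivial bound O(N) the last error would be N t^2, which asks for N below 1/|t|. N and
  t move together, so every estimate carries a rate and a constant that is the same for all laws of
  a class. That class is cut out by three numbers: a lower bound for the weights and the two
  constants of the exponential decay of step probabilities. The lower half of the squeeze measures
  distances in the Green metric of the moving law and yields the covariance for that metric. Its
  continuity at \<open>\<mu>\<^sub>0\<close> again comes from the uniform rate, by exchanging the
  limits in time and in the law.\<close>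

text \<open>Until \<open>integral_increments\<close> all probability is done with these finite sums,
  so that no measurability question arises. The first letter is summed outermost, which makes
  \<open>word_exp_append\<close> the independence of consecutive blocks.\<close>

primrec word_exp :: "'a set \<Rightarrow> ('a \<Rightarrow> real) \<Rightarrow> nat \<Rightarrow> ('a list \<Rightarrow> real) \<Rightarrow> real" where
  "word_exp S p 0 F = F []"
| "word_exp S p (Suc n) F = (\<Sum>a\<in>S. p a * word_exp S p n (\<lambda>xs. F (a # xs)))"

lemma word_exp_cong:
  assumes "\<And>xs. length xs = n \<Longrightarrow> set xs \<subseteq> S \<Longrightarrow> F xs = F' xs"
  shows "word_exp S p n F = word_exp S p n F'"
  using assms
proof (induction n arbitrary: F F')
  case (Suc n)
  have "word_exp S p n (\<lambda>xs. F (a # xs)) = word_exp S p n (\<lambda>xs. F' (a # xs))" if "a \<in> S" for a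
    by (rule Suc.IH) (use Suc.prems that in auto)
  then show ?case by simp
qed simp

lemma word_exp_add:
  "word_exp S p n (\<lambda>xs. F xs + F' xs) = word_exp S p n F + word_exp S p n F'"
  by (induction n arbitrary: F F') (simp_all add: sum.distrib algebra_simps)

lemma word_exp_cmult: "word_exp S p n (\<lambda>xs. c * F xs) = c * word_exp S p n F"
  by (induction n arbitrary: F) (simp_all add: sum_distrib_left algebra_simps)

lemma word_exp_cmult_right: "word_exp S p n (\<lambda>xs. F xs * c) = word_exp S p n F * c"
  using word_exp_cmult[of S p n c F] by (simp add: mult.commute)

lemma word_exp_diff:
  "word_exp S p n (\<lambda>xs. F xs - F' xs) = word_exp S p n F - word_exp S p n F'"
  using word_exp_add[of S p n F "\<lambda>xs. (-1) * F' xs"] word_exp_cmult[of S p n "-1" F'] by simp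

lemma word_exp_zero [simp]: "word_exp S p n (\<lambda>xs. 0) = 0"
  by (induction n) simp_all

lemma word_exp_sum:
  "word_exp S p n (\<lambda>xs. \<Sum>i\<in>A. F i xs) = (\<Sum>i\<in>A. word_exp S p n (F i))"
  by (induction A rule: infinite_finite_induct) (simp_all add: word_exp_add)

lemma word_exp_append:
  "word_exp S p (n + m) F = word_exp S p n (\<lambda>xs. word_exp S p m (\<lambda>ys. F (xs @ ys)))"
  by (induction n arbitrary: F) simp_all

text \<open>The density between two product laws is the product of the letter densities.\<close>

lemma word_exp_change_weights:
  assumes "\<And>a. a \<in> S \<Longrightarrow> q a = p a * w a"
  shows "word_exp S q n F = word_exp S p n (\<lambda>xs. prod_list (map w xs) * F xs)"
proof (induction n arbitrary: F)
  case (Suc n)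
  have "word_exp S q (Suc n) F =
      (\<Sum>a\<in>S. p a * (w a * word_exp S p n (\<lambda>xs. prod_list (map w xs) * F (a # xs))))"
    by (simp add: Suc.IH assms mult.assoc)
  then show ?case by (simp add: word_exp_cmult[symmetric] mult.assoc)
qed simp

lemma tendsto_word_exp:
  assumes "\<And>xs. set xs \<subseteq> S \<Longrightarrow> ((\<lambda>t. F t xs) \<longlongrightarrow> F0 xs) net"
    and "\<And>a. a \<in> S \<Longrightarrow> ((\<lambda>t. p t a) \<longlongrightarrow> p0 a) net"
  shows "((\<lambda>t. word_exp S (p t) n (F t)) \<longlongrightarrow> word_exp S p0 n F0) net"
  using assms(1)
proof (induction n arbitrary: F F0)
  case (Suc n)
  have "((\<lambda>t. word_exp S (p t) n (\<lambda>xs. F t (a # xs))) \<longlongrightarrow> word_exp S p0 n (\<lambda>xs. F0 (a # xs))) net"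
    if "a \<in> S" for a by (rule Suc.IH) (use Suc.prems that in auto)
  then show ?case
    unfolding word_exp.simps by (intro tendsto_intros assms(2))
qed simp

section \<open>Moments of words whose letters have probability weights\<close>

locale word_weights =
  fixes S :: "'a set" and p :: "'a \<Rightarrow> real"
  assumes weights_nonneg: "a \<in> S \<Longrightarrow> 0 \<le> p a"
    and weights_sum: "sum p S = 1"
begin

lemma weights_mult_const [simp]: "(\<Sum>a\<in>S. p a * c) = c"
  by (simp add: sum_distrib_right[symmetric] weights_sum)

abbreviation E :: "nat \<Rightarrow> ('a list \<Rightarrow> real) \<Rightarrow> real" where "E \<equiv> word_exp S p"

lemma word_exp_mono:
  assumes "\<And>xs. length xs = n \<Longrightarrow> set xs \<subseteq> S \<Longrightarrow> F xs \<le> F' xs"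
  shows "E n F \<le> E n F'"
  using assms
proof (induction n arbitrary: F F')
  case (Suc n)
  have "E n (\<lambda>xs. F (a # xs)) \<le> E n (\<lambda>xs. F' (a # xs))" if "a \<in> S" for a
    by (rule Suc.IH) (use Suc.prems that in auto)
  then show ?case by (auto intro!: sum_mono mult_left_mono weights_nonneg)
qed simp

lemma word_exp_const [simp]: "E n (\<lambda>xs. c) = c"
  by (induction n) (simp_all add: sum_distrib_right[symmetric] weights_sum)

lemma word_exp_nonneg:
  assumes "\<And>xs. length xs = n \<Longrightarrow> set xs \<subseteq> S \<Longrightarrow> 0 \<le> F xs"
  shows "0 \<le> E n F"
  using word_exp_mono[of n "\<lambda>_. 0" F] assms by simp

lemma word_exp_le_const:
  assumes "\<And>xs. length xs = n \<Longrightarrow> set xs \<subseteq> S \<Longrightarrow> F xs \<le> c"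
  shows "E n F \<le> c"
  using word_exp_mono[of n F "\<lambda>_. c"] assms by simp

lemma word_exp_drop: "i \<le> n \<Longrightarrow> E n (\<lambda>xs. F (drop i xs)) = E (n - i) F"
proof (induction i arbitrary: n F)
  case (Suc i)
  then obtain k where n: "n = Suc k" by (cases n) auto
  then have "E n (\<lambda>xs. F (drop (Suc i) xs)) = (\<Sum>a\<in>S. p a * E (k - i) F)"
    using Suc by simp
  then show ?case by (simp add: n sum_distrib_right[symmetric] weights_sum)
qed simp

lemma word_exp_take: "i \<le> n \<Longrightarrow> E n (\<lambda>xs. F (take i xs)) = E i F"
proof (induction i arbitrary: n F)
  case (Suc i)
  then obtain k where n: "n = Suc k" by (cases n) auto
  show ?case using Suc.IH[of k "\<lambda>xs. F (a # xs)" for a] Suc.prems by (simp add: n)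
qed simp

lemma word_exp_letters: "E n (\<lambda>xs. \<Sum>x\<leftarrow>xs. w x) = real n * (\<Sum>a\<in>S. p a * w a)"
proof (induction n)
  case (Suc n)
  then show ?case
    by (simp add: word_exp_add sum.distrib distrib_left) (simp add: distrib_right)
qed simp

text \<open>Both weights have total mass 1, so the density increment \<open>w\<close> has mean zero;
  its values at different letters are then orthogonal.\<close>

lemma density_centered:
  assumes "word_weights S p'" "\<forall>a\<in>S. p' a = p a * (1 + w a)"
  shows "(\<Sum>a\<in>S. p a * w a) = 0"
proof -
  have "(\<Sum>a\<in>S. p a * w a) = (\<Sum>a\<in>S. p' a - p a)"
    using assms(2) by (intro sum.cong) (auto simp: algebra_simps)
  then show ?thesis by (simp add: sum_subtractf weights_sum word_weights.weights_sum[OF assms(1)])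
qed

text \<open>The second moment of \<open>t * F - s * H\<close> is a nonnegative quadratic form in
  \<open>t\<close> and \<open>s\<close>; it is evaluated at its minimiser, and the degenerate case
  \<open>a = 0\<close> is treated apart.\<close>

lemma Cauchy_Schwarz_word_exp: "(E n (\<lambda>xs. F xs * H xs))\<^sup>2 \<le> E n (\<lambda>xs. (F xs)\<^sup>2) * E n (\<lambda>xs. (H xs)\<^sup>2)"
proof -
  define a b c where "a = E n (\<lambda>xs. (F xs)\<^sup>2)" and "b = E n (\<lambda>xs. F xs * H xs)"
    and "c = E n (\<lambda>xs. (H xs)\<^sup>2)"
  have q: "0 \<le> a * t\<^sup>2 - 2 * t * s * b + s\<^sup>2 * c" for t s
  proof -
    have "0 \<le> E n (\<lambda>xs. (t * F xs - s * H xs)\<^sup>2)" by (rule word_exp_nonneg) simp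
    also have "\<dots> = E n (\<lambda>xs. t\<^sup>2 * (F xs)\<^sup>2 - (2 * t * s) * (F xs * H xs) + s\<^sup>2 * (H xs)\<^sup>2)"
      by (rule word_exp_cong) (simp add: power2_eq_square algebra_simps)
    also have "\<dots> = a * t\<^sup>2 - 2 * t * s * b + s\<^sup>2 * c"
      unfolding a_def b_def c_def word_exp_add word_exp_diff word_exp_cmult by simp
    finally show ?thesis .
  qed
  have a0: "0 \<le> a" unfolding a_def by (rule word_exp_nonneg) simp
  show ?thesis
  proof (cases "a = 0")
    case True
    have "b = 0"
    proof (rule ccontr)
      assume "b \<noteq> 0"
      \<comment> \<open>At this \<open>t\<close> and \<open>s = 1\<close> the form equals
        \<open>c - (c + 1) = -1\<close>.\<close>
      then show False using q[of "(c + 1) / (2 * b)" 1] True by simp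
    qed
    then show ?thesis using True by (simp add: a_def b_def c_def)
  next
    case False
    then have "0 < a" using a0 by simp
    have "0 \<le> a * (a * c - b\<^sup>2)"
      using q[of b a] by (simp add: power2_eq_square algebra_simps)
    then have "b\<^sup>2 \<le> a * c" using \<open>0 < a\<close> by (simp add: zero_le_mult_iff)
    then show ?thesis by (simp add: a_def b_def c_def)
  qed
qed

lemma word_exp_mult_le_sqrt:
  "\<bar>E n (\<lambda>xs. F xs * H xs)\<bar> \<le> sqrt (E n (\<lambda>xs. (F xs)\<^sup>2)) * sqrt (E n (\<lambda>xs. (H xs)\<^sup>2))"
  using real_sqrt_le_mono[OF Cauchy_Schwarz_word_exp[of n F H]] by (simp add: real_sqrt_mult)

lemma word_exp_abs_le_sqrt: "\<bar>E n F\<bar> \<le> sqrt (E n (\<lambda>xs. (F xs)\<^sup>2))"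
  using word_exp_mult_le_sqrt[of n F "\<lambda>_. 1"] by simp

lemma Minkowski_word_exp:
  "sqrt (E n (\<lambda>xs. (F xs + H xs)\<^sup>2)) \<le> sqrt (E n (\<lambda>xs. (F xs)\<^sup>2)) + sqrt (E n (\<lambda>xs. (H xs)\<^sup>2))"
proof -
  have nn: "0 \<le> E n (\<lambda>xs. (F xs)\<^sup>2)" "0 \<le> E n (\<lambda>xs. (H xs)\<^sup>2)"
    by (auto intro: word_exp_nonneg)
  have "E n (\<lambda>xs. (F xs + H xs)\<^sup>2) = E n (\<lambda>xs. (F xs)\<^sup>2 + 2 * (F xs * H xs) + (H xs)\<^sup>2)"
    by (rule word_exp_cong) (simp add: power2_eq_square algebra_simps)
  also have "\<dots> = E n (\<lambda>xs. (F xs)\<^sup>2) + 2 * E n (\<lambda>xs. F xs * H xs) + E n (\<lambda>xs. (H xs)\<^sup>2)"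
    by (simp add: word_exp_add word_exp_cmult[of _ _ _ 2])
  also have "\<dots> \<le> (sqrt (E n (\<lambda>xs. (F xs)\<^sup>2)) + sqrt (E n (\<lambda>xs. (H xs)\<^sup>2)))\<^sup>2"
    using word_exp_mult_le_sqrt[of n F H] nn by (simp add: power2_sum)
  finally show ?thesis
    by (intro real_le_lsqrt) (auto simp: nn)
qed

lemma word_exp_centered_square:
  "E n (\<lambda>xs. (F xs - E n F)\<^sup>2) = E n (\<lambda>xs. (F xs)\<^sup>2) - (E n F)\<^sup>2"
proof -
  have "E n (\<lambda>xs. (F xs - E n F)\<^sup>2) = E n (\<lambda>xs. (F xs)\<^sup>2 - (2 * E n F) * F xs + (E n F)\<^sup>2)"
    by (rule word_exp_cong) (simp add: power2_eq_square algebra_simps)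
  also have "\<dots> = E n (\<lambda>xs. (F xs)\<^sup>2) - (E n F)\<^sup>2"
    by (simp add: word_exp_add word_exp_diff word_exp_cmult power2_eq_square)
  finally show ?thesis .
qed

text \<open>Independent centred letters are orthogonal, so only the diagonal terms survive.\<close>

lemma word_exp_letters_square:
  assumes "(\<Sum>a\<in>S. p a * w a) = 0"
  shows "E n (\<lambda>xs. (\<Sum>x\<leftarrow>xs. w x)\<^sup>2) = real n * (\<Sum>a\<in>S. p a * (w a)\<^sup>2)"
proof (induction n)
  case (Suc n)
  have "E n (\<lambda>xs. (w a + (\<Sum>x\<leftarrow>xs. w x))\<^sup>2) = (w a)\<^sup>2 + real n * (\<Sum>a\<in>S. p a * (w a)\<^sup>2)" for a
  proof -
    have "E n (\<lambda>xs. (w a + (\<Sum>x\<leftarrow>xs. w x))\<^sup>2) =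
        E n (\<lambda>xs. (w a)\<^sup>2 + (2 * w a) * (\<Sum>x\<leftarrow>xs. w x) + (\<Sum>x\<leftarrow>xs. w x)\<^sup>2)"
      by (rule word_exp_cong) (simp add: power2_eq_square algebra_simps)
    then show ?thesis
      by (simp add: word_exp_add word_exp_cmult Suc word_exp_letters assms)
  qed
  then show ?case
    by (simp add: sum.distrib distrib_left) (simp add: distrib_right)
qed simp

text \<open>The square of \<open>\<Prod>(1 + w) - 1 - \<Sum>w\<close> is computed exactly from orthogonality.\<close>

lemma word_exp_density_remainder:
  assumes w0: "(\<Sum>a\<in>S. p a * w a) = 0" and v: "v = (\<Sum>a\<in>S. p a * (w a)\<^sup>2)"
  shows "E n (\<lambda>xs. (prod_list (map (\<lambda>a. 1 + w a) xs) - 1 - (\<Sum>x\<leftarrow>xs. w x))\<^sup>2) =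
    (1 + v) ^ n - 1 - real n * v"
proof -
  define \<Lambda> where "\<Lambda> xs = prod_list (map (\<lambda>a. 1 + w a) xs)" for xs
  define R where "R xs = (\<Sum>x\<leftarrow>xs. w x)" for xs
  have L1: "E n \<Lambda> = 1" for n
  proof (induction n)
    case (Suc n)
    have "E (Suc n) \<Lambda> = (\<Sum>a\<in>S. p a * (1 + w a))"
      using Suc unfolding \<Lambda>_def by (simp add: word_exp_cmult)
    then show ?case by (simp add: distrib_left sum.distrib w0 weights_sum)
  qed (simp add: \<Lambda>_def)
  have L2: "E n (\<lambda>xs. (\<Lambda> xs)\<^sup>2) = (1 + v) ^ n" for n
  proof (induction n)
    case (Suc n)
    have "E (Suc n) (\<lambda>xs. (\<Lambda> xs)\<^sup>2) = (\<Sum>a\<in>S. p a * (1 + w a)\<^sup>2 * (1 + v) ^ n)"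
      using Suc unfolding \<Lambda>_def by (simp add: word_exp_cmult power_mult_distrib mult.assoc)
    also have "\<dots> = (\<Sum>a\<in>S. p a * (1 + w a)\<^sup>2) * (1 + v) ^ n"
      by (simp add: sum_distrib_right)
    also have "(\<Sum>a\<in>S. p a * (1 + w a)\<^sup>2) = (\<Sum>a\<in>S. p a + 2 * (p a * w a) + p a * (w a)\<^sup>2)"
      by (rule sum.cong) (simp_all add: power2_eq_square algebra_simps)
    also have "\<dots> = 1 + v"
      by (simp add: sum.distrib weights_sum v sum_distrib_left[symmetric] w0)
    finally show ?case by simp
  qed (simp add: \<Lambda>_def)
  have R1: "E n R = 0" for n
    unfolding R_def by (simp add: word_exp_letters w0)
  have R2: "E n (\<lambda>xs. (R xs)\<^sup>2) = real n * v" for n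
    unfolding R_def v by (rule word_exp_letters_square[OF w0])
  have LR: "E n (\<lambda>xs. \<Lambda> xs * R xs) = real n * v" for n
  proof (induction n)
    case (Suc n)
    have "E n (\<lambda>xs. \<Lambda> (a # xs) * R (a # xs)) = (1 + w a) * (w a + real n * v)" for a
    proof -
      have "E n (\<lambda>xs. \<Lambda> (a # xs) * R (a # xs)) =
          E n (\<lambda>xs. ((1 + w a) * w a) * \<Lambda> xs + (1 + w a) * (\<Lambda> xs * R xs))"
        by (rule word_exp_cong) (simp add: \<Lambda>_def R_def algebra_simps)
      then show ?thesis
        unfolding word_exp_add word_exp_cmult L1 Suc by (simp add: distrib_left)
    qed
    then have "E (Suc n) (\<lambda>xs. \<Lambda> xs * R xs) = (\<Sum>a\<in>S. p a * ((1 + w a) * (w a + real n * v)))"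
      by simp
    also have "\<dots> = (\<Sum>a\<in>S. p a * w a + p a * (w a)\<^sup>2 + real n * v * p a + real n * v * (p a * w a))"
      by (rule sum.cong) (simp_all add: power2_eq_square algebra_simps)
    also have "\<dots> = v + real n * v"
      by (simp add: sum.distrib sum_distrib_left[symmetric] w0 v weights_sum)
    finally show ?case by (simp add: algebra_simps)
  qed (simp add: \<Lambda>_def R_def)
  have "E n (\<lambda>xs. (\<Lambda> xs - 1 - R xs)\<^sup>2) =
      E n (\<lambda>xs. (\<Lambda> xs)\<^sup>2 + 1 + (R xs)\<^sup>2 - 2 * \<Lambda> xs - 2 * (\<Lambda> xs * R xs) + 2 * R xs)"
    by (rule word_exp_cong) (simp add: power2_eq_square algebra_simps)
  also have "\<dots> = (1 + v) ^ n - 1 - real n * v"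
    by (simp add: word_exp_add word_exp_diff word_exp_cmult[of _ _ _ 2] L1 L2 R1 R2 LR)
  finally show ?thesis by (simp add: \<Lambda>_def R_def)
qed

end

section \<open>Words in a group and the word metric\<close>

definition word_prod :: "('a, 'b) monoid_scheme \<Rightarrow> 'a list \<Rightarrow> 'a" where
  "word_prod G ws = foldr (mult G) ws \<one>\<^bsub>G\<^esub>"

lemma word_prod_Nil [simp]: "word_prod G [] = \<one>\<^bsub>G\<^esub>"
  and word_prod_Cons [simp]: "word_prod G (a # ws) = a \<otimes>\<^bsub>G\<^esub> word_prod G ws"
  by (simp_all add: word_prod_def)

context group
begin

lemma word_prod_closed [simp, intro]: "set ws \<subseteq> carrier G \<Longrightarrow> word_prod G ws \<in> carrier G"
  by (induction ws) auto

lemma word_prod_append: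
  "set xs \<subseteq> carrier G \<Longrightarrow> set ys \<subseteq> carrier G \<Longrightarrow>
    word_prod G (xs @ ys) = word_prod G xs \<otimes> word_prod G ys"
  by (induction xs) (auto simp: m_assoc)

lemma inv_word_prod:
  "set ws \<subseteq> carrier G \<Longrightarrow> inv (word_prod G ws) = word_prod G (rev (map (m_inv G) ws))"
proof (induction ws)
  case (Cons a ws)
  then have "set (rev (map (m_inv G) ws)) \<subseteq> carrier G" by auto
  with Cons show ?case by (simp add: word_prod_append inv_mult_group)
qed simp

lemma generate_word:
  assumes "S \<subseteq> carrier G" and "x \<in> generate G S"
  shows "\<exists>ws. set ws \<subseteq> S \<union> m_inv G ` S \<and> word_prod G ws = x"
  using assms(2)
proof induction
  case one
  show ?case by (rule exI[of _ "[]"]) simp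
next
  case (incl h)
  then show ?case using assms by (intro exI[of _ "[h]"]) auto
next
  case (inv h)
  then show ?case using assms by (intro exI[of _ "[inv h]"]) auto
next
  case (eng h1 h2)
  then obtain xs ys where "set xs \<subseteq> S \<union> m_inv G ` S" "word_prod G xs = h1"
    "set ys \<subseteq> S \<union> m_inv G ` S" "word_prod G ys = h2" by blast
  moreover have "S \<union> m_inv G ` S \<subseteq> carrier G" using assms by auto
  ultimately have "word_prod G (xs @ ys) = h1 \<otimes> h2"
    using word_prod_append[of xs ys] by blast
  with \<open>set xs \<subseteq> _\<close> \<open>set ys \<subseteq> _\<close> show ?case by (intro exI[of _ "xs @ ys"]) auto
qed

end

text \<open>\<open>T\<close> is the generating set that will witness hyperbolicity. It is unrelated
  to the support \<open>S\<close> of the walk, so lengths with respect to the two sets are compared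
  later.\<close>

locale word_metric_group = group G for G :: "('a, 'b) monoid_scheme" (structure) +
  fixes T :: "'a set"
  assumes finite_T: "finite T" and T_carrier: "T \<subseteq> carrier G"
    and generate_T: "generate G T = carrier G"
begin

abbreviation letters :: "'a set" where "letters \<equiv> T \<union> m_inv G ` T"
abbreviation wl :: "'a \<Rightarrow> nat" where "wl \<equiv> word_length G T"

lemma letters_carrier: "letters \<subseteq> carrier G"
  using T_carrier by auto

lemma inv_letters: "a \<in> letters \<Longrightarrow> inv a \<in> letters"
  using T_carrier by (auto simp: subset_iff)

lemma word_length_word_le:
  "set ws \<subseteq> letters \<Longrightarrow> wl (word_prod G ws) \<le> length ws"
  unfolding word_length_def word_prod_def by (rule Least_le) auto

lemma shortest_word:
  assumes "x \<in> carrier G"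
  obtains ws where "length ws = wl x" "set ws \<subseteq> letters" "word_prod G ws = x"
proof -
  have "\<exists>n ws. length ws = n \<and> set ws \<subseteq> letters \<and> foldr (mult G) ws \<one> = x"
    using generate_word[OF T_carrier, of x] assms by (auto simp: generate_T word_prod_def)
  from LeastI_ex[OF this] show ?thesis
    using that unfolding word_length_def word_prod_def by blast
qed

lemma word_length_one [simp]: "wl \<one> = 0"
  using word_length_word_le[of "[]"] by simp

lemma word_length_mult:
  assumes "x \<in> carrier G" "y \<in> carrier G"
  shows "wl (x \<otimes> y) \<le> wl x + wl y"
proof -
  obtain xs ys where w: "length xs = wl x" "set xs \<subseteq> letters" "word_prod G xs = x"
    "length ys = wl y" "set ys \<subseteq> letters" "word_prod G ys = y"
    using assms by (metis shortest_word)
  then have "word_prod G (xs @ ys) = x \<otimes> y"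
    using letters_carrier by (subst word_prod_append) auto
  then show ?thesis using word_length_word_le[of "xs @ ys"] w by auto
qed

lemma word_length_inv_le:
  assumes "x \<in> carrier G"
  shows "wl (inv x) \<le> wl x"
proof -
  obtain xs where w: "length xs = wl x" "set xs \<subseteq> letters" "word_prod G xs = x"
    using assms by (metis shortest_word)
  then have "inv x = word_prod G (rev (map (m_inv G) xs))"
    using inv_word_prod letters_carrier by blast
  moreover have "set (rev (map (m_inv G) xs)) \<subseteq> letters"
    using w inv_letters by auto
  ultimately show ?thesis using word_length_word_le[of "rev (map (m_inv G) xs)"] w by simp
qed

lemma word_length_inv: "x \<in> carrier G \<Longrightarrow> wl (inv x) = wl x"
  using word_length_inv_le[of x] word_length_inv_le[of "inv x"] by simp

definition wd :: "'a \<Rightarrow> 'a \<Rightarrow> nat" where "wd x y = wl (inv x \<otimes> y)"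

lemma word_dist_eq: "word_dist G T x y = real (wd x y)"
  by (simp add: word_dist_def wd_def)

lemma wd_self [simp]: "x \<in> carrier G \<Longrightarrow> wd x x = 0"
  by (simp add: wd_def)

lemma wd_sym: "x \<in> carrier G \<Longrightarrow> y \<in> carrier G \<Longrightarrow> wd x y = wd y x"
  unfolding wd_def using word_length_inv[of "inv x \<otimes> y"] by (simp add: inv_mult_group)

lemma mult_cancel_middle:
  "x \<in> carrier G \<Longrightarrow> y \<in> carrier G \<Longrightarrow> z \<in> carrier G \<Longrightarrow> (x \<otimes> y) \<otimes> (inv y \<otimes> z) = x \<otimes> z"
  by (metis inv_closed m_assoc m_closed r_inv r_one)

lemma wd_triangle:
  assumes "x \<in> carrier G" "y \<in> carrier G" "z \<in> carrier G"
  shows "wd x z \<le> wd x y + wd y z"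
  using word_length_mult[of "inv x \<otimes> y" "inv y \<otimes> z"] assms mult_cancel_middle[of "inv x" y z]
  by (simp add: wd_def)

lemma wd_right_mult: "x \<in> carrier G \<Longrightarrow> a \<in> carrier G \<Longrightarrow> wd x (x \<otimes> a) = wl a"
  by (simp add: wd_def m_assoc[symmetric])

lemma finite_words_le: "finite {ws. set ws \<subseteq> letters \<and> length ws \<le> r}"
  using finite_lists_length_le[of letters r] finite_T by auto

lemma card_words_le: "card {ws. set ws \<subseteq> letters \<and> length ws \<le> r} \<le> (card letters + 1) ^ r"
proof -
  have "card {ws. set ws \<subseteq> letters \<and> length ws \<le> r} = (\<Sum>i\<le>r. card letters ^ i)"
    using card_lists_length_le[of letters r] finite_T by auto
  also have "\<dots> \<le> (card letters + 1) ^ r"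
  proof (induction r)
    case (Suc r)
    have "card letters ^ Suc r \<le> card letters * (card letters + 1) ^ r"
      unfolding power_Suc by (intro mult_left_mono power_mono) auto
    from add_mono[OF Suc this] show ?case by simp
  qed simp
  finally show ?thesis .
qed

lemma ball_subset: "{x \<in> carrier G. wl x \<le> r} \<subseteq> word_prod G ` {ws. set ws \<subseteq> letters \<and> length ws \<le> r}"
proof
  fix x assume x: "x \<in> {x \<in> carrier G. wl x \<le> r}"
  then obtain ws where "length ws = wl x" "set ws \<subseteq> letters" "word_prod G ws = x"
    by (metis (mono_tags, lifting) mem_Collect_eq shortest_word)
  then show "x \<in> word_prod G ` {ws. set ws \<subseteq> letters \<and> length ws \<le> r}" using x by auto
qed

lemma finite_ball: "finite {x \<in> carrier G. wl x \<le> r}"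
  using finite_subset[OF ball_subset] finite_words_le by blast

lemma card_ball: "card {x \<in> carrier G. wl x \<le> r} \<le> (card letters + 1) ^ r"
  by (rule order_trans[OF card_mono[OF finite_imageI[OF finite_words_le] ball_subset]
        order_trans[OF card_image_le[OF finite_words_le] card_words_le]])

lemma ball_translate:
  assumes "c \<in> carrier G"
  shows "{w \<in> carrier G. wd c w \<le> r} = (\<lambda>x. c \<otimes> x) ` {x \<in> carrier G. wl x \<le> r}"
proof (intro equalityI subsetI)
  fix w assume w: "w \<in> {w \<in> carrier G. wd c w \<le> r}"
  then have "w = c \<otimes> (inv c \<otimes> w)" using assms by (simp add: m_assoc[symmetric])
  moreover have "inv c \<otimes> w \<in> {x \<in> carrier G. wl x \<le> r}" using w assms by (simp add: wd_def)
  ultimately show "w \<in> (\<lambda>x. c \<otimes> x) ` {x \<in> carrier G. wl x \<le> r}" by blast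
qed (use assms in \<open>auto simp: wd_right_mult\<close>)

lemma finite_wd_ball: "c \<in> carrier G \<Longrightarrow> finite {w \<in> carrier G. wd c w \<le> r}"
  by (simp add: ball_translate finite_ball)

lemma card_wd_ball: "c \<in> carrier G \<Longrightarrow> card {w \<in> carrier G. wd c w \<le> r} \<le> (card letters + 1) ^ r"
  unfolding ball_translate by (rule order_trans[OF card_image_le[OF finite_ball] card_ball])

text \<open>The witness is the sequence of partial products of a shortest word.\<close>

lemma geodesic:
  assumes "x \<in> carrier G" "y \<in> carrier G"
  obtains f where "f 0 = x" "f (wd x y) = y" "\<And>i. f i \<in> carrier G"
    "\<And>i. wd (f i) (f (Suc i)) \<le> 1" "\<And>i. i \<le> wd x y \<Longrightarrow> wd x (f i) + wd (f i) y \<le> wd x y"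
proof -
  obtain ws where ws: "length ws = wd x y" "set ws \<subseteq> letters" "word_prod G ws = inv x \<otimes> y"
    unfolding wd_def using assms by (metis inv_closed m_closed shortest_word)
  define f where "f i = x \<otimes> word_prod G (take i ws)" for i
  have sub: "set (take i ws) \<subseteq> letters" "set (drop i ws) \<subseteq> letters" for i
    using ws(2) by (meson order_trans set_take_subset set_drop_subset)+
  then have car: "set (take i ws) \<subseteq> carrier G" "set (drop i ws) \<subseteq> carrier G" for i
    using letters_carrier by (meson order_trans)+
  have fc: "f i \<in> carrier G" for i using car assms by (simp add: f_def)
  have y: "y = x \<otimes> word_prod G ws" using assms ws(3) by (simp add: m_assoc[symmetric])
  have step: "wd (f i) (f (Suc i)) \<le> 1" for i
  proof (cases "i < length ws")
    case True
    then have t: "take (Suc i) ws = take i ws @ [ws ! i]" by (simp add: take_Suc_conv_app_nth)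
    have a: "ws ! i \<in> letters" using True ws(2) nth_mem by blast
    then have ac: "ws ! i \<in> carrier G" using letters_carrier by blast
    have "f (Suc i) = f i \<otimes> ws ! i"
      unfolding f_def t using car[of i] assms ac by (subst word_prod_append) (auto simp: m_assoc)
    then have "wd (f i) (f (Suc i)) = wl (ws ! i)" using fc[of i] ac by (simp add: wd_right_mult)
    also have "\<dots> \<le> 1" using word_length_word_le[of "[ws ! i]"] a ac by simp
    finally show ?thesis .
  next
    case False
    then show ?thesis using fc[of i] by (simp add: f_def)
  qed
  have "wd x (f i) + wd (f i) y \<le> wd x y" if "i \<le> wd x y" for i
  proof -
    have "wd x (f i) \<le> i"
      using word_length_word_le[OF sub(1)[of i]] assms car[of i] ws that by (simp add: f_def wd_right_mult)
    moreover have "y = f i \<otimes> word_prod G (drop i ws)"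
      unfolding y f_def using word_prod_append[OF car[of i]] car[of i] assms by (simp add: m_assoc)
    then have "wd (f i) y \<le> wd x y - i"
      using word_length_word_le[OF sub(2)[of i]] fc[of i] car[of i] ws by (simp add: wd_right_mult)
    ultimately show ?thesis using that by linarith
  qed
  then show ?thesis
    using that[of f] fc step y ws(1) assms by (simp add: f_def)
qed

end

section \<open>Triangles of paths in a hyperbolic group\<close>

locale hyperbolic_word_metric = word_metric_group +
  fixes \<delta> :: nat
  assumes four_point: "w \<in> carrier G \<Longrightarrow> x \<in> carrier G \<Longrightarrow> y \<in> carrier G \<Longrightarrow> z \<in> carrier G \<Longrightarrow>
    min (gromov_product (word_dist G T) w x y) (gromov_product (word_dist G T) w y z) - real \<delta>
      \<le> gromov_product (word_dist G T) w x z"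
begin

abbreviation gpr :: "'a \<Rightarrow> 'a \<Rightarrow> 'a \<Rightarrow> real" where "gpr \<equiv> gromov_product (word_dist G T)"

lemma gpr_eq: "gpr w x y = (real (wd w x) + real (wd w y) - real (wd x y)) / 2"
  by (simp add: gromov_product_def word_dist_eq)

lemma gpr_sym: "x \<in> carrier G \<Longrightarrow> y \<in> carrier G \<Longrightarrow> gpr w x y = gpr w y x"
  by (simp add: gpr_eq wd_sym)

text \<open>Bisecting the path applies the four-point inequality along a binary tree of depth
  \<open>k\<close>, so the loss is \<open>\<delta>\<close> per level and not per step. This is the
  source of all logarithms below.\<close>

lemma gromov_product_dyadic:
  fixes f :: "nat \<Rightarrow> 'a"
  assumes w: "w \<in> carrier G" and f: "\<And>i. f i \<in> carrier G"
    and step: "\<And>i. a \<le> i \<Longrightarrow> i < b \<Longrightarrow> m \<le> gpr w (f i) (f (Suc i))"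
    and fin: "m \<le> real (wd w (f a))" and ab: "a \<le> b" "b - a \<le> 2 ^ k"
  shows "m - real (k * \<delta>) \<le> gpr w (f a) (f b)"
  using step fin ab
proof (induction k arbitrary: a b)
  case 0
  then consider "b = a" | "b = Suc a" by fastforce
  then show ?case
  proof cases
    case 1
    then show ?thesis using 0 f by (simp add: gpr_eq)
  next
    case 2
    then show ?thesis using 0 by simp
  qed
next
  case (Suc k)
  define c where "c = a + (b - a) div 2"
  have c: "a \<le> c" "c \<le> b" "c - a \<le> 2 ^ k" "b - c \<le> 2 ^ k" using Suc.prems by (auto simp: c_def)
  have le: "gpr w x y \<le> real (wd w y)" if "x \<in> carrier G" "y \<in> carrier G" for x y
  proof -
    have "wd w x \<le> wd w y + wd x y" using wd_triangle[of w y x] wd_sym[of x y] that w by simp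
    then show ?thesis by (simp add: gpr_eq)
  qed
  have 1: "m - real (k * \<delta>) \<le> gpr w (f a) (f c)"
    using Suc.prems c by (intro Suc.IH) auto
  \<comment> \<open>The right half may consist of a single point, where the Gromov product is the
    distance to \<open>w\<close> itself; hence the condition on the left end point must be passed
    on. A Gromov product never exceeds the distance to either end point.\<close>
  have endc: "m \<le> real (wd w (f c))"
  proof (cases "c = a")
    case False
    then have "a \<le> c - 1" "c - 1 < b" "Suc (c - 1) = c" using c by auto
    then show ?thesis using Suc.prems(1)[of "c - 1"] le[of "f (c - 1)" "f c"] f by force
  qed (use Suc.prems in simp)
  have 2: "m - real (k * \<delta>) \<le> gpr w (f c) (f b)"
    using Suc.prems c endc by (intro Suc.IH) auto
  from 1 2 four_point[OF w f[of a] f[of c] f[of b]] show ?case by (simp add: algebra_simps min_def split: if_splits)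
qed

text \<open>If the path stays at distance at least m from \<open>w\<close>, consecutive points have
  Gromov product at least m - R, and by bisection so do the end points up to
  \<open>k * \<delta>\<close>. Applying this with m the minimal distance bounds m by the Gromov
  product of the end points.\<close>

lemma path_approaches:
  fixes f :: "nat \<Rightarrow> 'a"
  assumes w: "w \<in> carrier G" and f: "\<And>i. f i \<in> carrier G"
    and step: "\<And>i. i < L \<Longrightarrow> wd (f i) (f (Suc i)) \<le> R" and L: "L \<le> 2 ^ k"
  obtains i where "i \<le> L" "real (wd w (f i)) \<le> gpr w (f 0) (f L) + real (R + k * \<delta>)"
proof -
  obtain i where i: "i \<le> L" "\<And>j. j \<le> L \<Longrightarrow> wd w (f i) \<le> wd w (f j)"
    using ex_min_if_finite[of "(\<lambda>i. wd w (f i)) ` {..L}"] by (auto simp: not_less)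
  have "real (wd w (f i)) - real R \<le> gpr w (f j) (f (Suc j))" if "j < L" for j
  proof -
    have "wd w (f j) \<ge> wd w (f i)" "wd w (f (Suc j)) \<ge> wd w (f i)" "wd (f j) (f (Suc j)) \<le> R"
      using i that step by auto
    then show ?thesis by (simp add: gpr_eq)
  qed
  moreover have "real (wd w (f i)) - real R \<le> real (wd w (f 0))" using i(2)[of 0] by simp
  ultimately have "real (wd w (f i)) - real R - real (k * \<delta>) \<le> gpr w (f 0) (f L)"
    using L by (intro gromov_product_dyadic w f) auto
  then show ?thesis using that[of i] i(1) by simp
qed

text \<open>Along a geodesic from \<open>x\<close> to \<open>y\<close> the difference
  \<open>\<phi>\<close> of the other two Gromov products changes sign and moves by at most 1 per
  step. At the first nonnegative value the two products almost agree, and the four-point inequality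
  bounds the smaller one by the product of \<open>x\<close> and \<open>y\<close>, which is at most 0
  on the geodesic, plus \<open>\<delta>\<close>.\<close>

lemma triangle_center:
  assumes x: "x \<in> carrier G" and y: "y \<in> carrier G" and z: "z \<in> carrier G"
  obtains c where "c \<in> carrier G" "gpr c x y \<le> real (\<delta> + 1)" "gpr c x z \<le> real (\<delta> + 1)"
    "gpr c y z \<le> real (\<delta> + 1)"
proof -
  obtain f where f: "f 0 = x" "f (wd x y) = y" "\<And>i. f i \<in> carrier G"
    "\<And>i. wd (f i) (f (Suc i)) \<le> 1" "\<And>i. i \<le> wd x y \<Longrightarrow> wd x (f i) + wd (f i) y \<le> wd x y"
    using geodesic[OF x y] by metis
  define \<phi> where "\<phi> i = gpr (f i) x z - gpr (f i) y z" for i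
  have \<phi>: "\<phi> i = (real (wd (f i) x) - real (wd (f i) y) - real (wd x z) + real (wd y z)) / 2" for i
    by (simp add: \<phi>_def gpr_eq field_simps)
  have fin: "0 \<le> \<phi> (wd x y)"
    unfolding \<phi> f(2) using wd_triangle[OF x y z] wd_sym[OF x y] y by simp
  define i where "i = (LEAST i. 0 \<le> \<phi> i)"
  have i0: "0 \<le> \<phi> i" and il: "i \<le> wd x y" and il2: "\<And>j. j < i \<Longrightarrow> \<phi> j < 0"
    unfolding i_def by (rule LeastI[of "\<lambda>i. 0 \<le> \<phi> i", OF fin], rule Least_le[of "\<lambda>i. 0 \<le> \<phi> i", OF fin])
      (metis not_le not_less_Least)
  have "\<phi> i \<le> 1"
  proof (cases i)
    case 0
    have "\<phi> 0 \<le> 0" unfolding \<phi> f(1) using wd_triangle[OF y x z] wd_sym[OF x y] x by simp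
    then show ?thesis using 0 by simp
  next
    case (Suc j)
    have "wd (f i) x \<le> wd (f j) x + 1" "wd (f j) y \<le> wd (f i) y + 1"
      using wd_triangle[OF f(3)[of i] f(3)[of j] x] wd_triangle[OF f(3)[of j] f(3)[of i] y] f(4)[of j]
        wd_sym[OF f(3)[of i] f(3)[of j]] Suc by auto
    then have "\<phi> i \<le> \<phi> j + 1" unfolding \<phi> by (simp add: field_simps)
    then show ?thesis using il2[of j] Suc by simp
  qed
  then have d: "gpr (f i) x z \<le> gpr (f i) y z + 1" "gpr (f i) y z \<le> gpr (f i) x z"
    using i0 by (auto simp: \<phi>_def)
  have xy: "gpr (f i) x y \<le> 0"
    using f(5)[OF il] wd_sym[OF f(3)[of i] x] by (simp add: gpr_eq)
  have "gpr (f i) y z - real \<delta> \<le> gpr (f i) x y"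
    using four_point[OF f(3)[of i] x z y] d(2) gpr_sym[OF y z, of "f i"] by simp
  with d xy show ?thesis by (intro that[OF f(3)[of i]]) auto
qed

end

section \<open>Step probabilities and the Green function\<close>

definition step_prob :: "('a, 'b) monoid_scheme \<Rightarrow> 'a set \<Rightarrow> ('a \<Rightarrow> real) \<Rightarrow> nat \<Rightarrow> 'a \<Rightarrow> real" where
  "step_prob G S p n x = word_exp S p n (\<lambda>ws. of_bool (word_prod G ws = x))"

definition green :: "('a, 'b) monoid_scheme \<Rightarrow> 'a set \<Rightarrow> ('a \<Rightarrow> real) \<Rightarrow> 'a \<Rightarrow> real" where
  "green G S p x = (\<Sum>n. step_prob G S p n x)"

text \<open>The distance from the identity to \<open>x\<close> in the Green metric of
  \<open>p\<close>.\<close>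

definition green_norm :: "('a, 'b) monoid_scheme \<Rightarrow> 'a set \<Rightarrow> ('a \<Rightarrow> real) \<Rightarrow> 'a \<Rightarrow> real" where
  "green_norm G S p x = ln (green G S p \<one>\<^bsub>G\<^esub>) - ln (green G S p x)"

locale walk_group = group G for G :: "('a, 'b) monoid_scheme" (structure) +
  fixes S :: "'a set"
  assumes finite_S: "finite S" and S_carrier: "S \<subseteq> carrier G"
    and inv_S: "a \<in> S \<Longrightarrow> inv a \<in> S" and generate_S: "generate G S = carrier G"
begin

abbreviation u :: "('a \<Rightarrow> real) \<Rightarrow> nat \<Rightarrow> 'a \<Rightarrow> real" where "u \<equiv> step_prob G S"

lemma word_carrier [simp]: "set ws \<subseteq> S \<Longrightarrow> set ws \<subseteq> carrier G"
  using S_carrier by blast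

lemma word_over_S:
  assumes "x \<in> carrier G"
  obtains ws where "set ws \<subseteq> S" "word_prod G ws = x"
proof -
  have "S \<union> m_inv G ` S = S" using inv_S by auto
  then show ?thesis using generate_word[OF S_carrier, of x] assms generate_S that by auto
qed

lemma finite_words: "finite {ws. set ws \<subseteq> S \<and> length ws = n}"
  by (rule finite_lists_length_eq[OF finite_S])

lemma countable_carrier: "countable (carrier G)"
proof -
  have "carrier G \<subseteq> word_prod G ` lists S"
    by (smt (verit, best) image_eqI in_listsI subset_eq word_over_S)
  then show ?thesis
    using countable_subset countable_image countable_lists countable_finite[OF finite_S] by metis
qed

lemma step_prob_Suc:
  assumes "x \<in> carrier G"
  shows "u p (Suc n) x = (\<Sum>a\<in>S. p a * u p n (inv a \<otimes> x))"
proof -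
  have "word_exp S p n (\<lambda>ws. of_bool (a \<otimes> word_prod G ws = x)) = u p n (inv a \<otimes> x)" if "a \<in> S" for a
    unfolding step_prob_def
  proof (rule word_exp_cong)
    fix ws assume "set ws \<subseteq> S"
    then have "word_prod G ws \<in> carrier G" by simp
    then have "a \<otimes> word_prod G ws = x \<longleftrightarrow> word_prod G ws = inv a \<otimes> x"
      using that S_carrier assms by (metis inv_solve_left subsetD)
    then show "of_bool (a \<otimes> word_prod G ws = x) = (of_bool (word_prod G ws = inv a \<otimes> x) :: real)" by simp
  qed
  then show ?thesis by (simp add: step_prob_def)
qed

lemma step_prob_0: "u p 0 x = of_bool (x = \<one>)"
  by (auto simp: step_prob_def)

text \<open>\<open>A\<close> only has to catch the end points at which \<open>f\<close> does not
  vanish, so a ball serves when \<open>f\<close> is its indicator.\<close>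

lemma word_exp_word_prod:
  assumes "finite A" and "\<And>ws. set ws \<subseteq> S \<Longrightarrow> length ws = n \<Longrightarrow> f (word_prod G ws) \<noteq> 0 \<Longrightarrow> word_prod G ws \<in> A"
  shows "word_exp S p n (\<lambda>ws. f (word_prod G ws)) = (\<Sum>x\<in>A. u p n x * f x)"
proof -
  have "word_exp S p n (\<lambda>ws. f (word_prod G ws)) =
      word_exp S p n (\<lambda>ws. \<Sum>x\<in>A. of_bool (word_prod G ws = x) * f x)"
  proof (rule word_exp_cong)
    fix ws assume ws: "length ws = n" "set ws \<subseteq> S"
    have "(\<Sum>x\<in>A. of_bool (word_prod G ws = x) * f x) =
        (\<Sum>x\<in>A. if word_prod G ws = x then f (word_prod G ws) else 0)"
      by (rule sum.cong) auto
    also have "\<dots> = f (word_prod G ws)" using assms ws by auto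
    finally show "f (word_prod G ws) = (\<Sum>x\<in>A. of_bool (word_prod G ws = x) * f x)" by simp
  qed
  also have "\<dots> = (\<Sum>x\<in>A. u p n x * f x)"
    unfolding word_exp_sum step_prob_def by (simp add: word_exp_cmult_right)
  finally show ?thesis .
qed

lemma step_prob_eq_0: "(\<And>ws. set ws \<subseteq> S \<Longrightarrow> length ws = n \<Longrightarrow> word_prod G ws \<noteq> x) \<Longrightarrow> u p n x = 0"
  unfolding step_prob_def using word_exp_cong[of n S "\<lambda>ws. of_bool (word_prod G ws = x)" "\<lambda>_. 0" p] by auto

lemma step_prob_split:
  assumes "z \<in> carrier G"
  shows "u p (n + m) z = word_exp S p n (\<lambda>ws. u p m (inv (word_prod G ws) \<otimes> z))"
  unfolding step_prob_def word_exp_append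
proof (intro word_exp_cong)
  fix xs ys assume "set xs \<subseteq> S" "set ys \<subseteq> S"
  then have "word_prod G (xs @ ys) = word_prod G xs \<otimes> word_prod G ys"
    "word_prod G xs \<in> carrier G" "word_prod G ys \<in> carrier G"
    by (auto simp: word_prod_append)
  then have "word_prod G (xs @ ys) = z \<longleftrightarrow> word_prod G ys = inv (word_prod G xs) \<otimes> z"
    using assms by (metis inv_solve_left)
  then show "of_bool (word_prod G (xs @ ys) = z) = (of_bool (word_prod G ys = inv (word_prod G xs) \<otimes> z) :: real)"
    by simp
qed

end

locale weighted_walk_group = walk_group G S + word_weights S p
  for G :: "('a, 'b) monoid_scheme" (structure) and S p
begin

lemma step_prob_nonneg: "0 \<le> u p n x"
  unfolding step_prob_def by (rule word_exp_nonneg) simp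

lemma sum_step_prob_le_1: "finite A \<Longrightarrow> (\<Sum>x\<in>A. u p n x) \<le> 1"
  unfolding step_prob_def word_exp_sum[symmetric]
  by (rule word_exp_le_const) (simp add: of_bool_def if_distrib sum.delta cong: if_cong)

text \<open>A word for \<open>x\<close> followed by a word for \<open>y\<close> is a word for the
  product.\<close>

lemma step_prob_mult_le:
  assumes x: "x \<in> carrier G" and y: "y \<in> carrier G"
  shows "u p n x * u p m y \<le> u p (n + m) (x \<otimes> y)"
proof -
  have "u p n x * u p m y = word_exp S p n (\<lambda>ws. of_bool (word_prod G ws = x) * u p m y)"
    by (simp add: word_exp_cmult_right step_prob_def)
  also have "\<dots> \<le> word_exp S p n (\<lambda>ws. u p m (inv (word_prod G ws) \<otimes> (x \<otimes> y)))"
    by (rule word_exp_mono) (use x y in \<open>auto simp: step_prob_nonneg m_assoc[symmetric]\<close>)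
  also have "\<dots> = u p (n + m) (x \<otimes> y)" using x y by (simp add: step_prob_split)
  finally show ?thesis .
qed

lemma step_prob_word_ge:
  assumes "\<And>a. a \<in> S \<Longrightarrow> \<epsilon> \<le> p a" "0 \<le> \<epsilon>" "set ws \<subseteq> S"
  shows "\<epsilon> ^ length ws \<le> u p (length ws) (word_prod G ws)"
  using assms(3)
proof (induction ws)
  case Nil
  then show ?case by (simp add: step_prob_0)
next
  case (Cons a ws)
  then have a: "a \<in> S" "a \<in> carrier G" and ws: "word_prod G ws \<in> carrier G" using S_carrier by auto
  have "\<epsilon> * \<epsilon> ^ length ws \<le> p a * u p (length ws) (word_prod G ws)"
    using Cons assms by (intro mult_mono) (auto intro: weights_nonneg)
  also have "\<dots> = p a * u p (length ws) (inv a \<otimes> (a \<otimes> word_prod G ws))"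
    using a ws by (simp add: m_assoc[symmetric])
  also have "\<dots> \<le> (\<Sum>a'\<in>S. p a' * u p (length ws) (inv a' \<otimes> (a \<otimes> word_prod G ws)))"
    using a finite_S by (intro member_le_sum) (auto intro!: mult_nonneg_nonneg step_prob_nonneg weights_nonneg)
  also have "\<dots> = u p (Suc (length ws)) (a \<otimes> word_prod G ws)"
    using a ws by (simp add: step_prob_Suc)
  finally show ?case by simp
qed

end

text \<open>The left side sums over a triangle of index pairs inside the square on the
  right.\<close>

lemma sum_convolution_le:
  fixes f g :: "nat \<Rightarrow> real"
  assumes "\<And>i. 0 \<le> f i" "\<And>i. 0 \<le> g i"
  shows "(\<Sum>k<M. \<Sum>i\<le>k. f i * g (k - i)) \<le> (\<Sum>i<M. f i) * (\<Sum>i<M. g i)"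
proof -
  have "(\<Sum>k<M. \<Sum>i\<le>k. f i * g (k - i)) = (\<Sum>(i, j)\<in>{(i, j). i + j < M}. f i * g j)"
    by (rule sum.triangle_reindex[symmetric])
  also have "\<dots> \<le> (\<Sum>(i, j)\<in>{..<M} \<times> {..<M}. f i * g j)"
    by (rule sum_mono2) (auto intro!: mult_nonneg_nonneg assms)
  also have "\<dots> = (\<Sum>i<M. f i) * (\<Sum>i<M. g i)"
    by (simp add: sum_product sum.cartesian_product)
  finally show ?thesis .
qed

text \<open>The class of step distributions over which all estimates are uniform.\<close>

locale transient_walks = walk_group G S
  for G :: "('a, 'b) monoid_scheme" (structure) and S +
  fixes \<epsilon> C\<^sub>0 \<rho> :: real
  assumes eps_pos: "0 < \<epsilon>" and C0_pos: "0 < C\<^sub>0" and rho: "0 < \<rho>" "\<rho> < 1"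
begin

text \<open>The exponential bound is imposed on the step probabilities themselves, with constants
  fixed in advance: in this form it passes from \<open>\<mu>\<^sub>0\<close> to nearby weights by
  domination, see \<open>word_exp_mono_weights\<close>.\<close>

definition admissible :: "('a \<Rightarrow> real) \<Rightarrow> bool" where
  "admissible p \<longleftrightarrow> word_weights S p \<and> (\<forall>a\<in>S. \<epsilon> \<le> p a) \<and>
    (\<forall>n. \<forall>x\<in>carrier G. u p n x \<le> C\<^sub>0 * \<rho> ^ n)"

lemma admissible_walk: "admissible p \<Longrightarrow> weighted_walk_group G S p"
  by (simp add: admissible_def weighted_walk_group_def walk_group_axioms)

abbreviation green_bound :: real where "green_bound \<equiv> C\<^sub>0 / (1 - \<rho>)"

text \<open>An element reached by \<open>N\<close> letters has Green function at least
  \<open>\<epsilon> ^ N\<close>. The factor makes the tail of the Green series beyond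
  \<open>2 ^ truncation_factor * N\<close> at most half of that. A power of two is convenient
  because only the logarithm of the path length enters the width of the corridor.\<close>

definition truncation_factor :: nat where
  "truncation_factor = (SOME k. green_bound * \<rho> ^ (2 ^ k) \<le> \<epsilon> / 2 \<and> \<rho> ^ (2 ^ k) \<le> \<epsilon>)"

lemma truncation_factor:
  assumes "1 \<le> N"
  shows "green_bound * \<rho> ^ (2 ^ truncation_factor * N) \<le> \<epsilon> ^ N / 2"
proof -
  have "(\<lambda>k. \<rho> ^ k) \<longlonglongrightarrow> 0" using rho by (intro LIMSEQ_realpow_zero) auto
  moreover have "filterlim (\<lambda>k. 2 ^ k :: nat) at_top sequentially"
    by (rule filterlim_subseq) (auto intro: strict_monoI_Suc)
  ultimately have lim: "(\<lambda>k. \<rho> ^ (2 ^ k)) \<longlonglongrightarrow> 0" by (rule filterlim_compose)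
  then have "(\<lambda>k. green_bound * \<rho> ^ (2 ^ k)) \<longlonglongrightarrow> green_bound * 0" by (intro tendsto_intros)
  then have "\<forall>\<^sub>F k in sequentially. green_bound * \<rho> ^ (2 ^ k) < \<epsilon> / 2"
    using eps_pos by (intro order_tendstoD) auto
  moreover have "\<forall>\<^sub>F k in sequentially. \<rho> ^ (2 ^ k) < \<epsilon>"
    using eps_pos lim by (intro order_tendstoD) auto
  ultimately have "\<forall>\<^sub>F k in sequentially. green_bound * \<rho> ^ (2 ^ k) \<le> \<epsilon> / 2 \<and> \<rho> ^ (2 ^ k) \<le> \<epsilon>"
    by eventually_elim auto
  then have "\<exists>k::nat. green_bound * \<rho> ^ (2 ^ k) \<le> \<epsilon> / 2 \<and> \<rho> ^ (2 ^ k) \<le> \<epsilon>"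
    by (rule eventually_happens'[OF sequentially_bot])
  then have t: "green_bound * \<rho> ^ (2 ^ truncation_factor) \<le> \<epsilon> / 2" "\<rho> ^ (2 ^ truncation_factor) \<le> \<epsilon>"
    unfolding truncation_factor_def by (metis (mono_tags, lifting) someI_ex)+
  \<comment> \<open>The first bound pays for one power of \<open>\<epsilon>\<close> and for the
    constant, the second for each of the other \<open>M\<close> powers.\<close>
  obtain M where M: "N = Suc M" using assms by (cases N) auto
  have "green_bound * \<rho> ^ (2 ^ truncation_factor * N) =
      (green_bound * \<rho> ^ (2 ^ truncation_factor)) * (\<rho> ^ (2 ^ truncation_factor)) ^ M"
    by (simp add: M power_add power_mult)
  also have "\<dots> \<le> (\<epsilon> / 2) * \<epsilon> ^ M"
    using t rho eps_pos C0_pos by (intro mult_mono power_mono) auto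
  finally show ?thesis by (simp add: M)
qed

context
  fixes p assumes adm: "admissible p"
begin

interpretation weighted_walk_group G S p
  using adm by (simp add: admissible_walk)

lemma step_prob_le: "x \<in> carrier G \<Longrightarrow> u p n x \<le> C\<^sub>0 * \<rho> ^ n"
  using adm by (simp add: admissible_def)

lemma eps_le: "a \<in> S \<Longrightarrow> \<epsilon> \<le> p a"
  using adm by (simp add: admissible_def)

lemma eps_le_1: "\<epsilon> \<le> 1"
proof -
  obtain a where a: "a \<in> S" using weights_sum by fastforce
  have "p a \<le> sum p S" using a finite_S by (intro member_le_sum) (auto intro: weights_nonneg)
  then show ?thesis using eps_le[OF a] weights_sum by simp
qed

lemma geometric_summable: "summable (\<lambda>n. C\<^sub>0 * \<rho> ^ n)"
  using rho by (intro summable_mult summable_geometric) auto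

lemma step_prob_summable:
  assumes "x \<in> carrier G"
  shows "summable (\<lambda>n. u p n x)"
  by (rule summable_comparison_test'[OF geometric_summable, of 0])
    (use assms step_prob_le step_prob_nonneg in auto)

lemma step_prob_le_green: "x \<in> carrier G \<Longrightarrow> u p n x \<le> green G S p x"
  unfolding green_def using sum_le_suminf[OF step_prob_summable, of x "{n}"] step_prob_nonneg by auto

lemma sum_step_prob_le_green: "x \<in> carrier G \<Longrightarrow> (\<Sum>n<k. u p n x) \<le> green G S p x"
  unfolding green_def by (intro sum_le_suminf step_prob_summable) (auto simp: step_prob_nonneg)

lemma green_tail_le:
  assumes "x \<in> carrier G"
  shows "green G S p x \<le> (\<Sum>n<k. u p n x) + green_bound * \<rho> ^ k"
proof -
  have "(\<Sum>n. u p (n + k) x) \<le> (\<Sum>n. C\<^sub>0 * \<rho> ^ (n + k))"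
    using summable_ignore_initial_segment[OF step_prob_summable[OF assms], of k]
      summable_ignore_initial_segment[OF geometric_summable, of k] step_prob_le[OF assms]
    by (intro suminf_le) auto
  also have "\<dots> = (\<Sum>n. (C\<^sub>0 * \<rho> ^ k) * \<rho> ^ n)" by (simp add: power_add mult_ac)
  also have "\<dots> = green_bound * \<rho> ^ k"
    using rho by (subst suminf_mult) (auto simp: suminf_geometric summable_geometric)
  finally show ?thesis
    using suminf_split_initial_segment[OF step_prob_summable[OF assms], of k] by (simp add: green_def)
qed

lemma green_le: "x \<in> carrier G \<Longrightarrow> green G S p x \<le> green_bound"
  using green_tail_le[of x 0] by simp

lemma green_word_ge:
  assumes "set ws \<subseteq> S"
  shows "\<epsilon> ^ length ws \<le> green G S p (word_prod G ws)"
  using step_prob_word_ge[OF eps_le, of ws] eps_pos assms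
    step_prob_le_green[of "word_prod G ws" "length ws"] by auto

lemma green_pos: "x \<in> carrier G \<Longrightarrow> 0 < green G S p x"
  using green_word_ge eps_pos by (metis order_less_le_trans word_over_S zero_less_power)

lemma green_one_ge_1: "1 \<le> green G S p \<one>"
  using green_word_ge[of "[]"] by simp

text \<open>The tail is at most half of the Green function itself and can be absorbed on the
  left.\<close>

lemma green_truncate:
  assumes "1 \<le> N" "set ws \<subseteq> S" "length ws \<le> N"
  shows "green G S p (word_prod G ws) \<le> 2 * (\<Sum>n < 2 ^ truncation_factor * N. u p n (word_prod G ws))"
proof -
  have "green_bound * \<rho> ^ (2 ^ truncation_factor * N) \<le> \<epsilon> ^ N / 2" by (rule truncation_factor[OF assms(1)])
  also have "\<epsilon> ^ N \<le> \<epsilon> ^ length ws" using assms eps_pos eps_le_1 by (intro power_decreasing) auto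
  also have "\<dots> \<le> green G S p (word_prod G ws)" by (rule green_word_ge[OF assms(2)])
  finally have "green_bound * \<rho> ^ (2 ^ truncation_factor * N) \<le> green G S p (word_prod G ws) / 2" by simp
  moreover have "word_prod G ws \<in> carrier G" using assms by simp
  note green_tail_le[OF this, of "2 ^ truncation_factor * N"]
  ultimately show ?thesis by linarith
qed

text \<open>The triangle inequality of the Green metric up to a logarithm. After truncation each of
  the O(N) lengths of a path to \<open>x\<close>, combined with all lengths of paths to
  \<open>y\<close>, contributes at most the Green function of the product.\<close>

lemma green_mult_le:
  assumes "1 \<le> N" "set xs \<subseteq> S" "set ys \<subseteq> S" "length xs + length ys \<le> N"
  shows "green G S p (word_prod G xs) * green G S p (word_prod G ys)
    \<le> 4 * 2 ^ truncation_factor * real N * green G S p (word_prod G (xs @ ys))"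
proof -
  define x y where "x = word_prod G xs" and "y = word_prod G ys"
  have xy: "x \<in> carrier G" "y \<in> carrier G" "word_prod G (xs @ ys) = x \<otimes> y"
    using assms by (auto simp: x_def y_def word_prod_append)
  define M where "M = 2 ^ truncation_factor * N"
  have "green G S p x * green G S p y \<le> (2 * (\<Sum>n<M. u p n x)) * (2 * (\<Sum>n<M. u p n y))"
    unfolding x_def y_def M_def using assms xy(1,2)
    by (intro mult_mono green_truncate) (auto simp: step_prob_nonneg less_imp_le[OF green_pos] intro!: sum_nonneg)
  also have "\<dots> = 4 * (\<Sum>i<M. \<Sum>j<M. u p i x * u p j y)"
    by (simp add: sum_product)
  also have "(\<Sum>i<M. \<Sum>j<M. u p i x * u p j y) \<le> (\<Sum>i<M. green G S p (x \<otimes> y))"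
  proof (rule sum_mono)
    fix i
    have "(\<Sum>j<M. u p i x * u p j y) \<le> (\<Sum>j<M. u p (j + i) (x \<otimes> y))"
      using step_prob_mult_le[OF xy(1,2), of i] by (intro sum_mono) (simp add: add.commute)
    also have "\<dots> \<le> (\<Sum>n. u p (n + i) (x \<otimes> y))"
      using xy summable_ignore_initial_segment[OF step_prob_summable, of "x \<otimes> y" i]
      by (intro sum_le_suminf) (auto simp: step_prob_nonneg)
    also have "\<dots> \<le> green G S p (x \<otimes> y)"
      using suminf_split_initial_segment[OF step_prob_summable, of "x \<otimes> y" i] xy
        sum_nonneg[of "{..<i}" "\<lambda>n. u p n (x \<otimes> y)"] by (simp add: green_def step_prob_nonneg)
    finally show "(\<Sum>j<M. u p i x * u p j y) \<le> green G S p (x \<otimes> y)" .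
  qed
  finally show ?thesis by (simp add: M_def xy(3) x_def y_def)
qed

lemma step_prob_mult_green_le:
  assumes "x \<in> carrier G" "y \<in> carrier G"
  shows "u p j x * green G S p y \<le> green G S p (x \<otimes> y)"
    and "u p j x * green G S p y \<le> green G S p (y \<otimes> x)"
proof -
  have *: "u p j x * green G S p y \<le> green G S p z"
    if z: "z \<in> carrier G" and le: "\<And>n. u p j x * u p n y \<le> u p (n + j) z" for z
  proof -
    have "u p j x * green G S p y = (\<Sum>n. u p j x * u p n y)"
      unfolding green_def by (rule suminf_mult[OF step_prob_summable[OF assms(2)], symmetric])
    also have "\<dots> \<le> (\<Sum>n. u p (n + j) z)"
      using z by (intro suminf_le summable_ignore_initial_segment step_prob_summable summable_mult le assms)
    also have "\<dots> \<le> green G S p z"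
      using suminf_split_initial_segment[OF step_prob_summable[OF z], of j]
        sum_nonneg[of "{..<j}" "\<lambda>n. u p n z"] by (simp add: green_def step_prob_nonneg)
    finally show ?thesis .
  qed
  show "u p j x * green G S p y \<le> green G S p (x \<otimes> y)"
    using assms step_prob_mult_le[of x y j] by (intro *) (auto simp: add.commute)
  show "u p j x * green G S p y \<le> green G S p (y \<otimes> x)"
    using assms step_prob_mult_le[of y x _ j] by (intro *) (auto simp: mult.commute)
qed

lemma green_norm_word_bound:
  assumes "set ws \<subseteq> S"
  shows "\<bar>green_norm G S p (word_prod G ws)\<bar> \<le> ln green_bound + real (length ws) * ln (1 / \<epsilon>)"
proof -
  have g1: "0 \<le> ln (green G S p \<one>)" "ln (green G S p \<one>) \<le> ln green_bound"
    using green_one_ge_1 green_le[of \<one>] by auto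
  have "\<epsilon> ^ length ws \<le> green G S p (word_prod G ws)" by (rule green_word_ge[OF assms])
  then have "ln (\<epsilon> ^ length ws) \<le> ln (green G S p (word_prod G ws))"
    using eps_pos by (intro ln_mono) auto
  then have g2: "- (real (length ws) * ln (1 / \<epsilon>)) \<le> ln (green G S p (word_prod G ws))"
    using eps_pos by (simp add: ln_realpow ln_div)
  have g3: "ln (green G S p (word_prod G ws)) \<le> ln green_bound"
    using green_le[of "word_prod G ws"] green_pos[of "word_prod G ws"] assms by (intro ln_mono) auto
  have "0 \<le> real (length ws) * ln (1 / \<epsilon>)"
    using eps_pos eps_le_1 by (intro mult_nonneg_nonneg ln_ge_zero) auto
  then show ?thesis using g1 g2 g3 by (auto simp: green_norm_def abs_le_iff)
qed

end

end

section \<open>The Green function along a hyperbolic group, up to logarithmic errors\<close>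

locale hyperbolic_walks = transient_walks G S \<epsilon> C\<^sub>0 \<rho> + hyperbolic_word_metric G T \<delta>
  for G :: "('a, 'b) monoid_scheme" (structure) and S \<epsilon> C\<^sub>0 \<rho> T \<delta>
begin

section \<open>Comparison of the two generating sets and the Harnack inequality\<close>

definition step_bound :: nat where "step_bound = (\<Sum>a\<in>S. wl a)"

lemma wl_step: "a \<in> S \<Longrightarrow> wl a \<le> step_bound"
  unfolding step_bound_def using finite_S by (intro member_le_sum) auto

lemma wl_word: "set ws \<subseteq> S \<Longrightarrow> wl (word_prod G ws) \<le> step_bound * length ws"
proof (induction ws)
  case (Cons a ws)
  then have "wl (a \<otimes> word_prod G ws) \<le> wl a + wl (word_prod G ws)"
    using S_carrier by (intro word_length_mult) auto
  then show ?case using Cons wl_step[of a] by simp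
qed simp

text \<open>The converse of \<open>step_bound\<close>: how many letters of \<open>S\<close> are
  enough to spell one letter of the word metric.\<close>

definition letter_bound :: nat where
  "letter_bound = (SOME J. \<forall>a\<in>letters. \<exists>ws. set ws \<subseteq> S \<and> length ws \<le> J \<and> word_prod G ws = a)"

lemma letter_bound: "a \<in> letters \<Longrightarrow> \<exists>ws. set ws \<subseteq> S \<and> length ws \<le> letter_bound \<and> word_prod G ws = a"
proof -
  have "\<forall>a\<in>letters. \<exists>ws. set ws \<subseteq> S \<and> word_prod G ws = a"
    using letters_carrier by (meson subsetD word_over_S)
  then obtain f where f: "\<And>a. a \<in> letters \<Longrightarrow> set (f a) \<subseteq> S \<and> word_prod G (f a) = a" by metis
  have "length (f a) \<le> (\<Sum>a\<in>letters. length (f a))" if "a \<in> letters" for a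
    using that finite_T by (intro member_le_sum) auto
  then have "\<exists>J. \<forall>a\<in>letters. \<exists>ws. set ws \<subseteq> S \<and> length ws \<le> J \<and> word_prod G ws = a"
    using f by meson
  from someI_ex[OF this] show "a \<in> letters \<Longrightarrow> ?thesis" unfolding letter_bound_def by blast
qed

lemma short_word_over_S:
  assumes "x \<in> carrier G"
  obtains ws where "set ws \<subseteq> S" "length ws \<le> letter_bound * wl x" "word_prod G ws = x"
proof -
  have "\<exists>ws. set ws \<subseteq> S \<and> length ws \<le> letter_bound * length xs \<and> word_prod G ws = word_prod G xs"
    if "set xs \<subseteq> letters" for xs
    using that
  proof (induction xs)
    case (Cons a xs)
    then obtain vs ws where w: "set vs \<subseteq> S" "length vs \<le> letter_bound" "word_prod G vs = a"
      "set ws \<subseteq> S" "length ws \<le> letter_bound * length xs" "word_prod G ws = word_prod G xs"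
      using letter_bound[of a] by auto
    then show ?case by (intro exI[of _ "vs @ ws"]) (auto simp: word_prod_append)
  qed auto
  then show ?thesis using shortest_word[OF assms] that by metis
qed

text \<open>The price of moving by one unit of word length: at most \<open>letter_bound\<close>
  steps, each of probability at least \<open>\<epsilon>\<close>.\<close>

definition harnack :: real where "harnack = (1 / \<epsilon>) ^ letter_bound"

lemma step_prob_ge_harnack:
  assumes "admissible p" "x \<in> carrier G"
  obtains j where "1 \<le> harnack ^ wl x * u p j x"
proof -
  interpret weighted_walk_group G S p
    using assms(1) by (simp add: admissible_walk)
  obtain ws where ws: "set ws \<subseteq> S" "length ws \<le> letter_bound * wl x" "word_prod G ws = x"
    using short_word_over_S assms(2) by metis
  have "\<epsilon> ^ (letter_bound * wl x) \<le> \<epsilon> ^ length ws"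
    using ws eps_pos eps_le_1[OF assms(1)] by (intro power_decreasing) auto
  also have "\<dots> \<le> u p (length ws) x"
    using step_prob_word_ge[OF eps_le[OF assms(1)], of ws] ws eps_pos by auto
  finally have "harnack ^ wl x * \<epsilon> ^ (letter_bound * wl x) \<le> harnack ^ wl x * u p (length ws) x"
    using eps_pos by (intro mult_left_mono) (auto simp: harnack_def)
  moreover have "harnack ^ wl x * \<epsilon> ^ (letter_bound * wl x) = 1"
    using eps_pos by (simp add: harnack_def power_mult[symmetric] power_mult_distrib[symmetric])
  ultimately show ?thesis using that by simp
qed

text \<open>For some number of steps the walk reaches \<open>x\<close> with probability at least
  \<open>1 / harnack ^ wl x\<close>; this piece of path is attached in front of the paths to
  \<open>y\<close>, or behind them.\<close>

lemma Harnack: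
  assumes "admissible p" "x \<in> carrier G" "y \<in> carrier G"
  shows "green G S p y \<le> harnack ^ wl x * green G S p (x \<otimes> y)"
    and "green G S p y \<le> harnack ^ wl x * green G S p (y \<otimes> x)"
proof -
  obtain j where j: "1 \<le> harnack ^ wl x * u p j x" using step_prob_ge_harnack assms by metis
  have g: "0 < green G S p y" using green_pos assms by blast
  have h: "0 \<le> harnack ^ wl x" using eps_pos by (simp add: harnack_def)
  have "green G S p y \<le> (harnack ^ wl x * u p j x) * green G S p y" using j g by simp
  also have "\<dots> = harnack ^ wl x * (u p j x * green G S p y)" by simp
  finally have *: "green G S p y \<le> harnack ^ wl x * (u p j x * green G S p y)" .
  show "green G S p y \<le> harnack ^ wl x * green G S p (x \<otimes> y)"
    "green G S p y \<le> harnack ^ wl x * green G S p (y \<otimes> x)"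
    using * mult_left_mono[OF step_prob_mult_green_le(1)[OF assms, of j] h]
      mult_left_mono[OF step_prob_mult_green_le(2)[OF assms, of j] h] by linarith+
qed

lemma harnack_ge_1: "admissible p \<Longrightarrow> 1 \<le> harnack"
  using eps_pos eps_le_1 by (simp add: harnack_def)

lemma word_path_approaches:
  assumes w: "w \<in> carrier G" and x: "x \<in> carrier G" and ws: "set ws \<subseteq> S" and L: "length ws \<le> 2 ^ k"
  obtains i where "i \<le> length ws"
    "real (wd w (x \<otimes> word_prod G (take i ws))) \<le> gpr w x (x \<otimes> word_prod G ws) + real (step_bound + k * \<delta>)"
proof -
  define f where "f i = x \<otimes> word_prod G (take i ws)" for i
  have t: "set (take i ws) \<subseteq> S" for i using ws set_take_subset by (meson order_trans)
  have f: "f i \<in> carrier G" for i using x t by (simp add: f_def)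
  have step: "wd (f i) (f (Suc i)) \<le> step_bound" if "i < length ws" for i
  proof -
    have a: "ws ! i \<in> S" using that ws nth_mem by blast
    have "f (Suc i) = f i \<otimes> ws ! i"
      using that t[of i] a S_carrier x
      by (subst (1) f_def, subst take_Suc_conv_app_nth) (auto simp: f_def word_prod_append m_assoc)
    then show ?thesis using a S_carrier f wl_step by (auto simp: wd_right_mult)
  qed
  obtain i where "i \<le> length ws"
    "real (wd w (f i)) \<le> gpr w (f 0) (f (length ws)) + real (step_bound + k * \<delta>)"
    by (rule path_approaches[of w f "length ws" step_bound k, OF w f step L]) auto
  then show ?thesis using that[of i] x by (simp add: f_def)
qed

text \<open>The radius of the ball around the center of a triangle that a path of length at most
  \<open>2 ^ (truncation_factor + l)\<close> between two of its vertices must hit: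
  \<open>\<delta> + 1\<close> comes from \<open>triangle_center\<close>, the rest from
  \<open>path_approaches\<close>. It is linear in \<open>l\<close>, hence logarithmic in the
  length.\<close>

definition corridor :: "nat \<Rightarrow> nat" where
  "corridor l = \<delta> + 1 + step_bound + (truncation_factor + l) * \<delta>"

text \<open>Almost all of the mass of \<open>G(xy)\<close> is carried by paths of length \<open>O(N)\<close>; in a hyperbolic space
  such paths come within distance \<open>O(log N)\<close> of the center of the triangle \<open>1, x, xy\<close>.\<close>

lemma green_split_at_center:
  assumes adm: "admissible p" and N: "1 \<le> N" "N \<le> 2 ^ l"
    and x: "x \<in> carrier G" and zs: "set zs \<subseteq> S" "length zs \<le> N"
    and c: "c \<in> carrier G" "gpr c \<one> (word_prod G zs) \<le> real (\<delta> + 1)"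
  shows "green G S p (word_prod G zs) \<le>
    2 * (\<Sum>w\<in>{w \<in> carrier G. wd c w \<le> corridor l}. green G S p w * green G S p (inv w \<otimes> word_prod G zs))"
proof -
  interpret weighted_walk_group G S p
    using adm by (simp add: admissible_walk)
  define z where "z = word_prod G zs"
  define B where "B = {w \<in> carrier G. wd c w \<le> corridor l}"
  have z: "z \<in> carrier G" using zs by (simp add: z_def)
  have B: "finite B" "B \<subseteq> carrier G" using finite_wd_ball[OF c(1)] by (auto simp: B_def)
  define M where "M = 2 ^ truncation_factor * N"
  have M: "M \<le> 2 ^ (truncation_factor + l)" using N by (simp add: M_def power_add)
  \<comment> \<open>Every such path is cut at a time when it is in the ball \<open>B\<close>.
    Summing over all times and all points of \<open>B\<close> counts a path more than once, which
    only enlarges the right side.\<close>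
  have through: "u p k z \<le> (\<Sum>i\<le>k. \<Sum>w\<in>B. u p i w * u p (k - i) (inv w \<otimes> z))" if k: "k < M" for k
  proof -
    have "u p k z \<le> word_exp S p k (\<lambda>ws. \<Sum>i\<le>k. \<Sum>w\<in>B.
        of_bool (word_prod G (take i ws) = w) * of_bool (word_prod G (drop i ws) = inv w \<otimes> z))"
      unfolding step_prob_def
    proof (rule word_exp_mono)
      fix ws assume ws: "length ws = k" "set ws \<subseteq> S"
      let ?F = "\<lambda>i w. of_bool (word_prod G (take i ws) = w) * of_bool (word_prod G (drop i ws) = inv w \<otimes> z) :: real"
      show "of_bool (word_prod G ws = z) \<le> (\<Sum>i\<le>k. \<Sum>w\<in>B. ?F i w)"
      proof (cases "word_prod G ws = z")
        case True
        obtain i where i: "i \<le> k" "real (wd c (word_prod G (take i ws))) \<le>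
            gpr c \<one> z + real (step_bound + (truncation_factor + l) * \<delta>)"
        proof (rule word_path_approaches[of c \<one> ws "truncation_factor + l"])
          show "length ws \<le> 2 ^ (truncation_factor + l)" using ws k M by linarith
        next
          fix i assume "i \<le> length ws" "real (wd c (\<one> \<otimes> word_prod G (take i ws))) \<le>
            gpr c \<one> (\<one> \<otimes> word_prod G ws) + real (step_bound + (truncation_factor + l) * \<delta>)"
          moreover have "set (take i ws) \<subseteq> S" using ws set_take_subset by (meson order_trans)
          ultimately show thesis using that[of i] True z ws by simp
        qed (use c ws in auto)
        define w where "w = word_prod G (take i ws)"
        have td: "set (take i ws) \<subseteq> S" "set (drop i ws) \<subseteq> S"
          using ws by (meson order_trans set_take_subset set_drop_subset)+
        then have w: "w \<in> carrier G" by (simp add: w_def)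
        have "real (wd c w) \<le> real (corridor l)"
          using i(2) c(2) by (simp add: w_def z_def corridor_def)
        then have wB: "w \<in> B" using w by (simp add: B_def)
        have "w \<otimes> word_prod G (drop i ws) = z"
          using td True word_prod_append[of "take i ws" "drop i ws"] by (simp add: w_def)
        then have "word_prod G (drop i ws) = inv w \<otimes> z"
          using w z td by (metis inv_solve_left word_prod_closed word_carrier)
        then have "1 = ?F i w" by (simp add: w_def)
        also have "\<dots> \<le> (\<Sum>w\<in>B. ?F i w)" using wB B by (intro member_le_sum) auto
        also have "\<dots> \<le> (\<Sum>i\<le>k. \<Sum>w\<in>B. ?F i w)"
          using i by (intro member_le_sum[where f = "\<lambda>i. \<Sum>w\<in>B. ?F i w"] sum_nonneg) auto
        finally show ?thesis by simp
      qed (auto intro!: sum_nonneg)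
    qed
    also have "\<dots> = (\<Sum>i\<le>k. \<Sum>w\<in>B. u p i w * u p (k - i) (inv w \<otimes> z))"
      unfolding word_exp_sum
    proof (intro sum.cong refl)
      fix i w assume i: "i \<in> {..k}"
      have "word_exp S p (i + (k - i)) (\<lambda>ws. of_bool (word_prod G (take i ws) = w) *
            of_bool (word_prod G (drop i ws) = inv w \<otimes> z)) =
          word_exp S p i (\<lambda>xs. word_exp S p (k - i) (\<lambda>ys. of_bool (word_prod G xs = w) *
            of_bool (word_prod G ys = inv w \<otimes> z)))"
        unfolding word_exp_append by (intro word_exp_cong) simp
      also have "\<dots> = u p i w * u p (k - i) (inv w \<otimes> z)"
        by (simp add: word_exp_cmult word_exp_cmult_right step_prob_def)
      finally show "word_exp S p k (\<lambda>ws. of_bool (word_prod G (take i ws) = w) *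
            of_bool (word_prod G (drop i ws) = inv w \<otimes> z)) = u p i w * u p (k - i) (inv w \<otimes> z)"
        using i by simp
    qed
    finally show ?thesis .
  qed
  have "green G S p z \<le> 2 * (\<Sum>k<M. u p k z)"
    unfolding z_def M_def using N zs by (intro green_truncate adm) auto
  also have "(\<Sum>k<M. u p k z) \<le> (\<Sum>k<M. \<Sum>i\<le>k. \<Sum>w\<in>B. u p i w * u p (k - i) (inv w \<otimes> z))"
    by (intro sum_mono through) simp
  also have "\<dots> = (\<Sum>w\<in>B. \<Sum>k<M. \<Sum>i\<le>k. u p i w * u p (k - i) (inv w \<otimes> z))"
    by (subst sum.swap, subst (2) sum.swap) (rule refl)
  also have "\<dots> \<le> (\<Sum>w\<in>B. (\<Sum>i<M. u p i w) * (\<Sum>i<M. u p i (inv w \<otimes> z)))"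
    by (intro sum_mono sum_convolution_le step_prob_nonneg)
  also have "\<dots> \<le> (\<Sum>w\<in>B. green G S p w * green G S p (inv w \<otimes> z))"
    using B z adm by (intro sum_mono mult_mono sum_step_prob_le_green)
      (auto simp: step_prob_nonneg subset_iff intro!: sum_nonneg less_imp_le[OF green_pos])
  finally show ?thesis by (simp add: z_def B_def)
qed

section \<open>Ancona's inequality for words that do not return\<close>

text \<open>Only subwords that straddle, or end at, the junction of \<open>xs\<close> and
  \<open>ys\<close> are constrained: once they have \<open>L\<close> letters, their end points are
  farther than \<open>r\<close> apart.\<close>

definition no_return :: "nat \<Rightarrow> nat \<Rightarrow> 'a list \<Rightarrow> 'a list \<Rightarrow> bool" where
  "no_return L r xs ys \<longleftrightarrow> (\<forall>i\<le>length xs. \<forall>j\<le>length ys. L \<le> (length xs - i) + j \<longrightarrow>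
    r < wl (word_prod G (drop i xs @ take j ys)))"

text \<open>The center of the triangle \<open>1, x, xy\<close> is close to both trajectories
  \<open>xs\<close> and \<open>ys\<close>. Without return this can only happen near the junction, so
  the center is within \<open>O(corridor l + L)\<close> of \<open>x\<close>. In the decomposition at
  the center every cut point can then be replaced by \<open>x\<close> through the Harnack
  inequality, and a ball of radius \<open>corridor l\<close> has few cut points.\<close>

lemma green_product_le:
  assumes adm: "admissible p" and N: "1 \<le> N" "N \<le> 2 ^ l"
    and xs: "set xs \<subseteq> S" and ys: "set ys \<subseteq> S" and len: "length xs + length ys \<le> N"
    and good: "no_return L (2 * corridor l) xs ys"
  shows "green G S p (word_prod G (xs @ ys)) \<le>
    2 * (real (card letters + 1) ^ corridor l * harnack ^ (4 * corridor l + 2 * step_bound * L)) *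
      (green G S p (word_prod G xs) * green G S p (word_prod G ys))"
proof -
  define x y where "x = word_prod G xs" and "y = word_prod G ys"
  define z where "z = word_prod G (xs @ ys)"
  define r where "r = corridor l"
  have car: "x \<in> carrier G" "y \<in> carrier G" "z \<in> carrier G" and z: "z = x \<otimes> y"
    using xs ys by (auto simp: x_def y_def z_def word_prod_append)
  obtain c where c: "c \<in> carrier G" "gpr c \<one> x \<le> real (\<delta> + 1)" "gpr c \<one> z \<le> real (\<delta> + 1)"
    "gpr c x z \<le> real (\<delta> + 1)"
    using triangle_center[of \<one> x z] car by auto
  have r_eq: "real r = real (\<delta> + 1) + real (step_bound + (truncation_factor + l) * \<delta>)"
    by (simp add: r_def corridor_def)
  have len2: "length xs \<le> 2 ^ (truncation_factor + l)" "length ys \<le> 2 ^ (truncation_factor + l)"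
    using len N by (auto simp: power_add intro: order_trans[of _ "2 ^ l"] order_trans[of "2 ^ l" "2 ^ truncation_factor * 2 ^ l"])
  obtain i where i: "i \<le> length xs" "wd c (word_prod G (take i xs)) \<le> r"
  proof (rule word_path_approaches[OF c(1) one_closed xs len2(1)])
    fix i assume "i \<le> length xs" "real (wd c (\<one> \<otimes> word_prod G (take i xs))) \<le>
      gpr c \<one> (\<one> \<otimes> word_prod G xs) + real (step_bound + (truncation_factor + l) * \<delta>)"
    moreover have "set (take i xs) \<subseteq> S" using xs set_take_subset by (meson order_trans)
    ultimately show ?thesis using that[of i] c(2) car(1) r_eq by (simp add: x_def[symmetric])
  qed
  obtain j where j: "j \<le> length ys" "wd c (x \<otimes> word_prod G (take j ys)) \<le> r"
  proof (rule word_path_approaches[OF c(1) car(1) ys len2(2)])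
    fix j assume "j \<le> length ys" "real (wd c (x \<otimes> word_prod G (take j ys))) \<le>
      gpr c x (x \<otimes> word_prod G ys) + real (step_bound + (truncation_factor + l) * \<delta>)"
    then show ?thesis using that[of j] c(4) r_eq by (simp add: z y_def[symmetric])
  qed
  define a b where "a = word_prod G (take i xs)" and "b = word_prod G (take j ys)"
  define d where "d = word_prod G (drop i xs)"
  have sub: "set (take i xs) \<subseteq> S" "set (drop i xs) \<subseteq> S" "set (take j ys) \<subseteq> S"
    using xs ys by (meson order_trans set_take_subset set_drop_subset)+
  then have abd: "a \<in> carrier G" "b \<in> carrier G" "d \<in> carrier G" by (simp_all add: a_def b_def d_def)
  have x_ad: "x = a \<otimes> d"
    using word_prod_append[of "take i xs" "drop i xs"] sub by (simp add: x_def a_def d_def)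
  \<comment> \<open>The points \<open>a\<close> and \<open>x \<otimes> b\<close> of the two
    trajectories both lie in the ball around \<open>c\<close>, so the subword between them ends
    within \<open>2 * r\<close> of its start; by \<open>no_return\<close> it has fewer than
    \<open>L\<close> letters.\<close>
  have "wd a (x \<otimes> b) \<le> wd a c + wd c (x \<otimes> b)" using abd car c(1) by (intro wd_triangle) auto
  also have "\<dots> \<le> 2 * r" using i j abd c(1) wd_sym[of a c] by (simp add: a_def b_def)
  finally have "wl (d \<otimes> b) \<le> 2 * r"
    using abd by (simp add: x_ad m_assoc wd_right_mult)
  then have "wl (word_prod G (drop i xs @ take j ys)) \<le> 2 * corridor l"
    using sub by (simp add: word_prod_append d_def b_def r_def)
  then have short: "length xs - i < L"
    using good i j unfolding no_return_def by (metis not_le trans_le_add1)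
  have "wd c x \<le> wd c a + wd a x" using abd car c(1) by (intro wd_triangle) auto
  also have "wd a x = wl d" using abd by (simp add: x_ad wd_right_mult)
  also have "wl d \<le> step_bound * (length xs - i)" unfolding d_def using wl_word[OF sub(2)] by simp
  also have "\<dots> \<le> step_bound * L" using short by simp
  finally have cx: "wd c x \<le> r + step_bound * L" using i by (simp add: a_def)
  define K where "K = harnack ^ (2 * r + step_bound * L)"
  have h1: "1 \<le> harnack" by (rule harnack_ge_1[OF adm])
  have K0: "0 \<le> K" using h1 by (simp add: K_def)
  define B where "B = {w \<in> carrier G. wd c w \<le> r}"
  have B: "finite B" "B \<subseteq> carrier G" using finite_wd_ball[OF c(1)] by (auto simp: B_def)
  \<comment> \<open>One factor \<open>K\<close> moves the end point of the first piece from
    \<open>w\<close> to \<open>x\<close>, the other moves the starting point of the second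
    piece.\<close>
  have summand: "green G S p w * green G S p (inv w \<otimes> z) \<le> (K * green G S p x) * (K * green G S p y)"
    if "w \<in> B" for w
  proof -
    have w: "w \<in> carrier G" using that B by blast
    have wx: "wd w x \<le> 2 * r + step_bound * L"
      using wd_triangle[OF w c(1) car(1)] wd_sym[OF w c(1)] that cx by (simp add: B_def)
    then have "harnack ^ wd w x \<le> K" unfolding K_def by (intro power_increasing h1)
    moreover have "green G S p w \<le> harnack ^ wd w x * green G S p x"
      using Harnack(2)[OF adm, of "inv w \<otimes> x" w] w car by (simp add: wd_def m_assoc[symmetric])
    moreover have "green G S p (inv w \<otimes> z) \<le> harnack ^ wd w x * green G S p y"
    proof -
      have "(inv x \<otimes> w) \<otimes> (inv w \<otimes> z) = y"
        using mult_cancel_middle[of "inv x" w z] w car by (simp add: z m_assoc[symmetric])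
      moreover have "wl (inv x \<otimes> w) = wd w x" using wd_sym[OF w car(1)] by (simp add: wd_def)
      ultimately show ?thesis using Harnack(1)[OF adm, of "inv x \<otimes> w" "inv w \<otimes> z"] w car by simp
    qed
    ultimately show ?thesis
      using green_pos[OF adm] w car K0
      by (intro mult_mono) (auto intro: order_trans mult_right_mono less_imp_le mult_nonneg_nonneg)
  qed
  have "green G S p z \<le> 2 * (\<Sum>w\<in>B. green G S p w * green G S p (inv w \<otimes> z))"
    unfolding z_def B_def r_def
    using adm N car(1) xs ys len c by (intro green_split_at_center) (auto simp: z_def)
  also have "\<dots> \<le> 2 * (real (card B) * ((K * green G S p x) * (K * green G S p y)))"
    using sum_bounded_above[of B "\<lambda>w. green G S p w * green G S p (inv w \<otimes> z)", OF summand] by simp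
  also have "\<dots> \<le> 2 * (real (card letters + 1) ^ r * ((K * green G S p x) * (K * green G S p y)))"
  proof -
    have "card B \<le> (card letters + 1) ^ r" unfolding B_def by (rule card_wd_ball[OF c(1)])
    then have "real (card B) \<le> real (card letters + 1) ^ r" by (metis of_nat_le_iff of_nat_power)
    then show ?thesis
      using green_pos[OF adm] car K0 by (intro mult_left_mono mult_right_mono mult_nonneg_nonneg) (auto intro: less_imp_le)
  qed
  also have "\<dots> = 2 * (real (card letters + 1) ^ r * (K * K)) * (green G S p x * green G S p y)" by simp
  also have "K * K = harnack ^ (4 * r + 2 * step_bound * L)"
    unfolding K_def power_add[symmetric] by (rule arg_cong[where f = "(^) harnack"]) simp
  finally show ?thesis by (simp add: x_def y_def z_def r_def)
qed

end

text \<open>Turns the square of a logarithm into a pure power of the length, the form that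
  \<open>almost_additive\<close> can sum.\<close>

lemma square_le_sqrt_power2:
  obtains K :: real where "0 < K" "\<And>l::nat. (real l + 1)\<^sup>2 \<le> K * sqrt (2 ^ l)"
proof -
  have "(\<lambda>l::nat. (real l + 1)\<^sup>2 / sqrt (2 ^ l)) \<longlonglongrightarrow> 0" by real_asymp
  then have "Bseq (\<lambda>l::nat. (real l + 1)\<^sup>2 / sqrt (2 ^ l))" by (intro convergent_imp_Bseq convergentI)
  then obtain K where K: "0 < K" "\<And>l::nat. norm ((real l + 1)\<^sup>2 / sqrt (2 ^ l)) \<le> K"
    using BseqE by blast
  then have "(real l + 1)\<^sup>2 \<le> K * sqrt (2 ^ l)" for l :: nat
    using K(2)[of l] by (simp add: field_simps)
  with K(1) that show ?thesis by blast
qed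

lemma dyadic_sandwich:
  assumes "1 \<le> (N::nat)"
  obtains l where "N \<le> 2 ^ l" "2 ^ l \<le> 2 * N"
proof -
  define l where "l = (LEAST l. N \<le> 2 ^ l)"
  have "N \<le> 2 ^ N" by (rule less_imp_le) simp
  then have l: "N \<le> 2 ^ l" unfolding l_def by (rule LeastI)
  moreover have "2 ^ l \<le> 2 * N"
  proof (cases l)
    case (Suc k)
    then have "\<not> N \<le> 2 ^ k" using not_less_Least[of k "\<lambda>l. N \<le> 2 ^ l"] by (simp add: l_def)
    then show ?thesis using Suc by simp
  qed (use assms in simp)
  ultimately show ?thesis using that by blast
qed

section \<open>Returns are rare: the second moment of the defect\<close>

context hyperbolic_walks
begin

text \<open>A union bound over the two cut times. The subword between them is itself a walk with at
  least \<open>L\<close> steps, and it ends in a ball of radius \<open>r\<close> with probability at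
  most the size of the ball times the largest step probability.\<close>

lemma return_probability:
  assumes adm: "admissible p"
  shows "word_exp S p n (\<lambda>xs. word_exp S p m (\<lambda>ys. of_bool (\<not> no_return L r xs ys)))
    \<le> real (n + 1) * real (m + 1) * (real (card letters + 1) ^ r * (C\<^sub>0 * \<rho> ^ L))"
proof -
  interpret weighted_walk_group G S p
    using adm by (simp add: admissible_walk)
  define H :: "'a list \<Rightarrow> real" where "H ws = of_bool (wl (word_prod G ws) \<le> r)" for ws
  define Q where "Q = real (card letters + 1) ^ r * (C\<^sub>0 * \<rho> ^ L)"
  have Q: "0 \<le> Q" using C0_pos rho by (simp add: Q_def)
  have H: "E k H \<le> Q" if "L \<le> k" for k
  proof -
    let ?B = "{x \<in> carrier G. wl x \<le> r}"
    have "E k H = (\<Sum>x\<in>?B. u p k x * of_bool (wl x \<le> r))"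
      unfolding H_def by (rule word_exp_word_prod[OF finite_ball]) auto
    also have "\<dots> \<le> (\<Sum>x\<in>?B. C\<^sub>0 * \<rho> ^ L)"
    proof (rule sum_mono)
      fix x assume x: "x \<in> ?B"
      have "u p k x \<le> C\<^sub>0 * \<rho> ^ k" using step_prob_le[OF adm] x by simp
      also have "\<dots> \<le> C\<^sub>0 * \<rho> ^ L" using that rho C0_pos by (intro mult_left_mono power_decreasing) auto
      finally show "u p k x * of_bool (wl x \<le> r) \<le> C\<^sub>0 * \<rho> ^ L" using x by simp
    qed
    also have "\<dots> = real (card ?B) * (C\<^sub>0 * \<rho> ^ L)" by simp
    also have "\<dots> \<le> Q"
    proof -
      have "real (card ?B) \<le> real (card letters + 1) ^ r"
        using card_ball[of r] by (metis of_nat_le_iff of_nat_power)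
      then show ?thesis unfolding Q_def using rho C0_pos by (intro mult_right_mono) auto
    qed
    finally show ?thesis .
  qed
  have "E n (\<lambda>xs. E m (\<lambda>ys. of_bool (\<not> no_return L r xs ys))) \<le>
      E n (\<lambda>xs. E m (\<lambda>ys. \<Sum>i\<le>n. \<Sum>j\<le>m. of_bool (L \<le> (n - i) + j) * H (drop i xs @ take j ys)))"
  proof (intro word_exp_mono)
    fix xs ys :: "'a list" assume len: "length xs = n" "length ys = m"
    let ?F = "\<lambda>i j. of_bool (L \<le> (n - i) + j) * H (drop i xs @ take j ys)"
    show "of_bool (\<not> no_return L r xs ys) \<le> (\<Sum>i\<le>n. \<Sum>j\<le>m. ?F i j)"
    proof (cases "no_return L r xs ys")
      case False
      then obtain i j where ij: "i \<le> n" "j \<le> m" "L \<le> (n - i) + j"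
        "wl (word_prod G (drop i xs @ take j ys)) \<le> r"
        unfolding no_return_def using len by (auto simp: not_less)
      then have "1 = ?F i j" by (simp add: H_def)
      also have "\<dots> \<le> (\<Sum>j\<le>m. ?F i j)" using ij by (intro member_le_sum) (auto simp: H_def)
      also have "\<dots> \<le> (\<Sum>i\<le>n. \<Sum>j\<le>m. ?F i j)"
        using ij by (intro member_le_sum[where f = "\<lambda>i. \<Sum>j\<le>m. ?F i j"] sum_nonneg) (auto simp: H_def)
      finally show ?thesis using False by simp
    qed (auto simp: H_def intro!: sum_nonneg)
  qed
  also have "\<dots> = (\<Sum>i\<le>n. \<Sum>j\<le>m. of_bool (L \<le> (n - i) + j) * E ((n - i) + j) H)"
    unfolding word_exp_sum word_exp_cmult
  proof (intro sum.cong refl arg_cong2[where f = "(*)"])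
    fix i j assume "i \<in> {..n}" "j \<in> {..m}"
    then have "E n (\<lambda>xs. E m (\<lambda>ys. H (drop i xs @ take j ys))) = E n (\<lambda>xs. E j (\<lambda>ys. H (drop i xs @ ys)))"
      by (intro word_exp_cong word_exp_take) auto
    also have "\<dots> = E (n - i) (\<lambda>xs. E j (\<lambda>ys. H (xs @ ys)))"
      using word_exp_drop[of i n "\<lambda>xs. E j (\<lambda>ys. H (xs @ ys))"] \<open>i \<in> {..n}\<close> by simp
    finally show "E n (\<lambda>xs. E m (\<lambda>ys. H (drop i xs @ take j ys))) = E ((n - i) + j) H"
      by (simp add: word_exp_append)
  qed
  also have "\<dots> \<le> (\<Sum>i\<le>n. \<Sum>j\<le>m. Q)"
    using H Q by (intro sum_mono) auto
  also have "\<dots> = real (n + 1) * real (m + 1) * Q" by simp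
  finally show ?thesis by (simp add: Q_def)
qed

text \<open>For symmetric weights this is twice the Gromov product, in the Green metric and based at
  the identity, of the inverse of the first element and the second element.\<close>

definition defect :: "('a \<Rightarrow> real) \<Rightarrow> 'a list \<Rightarrow> 'a list \<Rightarrow> real" where
  "defect p xs ys = green_norm G S p (word_prod G xs) + green_norm G S p (word_prod G ys)
    - green_norm G S p (word_prod G (xs @ ys))"

lemma corridor_le: "corridor l \<le> corridor 1 * (l + 1)"
  by (simp add: corridor_def algebra_simps)

text \<open>The crude bound adds three linear bounds on Green norms. In the fine one the upper bound
  is the logarithm of \<open>green_product_le\<close> and needs a word without return, while the
  lower bound is the logarithm of \<open>green_mult_le\<close> and holds for all words. Both are
  linear in \<open>l\<close>.\<close>

lemma defect_bounds:
  assumes adm: "admissible p" and N: "1 \<le> N" "N \<le> 2 ^ l"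
    and xs: "set xs \<subseteq> S" and ys: "set ys \<subseteq> S" and len: "length xs + length ys \<le> N"
  shows "\<bar>defect p xs ys\<bar> \<le> (3 * ln green_bound + 2 * ln (1 / \<epsilon>)) * real N" (is ?crude)
    and "no_return (b * (l + 1)) (2 * corridor l) xs ys \<Longrightarrow> \<bar>defect p xs ys\<bar> \<le>
      (ln green_bound + ln 2 + real (corridor 1) * ln (real (card letters + 1)) +
       (4 * real (corridor 1) + 2 * real step_bound * real b) * ln harnack +
       ln (4 * 2 ^ truncation_factor) + ln 2) * real (l + 1)" (is "_ \<Longrightarrow> ?fine")
proof -
  define gx gy gz g1 where "gx = green G S p (word_prod G xs)" and "gy = green G S p (word_prod G ys)"
    and "gz = green G S p (word_prod G (xs @ ys))" and "g1 = green G S p \<one>"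
  have pos: "0 < gx" "0 < gy" "0 < gz" "0 < g1"
    using xs ys by (auto simp: gx_def gy_def gz_def g1_def intro!: green_pos[OF adm])
  have D: "defect p xs ys = ln g1 + ln gz - ln gx - ln gy"
    by (simp add: defect_def green_norm_def gx_def gy_def gz_def g1_def)
  have g1: "0 \<le> ln g1" "ln g1 \<le> ln green_bound"
    using green_one_ge_1[OF adm] green_le[OF adm, of \<one>] by (auto simp: g1_def)
  have e1: "0 \<le> ln (1 / \<epsilon>)" using eps_pos eps_le_1[OF adm] by (intro ln_ge_zero) auto
  show ?crude
  proof -
    have "\<bar>defect p xs ys\<bar> \<le> 3 * ln green_bound + 2 * (real (length xs + length ys) * ln (1 / \<epsilon>))"
      using green_norm_word_bound[OF adm xs] green_norm_word_bound[OF adm ys]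
        green_norm_word_bound[OF adm, of "xs @ ys"] xs ys
      unfolding defect_def by (simp add: algebra_simps abs_le_iff)
    also have "\<dots> \<le> 3 * ln green_bound * real N + 2 * (real N * ln (1 / \<epsilon>))"
    proof (rule add_mono)
      have "3 * ln green_bound * 1 \<le> 3 * ln green_bound * real N"
        using g1 N by (intro mult_left_mono) auto
      then show "3 * ln green_bound \<le> 3 * ln green_bound * real N" by simp
      show "2 * (real (length xs + length ys) * ln (1 / \<epsilon>)) \<le> 2 * (real N * ln (1 / \<epsilon>))"
        using len e1 by (intro mult_left_mono mult_right_mono) auto
    qed
    finally show ?thesis by (simp add: algebra_simps)
  qed
  assume good: "no_return (b * (l + 1)) (2 * corridor l) xs ys"
  define V where "V = real (card letters + 1)"
  define e where "e = 4 * corridor l + 2 * step_bound * (b * (l + 1))"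
  have V: "1 \<le> V" by (simp add: V_def)
  have h: "1 \<le> harnack" by (rule harnack_ge_1[OF adm])
  have "gz \<le> 2 * (V ^ corridor l * harnack ^ e) * (gx * gy)"
    using green_product_le[OF adm N xs ys len good] by (simp add: gx_def gy_def gz_def V_def e_def)
  then have "ln gz \<le> ln (2 * (V ^ corridor l * harnack ^ e) * (gx * gy))"
    using pos by (intro ln_mono) auto
  also have "\<dots> = ln 2 + real (corridor l) * ln V + real e * ln harnack + ln gx + ln gy"
    using pos V h by (simp add: ln_mult ln_realpow)
  finally have up: "defect p xs ys \<le> ln green_bound + ln 2 + real (corridor l) * ln V + real e * ln harnack"
    using g1 by (simp add: D)
  have "gx * gy \<le> 4 * 2 ^ truncation_factor * real N * gz"
    using green_mult_le[OF adm N(1) xs ys len] by (simp add: gx_def gy_def gz_def)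
  also have "\<dots> \<le> 4 * 2 ^ truncation_factor * 2 ^ l * gz"
    using N(2) pos by (intro mult_right_mono mult_left_mono) (auto simp flip: of_nat_le_iff)
  finally have "ln (gx * gy) \<le> ln (4 * 2 ^ truncation_factor * 2 ^ l * gz)"
    using pos by (intro ln_mono) auto
  also have "\<dots> = ln (4 * 2 ^ truncation_factor) + real l * ln 2 + ln gz"
    using pos by (simp add: ln_mult ln_realpow)
  finally have low: "- (ln (4 * 2 ^ truncation_factor) + real l * ln 2) \<le> defect p xs ys"
    unfolding D using g1 ln_mult_pos[OF pos(1,2)] by linarith
  have l1: "1 \<le> real (l + 1)" by simp
  have scale: "c \<le> c * real (l + 1)" if "0 \<le> c" for c :: real
    using mult_left_mono[OF l1 that] by simp
  have r: "real (corridor l) \<le> real (corridor 1) * real (l + 1)"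
    using corridor_le[of l] by (metis of_nat_le_iff of_nat_mult)
  have t1: "real (corridor l) * ln V \<le> real (corridor 1) * ln V * real (l + 1)"
    using mult_right_mono[OF r, of "ln V"] V by (simp add: mult_ac)
  have eb: "real e \<le> (4 * real (corridor 1) + 2 * real step_bound * real b) * real (l + 1)"
    using r by (simp add: e_def algebra_simps)
  have t2: "real e * ln harnack \<le>
      (4 * real (corridor 1) + 2 * real step_bound * real b) * ln harnack * real (l + 1)"
    using mult_right_mono[OF eb, of "ln harnack"] h by (simp add: mult_ac)
  have "(1::real) \<le> 2 ^ truncation_factor" by simp
  then have "(1::real) \<le> 4 * 2 ^ truncation_factor" by linarith
  then have nn: "0 \<le> real (corridor 1) * ln V * real (l + 1)"
    "0 \<le> (4 * real (corridor 1) + 2 * real step_bound * real b) * ln harnack * real (l + 1)"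
    "0 \<le> ln (4 * 2 ^ truncation_factor :: real)" "0 \<le> ln green_bound" "0 \<le> ln (2::real)"
    "real l * ln 2 \<le> ln 2 * real (l + 1)" "0 \<le> real l * ln 2"
    using V h g1 by (auto intro!: mult_nonneg_nonneg ln_ge_zero simp: algebra_simps)
  show ?fine
    using up low t1 t2 nn scale[OF nn(3)] scale[OF nn(4)] scale[OF nn(5)]
    unfolding V_def[symmetric] distrib_right abs_le_iff by (intro conjI; linarith)
qed

text \<open>Words without return contribute a squared logarithm. The others contribute at most the
  squared crude bound times their probability, which a large enough multiple \<open>b\<close> of the
  logarithm as waiting time makes bounded. The law \<open>p\<close> of the walk and the law
  \<open>q\<close> of the metric vary independently.\<close>

lemma defect_second_moment:
  obtains K where "0 < K" "\<And>p q n m. admissible p \<Longrightarrow> admissible q \<Longrightarrow> 1 \<le> n + m \<Longrightarrow>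
    word_exp S p n (\<lambda>xs. word_exp S p m (\<lambda>ys. (defect q xs ys)\<^sup>2)) \<le> K * sqrt (real (n + m))"
proof -
  define V where "V = real (card letters + 1)"
  have V: "1 \<le> V" by (simp add: V_def)
  \<comment> \<open>Per unit of \<open>l + 1\<close>, a bad word costs a factor 4 for the pair of
    cut times, 4 for the squared crude bound and \<open>V ^ (2 * corridor 1)\<close> for the size of
    the ball; the decay \<open>\<rho> ^ b\<close> has to beat the product.\<close>
  have "(\<lambda>b. 16 * V ^ (2 * corridor 1) * \<rho> ^ b) \<longlonglongrightarrow> 16 * V ^ (2 * corridor 1) * 0"
    using rho by (intro tendsto_intros LIMSEQ_realpow_zero) auto
  then have "\<forall>\<^sub>F b in sequentially. 16 * V ^ (2 * corridor 1) * \<rho> ^ b < 1"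
    by (intro order_tendstoD) auto
  then obtain b where b: "16 * V ^ (2 * corridor 1) * \<rho> ^ b < 1"
    using eventually_happens'[OF sequentially_bot] by blast
  define K1 where "K1 = ln green_bound + ln 2 + real (corridor 1) * ln V +
       (4 * real (corridor 1) + 2 * real step_bound * real b) * ln harnack +
       ln (4 * 2 ^ truncation_factor) + ln 2"
  define K2 where "K2 = 3 * ln green_bound + 2 * ln (1 / \<epsilon>)"
  obtain K3 where K3: "0 < K3" "\<And>l::nat. (real l + 1)\<^sup>2 \<le> K3 * sqrt (2 ^ l)"
    using square_le_sqrt_power2 by blast
  define K4 where "K4 = K1\<^sup>2 + K2\<^sup>2 * C\<^sub>0 + 1"
  have K4: "0 < K4" using C0_pos by (simp add: K4_def add_nonneg_pos)
  have main: "word_exp S p n (\<lambda>xs. word_exp S p m (\<lambda>ys. (defect q xs ys)\<^sup>2)) \<le> K4 * K3 * sqrt 2 * sqrt (real (n + m))"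
    if adm: "admissible p" "admissible q" and nm: "1 \<le> n + m" for p q n m
  proof -
    interpret weighted_walk_group G S p
      using adm by (simp add: admissible_walk)
    obtain l where l: "n + m \<le> 2 ^ l" "2 ^ l \<le> 2 * (n + m)" using dyadic_sandwich[OF nm] by blast
    let ?bad = "\<lambda>xs ys. of_bool (\<not> no_return (b * (l + 1)) (2 * corridor l) xs ys) :: real"
    have "E n (\<lambda>xs. E m (\<lambda>ys. (defect q xs ys)\<^sup>2)) \<le>
        E n (\<lambda>xs. E m (\<lambda>ys. (K1 * real (l + 1))\<^sup>2 + (K2 * 2 ^ l)\<^sup>2 * ?bad xs ys))"
    proof (intro word_exp_mono)
      fix xs ys assume w: "length xs = n" "set xs \<subseteq> S" "length ys = m" "set ys \<subseteq> S"
      then have w': "length xs + length ys \<le> n + m" by simp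
      show "(defect q xs ys)\<^sup>2 \<le> (K1 * real (l + 1))\<^sup>2 + (K2 * 2 ^ l)\<^sup>2 * ?bad xs ys"
      proof (cases "no_return (b * (l + 1)) (2 * corridor l) xs ys")
        case True
        have "\<bar>defect q xs ys\<bar> \<le> K1 * real (l + 1)"
          unfolding K1_def V_def by (rule defect_bounds(2)[OF adm(2) nm l(1) w(2,4) w' True])
        then have "(defect q xs ys)\<^sup>2 \<le> (K1 * real (l + 1))\<^sup>2" using power_mono[OF _ abs_ge_zero, of "defect q xs ys" _ 2] by simp
        then show ?thesis using True by simp
      next
        case False
        have "0 \<le> K2"
        proof -
          have "0 \<le> K2 * real (n + m)"
            using defect_bounds(1)[OF adm(2) nm l(1) w(2,4) w'] abs_ge_zero order_trans
            unfolding K2_def by blast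
          then show ?thesis using nm by (auto simp: zero_le_mult_iff)
        qed
        moreover have "real (n + m) \<le> 2 ^ l" using l(1) by (metis of_nat_le_iff of_nat_numeral of_nat_power)
        ultimately have "K2 * real (n + m) \<le> K2 * 2 ^ l" by (intro mult_left_mono)
        then have "\<bar>defect q xs ys\<bar> \<le> K2 * 2 ^ l"
          using defect_bounds(1)[OF adm(2) nm l(1) w(2,4) w'] unfolding K2_def by linarith
        then have "(defect q xs ys)\<^sup>2 \<le> (K2 * 2 ^ l)\<^sup>2" using power_mono[OF _ abs_ge_zero, of "defect q xs ys" _ 2] by simp
        then show ?thesis using False by (simp add: add_increasing)
      qed
    qed
    also have "\<dots> = (K1 * real (l + 1))\<^sup>2 + (K2 * 2 ^ l)\<^sup>2 * E n (\<lambda>xs. E m (\<lambda>ys. ?bad xs ys))"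
      by (simp only: word_exp_add word_exp_cmult word_exp_const)
    also have "(K2 * 2 ^ l)\<^sup>2 * E n (\<lambda>xs. E m (\<lambda>ys. ?bad xs ys)) \<le> K2\<^sup>2 * C\<^sub>0"
    proof -
      have n1: "real (n + 1) \<le> 2 ^ (l + 1)" "real (m + 1) \<le> 2 ^ (l + 1)"
      proof -
        have "(1::nat) \<le> 2 ^ l" by simp
        then have "n + 1 \<le> 2 ^ (l + 1)" "m + 1 \<le> 2 ^ (l + 1)"
          using l(1) unfolding power_add power_one_right by linarith+
        then show "real (n + 1) \<le> 2 ^ (l + 1)" "real (m + 1) \<le> 2 ^ (l + 1)"
          by (simp_all only: of_nat_le_iff[symmetric, where 'a = real] of_nat_power of_nat_numeral)
      qed
      have "E n (\<lambda>xs. E m (\<lambda>ys. ?bad xs ys)) \<le>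
          real (n + 1) * real (m + 1) * (V ^ (2 * corridor l) * (C\<^sub>0 * \<rho> ^ (b * (l + 1))))"
        unfolding V_def by (rule return_probability[OF adm(1)])
      also have "\<dots> \<le> 2 ^ (l + 1) * 2 ^ (l + 1) * (V ^ (2 * corridor 1 * (l + 1)) * (C\<^sub>0 * \<rho> ^ (b * (l + 1))))"
      proof -
        have "2 * corridor l \<le> 2 * corridor 1 * (l + 1)" using corridor_le[of l] by simp
        then have "V ^ (2 * corridor l) \<le> V ^ (2 * corridor 1 * (l + 1))"
          using V by (intro power_increasing)
        then show ?thesis using n1 V rho C0_pos by (intro mult_mono[OF mult_mono] mult_right_mono) auto
      qed
      finally have "(K2 * 2 ^ l)\<^sup>2 * E n (\<lambda>xs. E m (\<lambda>ys. ?bad xs ys)) \<le>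
          (K2 * 2 ^ (l + 1))\<^sup>2 * (2 ^ (l + 1) * 2 ^ (l + 1) * (V ^ (2 * corridor 1 * (l + 1)) * (C\<^sub>0 * \<rho> ^ (b * (l + 1)))))"
        by (intro mult_mono) (auto simp: power_mult_distrib intro!: word_exp_nonneg mult_left_mono power_mono)
      also have "\<dots> = K2\<^sup>2 * C\<^sub>0 * (16 * V ^ (2 * corridor 1) * \<rho> ^ b) ^ (l + 1)"
      proof -
        have "(16::real) ^ (l + 1) = (2 ^ (l + 1))\<^sup>2 * (2 ^ (l + 1) * 2 ^ (l + 1))"
          by (simp add: power2_eq_square power_mult_distrib[symmetric])
        moreover have "V ^ (2 * corridor 1 * (l + 1)) = (V ^ (2 * corridor 1)) ^ (l + 1)"
          "\<rho> ^ (b * (l + 1)) = (\<rho> ^ b) ^ (l + 1)" by (rule power_mult)+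
        ultimately show ?thesis by (simp only: power_mult_distrib mult_ac)
      qed
      also have "\<dots> \<le> K2\<^sup>2 * C\<^sub>0 * 1"
        using b V rho C0_pos by (intro mult_left_mono power_le_one) auto
      finally show ?thesis by simp
    qed
    also have "(K1 * real (l + 1))\<^sup>2 + K2\<^sup>2 * C\<^sub>0 \<le> K4 * (real l + 1)\<^sup>2"
    proof -
      have "(K2\<^sup>2 * C\<^sub>0 + 1) * 1 \<le> (K2\<^sup>2 * C\<^sub>0 + 1) * (real l + 1)\<^sup>2"
        using C0_pos by (intro mult_left_mono) auto
      then show ?thesis by (simp add: K4_def power_mult_distrib distrib_right add.commute)
    qed
    also have "\<dots> \<le> K4 * (K3 * sqrt (2 ^ l))" using K3 K4 by (intro mult_left_mono) auto
    also have "sqrt (2 ^ l) \<le> sqrt 2 * sqrt (real (n + m))"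
    proof -
      have "2 ^ l \<le> 2 * real (n + m)"
        using l(2) by (metis of_nat_le_iff of_nat_mult of_nat_numeral of_nat_power)
      then show ?thesis unfolding real_sqrt_mult[symmetric] by (intro real_sqrt_le_mono)
    qed
    finally show ?thesis using K3 K4 by (simp add: mult_ac)
  qed
  show ?thesis
    by (rule that[of "K4 * K3 * sqrt 2"]) (use main K3 K4 in auto)
qed

end

section \<open>Almost additive sequences\<close>

text \<open>The dyadic averages \<open>a (2 ^ k * n) / 2 ^ k\<close> form a Cauchy sequence with
  geometric increments of ratio \<open>\<theta>\<close>. Their limit is exactly additive in
  \<open>n\<close>, because the error at scale \<open>2 ^ k\<close> is divided by
  \<open>2 ^ k\<close>. The explicit constant keeps the estimate uniform in families of
  sequences.\<close>

lemma almost_additive: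
  fixes a :: "nat \<Rightarrow> real"
  assumes \<alpha>: "\<alpha> < 1"
    and a: "\<And>n m. 1 \<le> n \<Longrightarrow> 1 \<le> m \<Longrightarrow> \<bar>a (n + m) - a n - a m\<bar> \<le> C * real (n + m) powr \<alpha>"
  shows "\<exists>L. \<forall>n\<ge>1. \<bar>a n - real n * L\<bar> \<le> C / (1 - 2 powr (\<alpha> - 1)) * real n powr \<alpha>"
proof -
  define \<theta> where "\<theta> = 2 powr (\<alpha> - 1)"
  have \<theta>: "0 < \<theta>" "\<theta> < 1" using \<alpha> by (auto simp: \<theta>_def powr_less_one)
  have C: "0 \<le> C"
  proof -
    have "0 \<le> C * 2 powr \<alpha>" using a[of 1 1] abs_ge_zero[of "a (1 + 1) - a 1 - a 1"] by simp
    then show ?thesis by (simp add: zero_le_mult_iff)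
  qed
  have scale: "real (2 ^ k * n) powr \<alpha> / 2 ^ k = real n powr \<alpha> * \<theta> ^ k" for k n
  proof -
    have p: "(2 ^ k :: real) powr \<alpha> = (2 powr \<alpha>) ^ k"
      by (simp add: powr_realpow[symmetric] powr_powr mult.commute powr_power)
    have t: "\<theta> = 2 powr \<alpha> / 2" by (simp add: \<theta>_def powr_diff)
    show ?thesis unfolding t power_divide by (simp add: powr_mult p)
  qed
  define b where "b n k = a (2 ^ k * n) / 2 ^ k" for n k
  have bstep: "\<bar>b n (Suc k) - b n k\<bar> \<le> C * real n powr \<alpha> * \<theta> ^ Suc k" if "1 \<le> n" for n k
  proof -
    have eq: "b n (Suc k) - b n k = (a (2 ^ k * n + 2 ^ k * n) - a (2 ^ k * n) - a (2 ^ k * n)) / 2 ^ Suc k"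
      by (simp add: b_def field_simps mult_2[symmetric])
    have "\<bar>b n (Suc k) - b n k\<bar> \<le> C * real (2 ^ k * n + 2 ^ k * n) powr \<alpha> / 2 ^ Suc k"
      unfolding eq abs_divide using that a[of "2 ^ k * n" "2 ^ k * n"] by (intro frac_le) auto
    also have "\<dots> = C * (real (2 ^ Suc k * n) powr \<alpha> / 2 ^ Suc k)" by (simp add: mult_2[symmetric] mult_ac)
    also have "\<dots> = C * (real n powr \<alpha> * \<theta> ^ Suc k)" by (simp only: scale)
    finally show ?thesis by (simp only: mult.assoc)
  qed
  have bsum: "summable (\<lambda>k. b n (Suc k) - b n k)" if "1 \<le> n" for n
    by (rule summable_comparison_test'[where g = "\<lambda>k. C * real n powr \<alpha> * \<theta> ^ Suc k" and N = 0])
      (use \<theta> bstep[OF that] in \<open>auto intro!: summable_mult summable_geometric\<close>)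
  define L where "L n = b n 0 + (\<Sum>k. b n (Suc k) - b n k)" for n
  have bL: "b n \<longlonglongrightarrow> L n" if "1 \<le> n" for n
  proof -
    have "(\<lambda>k. b n 0 + (\<Sum>i<k. b n (Suc i) - b n i)) \<longlonglongrightarrow> L n"
      unfolding L_def by (intro tendsto_add tendsto_const summable_LIMSEQ bsum that)
    then show ?thesis by (simp add: sum_lessThan_telescope)
  qed
  have Lb: "\<bar>a n - L n\<bar> \<le> C / (1 - \<theta>) * real n powr \<alpha>" if "1 \<le> n" for n
  proof -
    have s: "summable (\<lambda>k. C * real n powr \<alpha> * \<theta> ^ Suc k)"
      using \<theta> by (auto intro!: summable_mult summable_geometric)
    have "\<bar>\<Sum>k. b n (Suc k) - b n k\<bar> \<le> (\<Sum>k. C * real n powr \<alpha> * \<theta> ^ Suc k)"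
      using norm_suminf_le[OF _ s, of "\<lambda>k. b n (Suc k) - b n k"] bstep[OF that] by simp
    also have "\<dots> = C * real n powr \<alpha> * \<theta> * (\<Sum>k. \<theta> ^ k)"
      using \<theta> by (subst suminf_mult[symmetric]) (auto simp: mult_ac summable_geometric)
    also have "\<dots> = C / (1 - \<theta>) * real n powr \<alpha> * \<theta>" using \<theta> by (simp add: suminf_geometric)
    also have "\<dots> \<le> C / (1 - \<theta>) * real n powr \<alpha> * 1"
      using \<theta> C by (intro mult_left_mono) auto
    finally show ?thesis by (simp add: L_def b_def abs_minus_commute)
  qed
  have Ladd: "L (n + m) = L n + L m" if "1 \<le> n" "1 \<le> m" for n m
  proof -
    have "(\<lambda>k. b (n + m) k - b n k - b m k) \<longlonglongrightarrow> 0"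
    proof (rule Lim_null_comparison)
      show "\<forall>\<^sub>F k in sequentially. norm (b (n + m) k - b n k - b m k) \<le> C * real (n + m) powr \<alpha> * \<theta> ^ k"
      proof (intro always_eventually allI)
        fix k
        have eq: "b (n + m) k - b n k - b m k = (a (2 ^ k * n + 2 ^ k * m) - a (2 ^ k * n) - a (2 ^ k * m)) / 2 ^ k"
          by (simp add: b_def field_simps)
        have "norm (b (n + m) k - b n k - b m k) \<le> C * real (2 ^ k * n + 2 ^ k * m) powr \<alpha> / 2 ^ k"
          unfolding eq real_norm_def abs_divide using that a[of "2 ^ k * n" "2 ^ k * m"] by (intro frac_le) auto
        also have "\<dots> = C * (real (2 ^ k * (n + m)) powr \<alpha> / 2 ^ k)" by (simp add: algebra_simps)
        also have "\<dots> = C * (real (n + m) powr \<alpha> * \<theta> ^ k)" by (simp only: scale)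
        finally show "norm (b (n + m) k - b n k - b m k) \<le> C * real (n + m) powr \<alpha> * \<theta> ^ k"
          by (simp only: mult.assoc)
      qed
      have "(\<lambda>k. C * real (n + m) powr \<alpha> * \<theta> ^ k) \<longlonglongrightarrow> C * real (n + m) powr \<alpha> * 0"
        using \<theta> by (intro tendsto_intros LIMSEQ_realpow_zero) auto
      then show "(\<lambda>k. C * real (n + m) powr \<alpha> * \<theta> ^ k) \<longlonglongrightarrow> 0" by simp
    qed
    moreover have "(\<lambda>k. b (n + m) k - b n k - b m k) \<longlonglongrightarrow> L (n + m) - L n - L m"
      using that by (intro tendsto_diff bL) auto
    ultimately have "L (n + m) - L n - L m = 0" using LIMSEQ_unique by blast
    then show ?thesis by simp
  qed
  \<comment> \<open>Exact additivity on the positive integers forces linearity, with slope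
    \<open>L 1\<close>.\<close>
  have "L n = real n * L 1" if "1 \<le> n" for n
    using that by (induction n rule: dec_induct) (auto simp: Ladd[of _ 1, simplified] algebra_simps)
  with Lb show ?thesis unfolding \<theta>_def by (metis (no_types, lifting))
qed

lemma almost_additive_tendsto:
  fixes a :: "nat \<Rightarrow> real"
  assumes "\<alpha> < 1" and "\<And>n. 1 \<le> n \<Longrightarrow> \<bar>a n - real n * L\<bar> \<le> C * real n powr \<alpha>"
  shows "(\<lambda>n. a n / real n) \<longlonglongrightarrow> L"
proof -
  have "(\<lambda>n. a n / real n - L) \<longlonglongrightarrow> 0"
  proof (rule Lim_null_comparison)
    show "\<forall>\<^sub>F n in sequentially. norm (a n / real n - L) \<le> C * real n powr (\<alpha> - 1)"
    proof (intro eventually_sequentiallyI[of 1])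
      fix n :: nat assume n: "1 \<le> n"
      have "a n / real n - L = (a n - real n * L) / real n" using n by (simp add: field_simps)
      then have "norm (a n / real n - L) = \<bar>a n - real n * L\<bar> / real n" by (simp add: abs_divide)
      also have "\<dots> \<le> C * real n powr \<alpha> / real n" using assms(2)[OF n] by (intro divide_right_mono) auto
      also have "\<dots> = C * real n powr (\<alpha> - 1)" using n by (simp add: powr_diff)
      finally show "norm (a n / real n - L) \<le> C * real n powr (\<alpha> - 1)" .
    qed
    have "(\<lambda>n. real n powr (\<alpha> - 1)) \<longlonglongrightarrow> 0"
      using assms(1) by (intro tendsto_neg_powr filterlim_real_sequentially) auto
    then have "(\<lambda>n. C * real n powr (\<alpha> - 1)) \<longlonglongrightarrow> C * 0" by (intro tendsto_intros)
    then show "(\<lambda>n. C * real n powr (\<alpha> - 1)) \<longlonglongrightarrow> 0" by simp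
  qed
  then show ?thesis by (simp add: LIM_zero_iff)
qed

lemma sqrt_sqrt: "0 \<le> x \<Longrightarrow> sqrt (sqrt x) = x powr (1 / 4)"
  by (simp add: powr_half_sqrt[symmetric] powr_powr)

text \<open>Codes a pair of independent words as one word, so that inequalities stated for single
  words, such as Cauchy-Schwarz and Minkowski, apply to functions of pairs.\<close>

lemma (in word_weights) word_exp_pair:
  "E (n + m) (\<lambda>zs. F (take n zs) (drop n zs)) = E n (\<lambda>xs. E m (\<lambda>ys. F xs ys))"
  unfolding word_exp_append by (intro word_exp_cong) simp

section \<open>Rates of escape, covariances and fluctuations\<close>

context hyperbolic_walks
begin

abbreviation gn :: "('a \<Rightarrow> real) \<Rightarrow> 'a list \<Rightarrow> real" where "gn q xs \<equiv> green_norm G S q (word_prod G xs)"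

text \<open>\<open>p\<close> is the law of the steps and \<open>q\<close> the law whose Green metric
  measures the distance. The squeeze for the entropy compares different pairs, so the two roles are
  kept apart.\<close>

definition mean :: "('a \<Rightarrow> real) \<Rightarrow> ('a \<Rightarrow> real) \<Rightarrow> nat \<Rightarrow> real" where
  "mean p q n = word_exp S p n (gn q)"

definition cov :: "('a \<Rightarrow> real) \<Rightarrow> ('a \<Rightarrow> real) \<Rightarrow> ('a \<Rightarrow> real) \<Rightarrow> nat \<Rightarrow> real" where
  "cov p q w n = word_exp S p n (\<lambda>xs. gn q xs * (\<Sum>x\<leftarrow>xs. w x))"

definition rate :: "('a \<Rightarrow> real) \<Rightarrow> ('a \<Rightarrow> real) \<Rightarrow> real" where
  "rate p q = lim (\<lambda>n. mean p q n / real n)"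

definition cov_rate :: "('a \<Rightarrow> real) \<Rightarrow> ('a \<Rightarrow> real) \<Rightarrow> ('a \<Rightarrow> real) \<Rightarrow> real" where
  "cov_rate p q w = lim (\<lambda>n. cov p q w n / real n)"

lemma admissible_weights: "admissible p \<Longrightarrow> word_weights S p"
  by (simp add: admissible_def)

lemma gn_append: "gn q (xs @ ys) = gn q xs + gn q ys - defect q xs ys"
  by (simp add: defect_def)

text \<open>The failure of additivity is the mean of the defect, at most the root of its second
  moment, hence O(N^(1/4)).\<close>

lemma mean_rate:
  obtains C where "0 < C" "\<And>p q n. admissible p \<Longrightarrow> admissible q \<Longrightarrow> 1 \<le> n \<Longrightarrow>
    \<bar>mean p q n - real n * rate p q\<bar> \<le> C * real n powr (1 / 4)"
proof -
  obtain K where K: "0 < K" "\<And>p q n m. admissible p \<Longrightarrow> admissible q \<Longrightarrow> 1 \<le> n + m \<Longrightarrow>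
    word_exp S p n (\<lambda>xs. word_exp S p m (\<lambda>ys. (defect q xs ys)\<^sup>2)) \<le> K * sqrt (real (n + m))"
    by (rule defect_second_moment) (rule that)
  define C where "C = sqrt K / (1 - 2 powr (1 / 4 - 1 :: real))"
  have "(2::real) powr (1 / 4 - 1) < 1" by (rule powr_less_one) auto
  then have C: "0 < C" using K(1) by (auto simp: C_def)
  have "\<bar>mean p q n - real n * rate p q\<bar> \<le> C * real n powr (1 / 4)"
    if adm: "admissible p" "admissible q" and n: "1 \<le> n" for p q n
  proof -
    interpret word_weights S p using adm admissible_weights by blast
    have "\<bar>mean p q (n + m) - mean p q n - mean p q m\<bar> \<le> sqrt K * real (n + m) powr (1 / 4)"
      if "1 \<le> n" "1 \<le> m" for n m
    proof -
      have "mean p q (n + m) = E n (\<lambda>xs. E m (\<lambda>ys. gn q xs + gn q ys - defect q xs ys))"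
        by (simp add: mean_def word_exp_append gn_append)
      also have "\<dots> = mean p q n + mean p q m - E n (\<lambda>xs. E m (\<lambda>ys. defect q xs ys))"
        by (simp add: word_exp_add word_exp_diff mean_def)
      finally have "\<bar>mean p q (n + m) - mean p q n - mean p q m\<bar> =
          \<bar>E (n + m) (\<lambda>zs. defect q (take n zs) (drop n zs))\<bar>"
        by (simp add: word_exp_pair)
      also have "\<dots> \<le> sqrt (E (n + m) (\<lambda>zs. (defect q (take n zs) (drop n zs))\<^sup>2))"
        by (rule word_exp_abs_le_sqrt)
      also have "\<dots> \<le> sqrt (K * sqrt (real (n + m)))"
        unfolding word_exp_pair[where F = "\<lambda>xs ys. (defect q xs ys)\<^sup>2"]
        using K(2)[OF adm] that by (intro real_sqrt_le_mono) auto
      finally show ?thesis by (simp add: real_sqrt_mult sqrt_sqrt)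
    qed
    then obtain L where L: "\<And>n. 1 \<le> n \<Longrightarrow> \<bar>mean p q n - real n * L\<bar> \<le> C * real n powr (1 / 4)"
      using almost_additive[of "1 / 4" "mean p q" "sqrt K"] unfolding C_def by auto
    have "(\<lambda>n. mean p q n / real n) \<longlonglongrightarrow> L" by (rule almost_additive_tendsto[OF _ L]) auto
    then have "rate p q = L" unfolding rate_def by (rule limI)
    then show ?thesis using L[OF n] by simp
  qed
  then show ?thesis using that C by blast
qed

lemma mean_tendsto:
  assumes "admissible p" "admissible q"
  shows "(\<lambda>n. mean p q n / real n) \<longlonglongrightarrow> rate p q"
proof -
  obtain C where "0 < C" "\<And>p q n. admissible p \<Longrightarrow> admissible q \<Longrightarrow> 1 \<le> n \<Longrightarrow>
    \<bar>mean p q n - real n * rate p q\<bar> \<le> C * real n powr (1 / 4)" by (rule mean_rate) (rule that)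
  then show ?thesis using assms by (intro almost_additive_tendsto[of "1 / 4" _ _ C]) auto
qed

text \<open>In the product over two independent halves the mixed terms vanish, since the letter sums
  are centred. What remains is the defect times the letter sum, at most N^(1/4) times
  \<open>B\<close> N^(1/2) by Cauchy-Schwarz. Linearity in \<open>B\<close> matters: the bound is
  applied to density increments that tend to 0.\<close>

lemma cov_rate_bound:
  obtains C where "0 < C" "\<And>p q w B n. admissible p \<Longrightarrow> admissible q \<Longrightarrow> (\<Sum>a\<in>S. p a * w a) = 0 \<Longrightarrow>
    (\<forall>a\<in>S. \<bar>w a\<bar> \<le> B) \<Longrightarrow> 1 \<le> n \<Longrightarrow>
    \<bar>cov p q w n - real n * cov_rate p q w\<bar> \<le> C * B * real n powr (3 / 4)"
proof -
  obtain K where K: "0 < K" "\<And>p q n m. admissible p \<Longrightarrow> admissible q \<Longrightarrow> 1 \<le> n + m \<Longrightarrow>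
    word_exp S p n (\<lambda>xs. word_exp S p m (\<lambda>ys. (defect q xs ys)\<^sup>2)) \<le> K * sqrt (real (n + m))"
    by (rule defect_second_moment) (rule that)
  define C where "C = sqrt K / (1 - 2 powr (3 / 4 - 1 :: real))"
  have "(2::real) powr (3 / 4 - 1) < 1" by (rule powr_less_one) auto
  then have C: "0 < C" using K(1) by (auto simp: C_def)
  have "\<bar>cov p q w n - real n * cov_rate p q w\<bar> \<le> C * B * real n powr (3 / 4)"
    if adm: "admissible p" "admissible q" and n: "1 \<le> n" and w: "(\<Sum>a\<in>S. p a * w a) = 0"
      "\<forall>a\<in>S. \<bar>w a\<bar> \<le> B" for p q w B n
  proof -
    interpret word_weights S p using adm admissible_weights by blast
    define W where "W xs = (\<Sum>x\<leftarrow>xs. w x)" for xs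
    have W0: "E n W = 0" for n unfolding W_def by (simp add: word_exp_letters w)
    have "S \<noteq> {}" using weights_sum by auto
    then have B: "0 \<le> B" using w(2) by fastforce
    have v: "(\<Sum>a\<in>S. p a * (w a)\<^sup>2) \<le> B\<^sup>2"
    proof -
      have "(\<Sum>a\<in>S. p a * (w a)\<^sup>2) \<le> (\<Sum>a\<in>S. p a * B\<^sup>2)"
        using w(2) weights_nonneg B by (intro sum_mono mult_left_mono) (auto simp: abs_le_square_iff[symmetric])
      then show ?thesis by simp
    qed
    have "\<bar>cov p q w (n + m) - cov p q w n - cov p q w m\<bar> \<le> sqrt K * B * real (n + m) powr (3 / 4)"
      if "1 \<le> n" "1 \<le> m" for n m
    proof -
      have "cov p q w (n + m) = E n (\<lambda>xs. E m (\<lambda>ys.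
          gn q xs * W xs + gn q xs * W ys + W xs * gn q ys + gn q ys * W ys - defect q xs ys * (W xs + W ys)))"
        unfolding cov_def word_exp_append gn_append by (intro word_exp_cong) (simp add: W_def algebra_simps)
      also have "\<dots> = cov p q w n + cov p q w m - E n (\<lambda>xs. E m (\<lambda>ys. defect q xs ys * (W xs + W ys)))"
        by (simp add: word_exp_add word_exp_diff word_exp_cmult word_exp_cmult_right W0 cov_def W_def[symmetric])
      finally have "\<bar>cov p q w (n + m) - cov p q w n - cov p q w m\<bar> =
          \<bar>E (n + m) (\<lambda>zs. defect q (take n zs) (drop n zs) * (W (take n zs) + W (drop n zs)))\<bar>"
        by (simp add: word_exp_pair[where F = "\<lambda>xs ys. defect q xs ys * (W xs + W ys)"])
      also have "\<dots> \<le> sqrt (E (n + m) (\<lambda>zs. (defect q (take n zs) (drop n zs))\<^sup>2)) *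
          sqrt (E (n + m) (\<lambda>zs. (W (take n zs) + W (drop n zs))\<^sup>2))"
        by (rule word_exp_mult_le_sqrt)
      also have "(\<lambda>zs. (W (take n zs) + W (drop n zs))\<^sup>2) = (\<lambda>zs. (W zs)\<^sup>2)"
      proof
        fix zs
        have "W zs = W (take n zs @ drop n zs)" by simp
        also have "\<dots> = W (take n zs) + W (drop n zs)" unfolding W_def map_append sum_list.append ..
        finally show "(W (take n zs) + W (drop n zs))\<^sup>2 = (W zs)\<^sup>2" by simp
      qed
      also have "E (n + m) (\<lambda>zs. (W zs)\<^sup>2) = real (n + m) * (\<Sum>a\<in>S. p a * (w a)\<^sup>2)"
        unfolding W_def by (rule word_exp_letters_square[OF w(1)])
      also have "sqrt (E (n + m) (\<lambda>zs. (defect q (take n zs) (drop n zs))\<^sup>2)) * sqrt \<dots> \<le>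
          sqrt (K * sqrt (real (n + m))) * sqrt (real (n + m) * B\<^sup>2)"
        unfolding word_exp_pair[where F = "\<lambda>xs ys. (defect q xs ys)\<^sup>2"]
        using K(2)[OF adm, of n m] K(1) that v
        by (intro mult_mono real_sqrt_le_mono mult_left_mono real_sqrt_ge_zero mult_nonneg_nonneg sum_nonneg)
          (auto intro: weights_nonneg)
      also have "\<dots> = sqrt K * B * (real (n + m) powr (1 / 4) * real (n + m) powr (1 / 2))"
        using B by (simp only: real_sqrt_mult sqrt_sqrt[OF of_nat_0_le_iff] powr_half_sqrt[OF of_nat_0_le_iff]
            real_sqrt_abs abs_of_nonneg mult_ac)
      also have "\<dots> = sqrt K * B * real (n + m) powr (3 / 4)" by (simp add: powr_add[symmetric])
      finally show ?thesis .
    qed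
    then obtain L where L: "\<And>n. 1 \<le> n \<Longrightarrow> \<bar>cov p q w n - real n * L\<bar> \<le> C * B * real n powr (3 / 4)"
      using almost_additive[of "3 / 4" "cov p q w" "sqrt K * B"] unfolding C_def by auto
    have "(\<lambda>n. cov p q w n / real n) \<longlonglongrightarrow> L" by (rule almost_additive_tendsto[OF _ L]) auto
    then have "cov_rate p q w = L" unfolding cov_rate_def by (rule limI)
    then show ?thesis using L[OF n] by simp
  qed
  then show ?thesis using that C by blast
qed

lemma cov_tendsto:
  assumes "admissible p" "admissible q" and w: "(\<Sum>a\<in>S. p a * w a) = 0"
  shows "(\<lambda>n. cov p q w n / real n) \<longlonglongrightarrow> cov_rate p q w"
proof -
  obtain C where C: "0 < C" "\<And>p q w B n. admissible p \<Longrightarrow> admissible q \<Longrightarrow> (\<Sum>a\<in>S. p a * w a) = 0 \<Longrightarrow>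
    (\<forall>a\<in>S. \<bar>w a\<bar> \<le> B) \<Longrightarrow> 1 \<le> n \<Longrightarrow>
    \<bar>cov p q w n - real n * cov_rate p q w\<bar> \<le> C * B * real n powr (3 / 4)" by (rule cov_rate_bound) (rule that)
  have "\<bar>w a\<bar> \<le> (\<Sum>a\<in>S. \<bar>w a\<bar>)" if "a \<in> S" for a
    using that finite_S by (intro member_le_sum) auto
  then show ?thesis
    using C(2)[OF assms] by (intro almost_additive_tendsto[of "3 / 4" _ _ "C * (\<Sum>a\<in>S. \<bar>w a\<bar>)"]) auto
qed

lemma gn_single_bound:
  obtains K where "0 < K" "\<And>q a. admissible q \<Longrightarrow> a \<in> S \<Longrightarrow> \<bar>gn q [a]\<bar> \<le> K"
proof -
  have "\<bar>gn q [a]\<bar> \<le> \<bar>ln green_bound + ln (1 / \<epsilon>)\<bar> + 1" if "admissible q" "a \<in> S" for q a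
    using green_norm_word_bound[of q "[a]"] that by simp
  then show ?thesis using that[of "\<bar>ln green_bound + ln (1 / \<epsilon>)\<bar> + 1"] by auto
qed

text \<open>The uniform rate at time 1, where the covariance is a single sum over letters.\<close>

lemma cov_rate_le:
  obtains C where "0 < C" "\<And>p q w B. admissible p \<Longrightarrow> admissible q \<Longrightarrow> (\<Sum>a\<in>S. p a * w a) = 0 \<Longrightarrow>
    (\<forall>a\<in>S. \<bar>w a\<bar> \<le> B) \<Longrightarrow> \<bar>cov_rate p q w\<bar> \<le> C * B"
proof -
  obtain C where C: "0 < C" "\<And>p q w B n. admissible p \<Longrightarrow> admissible q \<Longrightarrow> (\<Sum>a\<in>S. p a * w a) = 0 \<Longrightarrow>
    (\<forall>a\<in>S. \<bar>w a\<bar> \<le> B) \<Longrightarrow> 1 \<le> n \<Longrightarrow>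
    \<bar>cov p q w n - real n * cov_rate p q w\<bar> \<le> C * B * real n powr (3 / 4)" by (rule cov_rate_bound) (rule that)
  obtain K where K: "0 < K" "\<And>q a. admissible q \<Longrightarrow> a \<in> S \<Longrightarrow> \<bar>gn q [a]\<bar> \<le> K"
    by (rule gn_single_bound) (rule that)
  have "\<bar>cov_rate p q w\<bar> \<le> (C + K) * B"
    if adm: "admissible p" "admissible q" and w: "(\<Sum>a\<in>S. p a * w a) = 0"
      "\<forall>a\<in>S. \<bar>w a\<bar> \<le> B" for p q w B
  proof -
    interpret word_weights S p using adm admissible_weights by blast
    have "\<bar>cov p q w 1\<bar> = \<bar>\<Sum>a\<in>S. p a * (gn q [a] * w a)\<bar>" by (simp add: cov_def)
    also have "\<dots> \<le> (\<Sum>a\<in>S. p a * (K * B))"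
    proof (rule order_trans[OF sum_abs sum_mono])
      fix a assume a: "a \<in> S"
      have "\<bar>gn q [a]\<bar> * \<bar>w a\<bar> \<le> K * B" using K adm w a by (intro mult_mono) auto
      then show "\<bar>p a * (gn q [a] * w a)\<bar> \<le> p a * (K * B)"
        using weights_nonneg[OF a] by (simp add: abs_mult mult_left_mono)
    qed
    finally have "\<bar>cov p q w 1\<bar> \<le> K * B" by simp
    then show ?thesis using C(2)[OF adm w order_refl] by (simp add: distrib_right abs_le_iff)
  qed
  then show ?thesis using that[of "C + K"] C(1) K(1) by auto
qed

lemma cov_rate_diff_scaled:
  assumes "admissible p" "admissible q" "(\<Sum>a\<in>S. p a * v a) = 0" "(\<Sum>a\<in>S. p a * w a) = 0"
  shows "cov_rate p q (\<lambda>a. v a - t * w a) = cov_rate p q v - t * cov_rate p q w"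
proof -
  interpret word_weights S p using assms admissible_weights by blast
  have "cov p q (\<lambda>a. v a - t * w a) n / real n = cov p q v n / real n - t * (cov p q w n / real n)" for n
  proof -
    have "cov p q (\<lambda>a. v a - t * w a) n =
        E n (\<lambda>xs. gn q xs * (\<Sum>x\<leftarrow>xs. v x) - t * (gn q xs * (\<Sum>x\<leftarrow>xs. w x)))"
      unfolding cov_def
      by (intro word_exp_cong) (simp add: sum_list_subtractf sum_list_const_mult algebra_simps)
    then show ?thesis by (simp add: cov_def word_exp_diff word_exp_cmult diff_divide_distrib)
  qed
  then have "(\<lambda>n. cov p q (\<lambda>a. v a - t * w a) n / real n) \<longlonglongrightarrow> cov_rate p q v - t * cov_rate p q w"
    using assms by (simp only:) (intro tendsto_intros cov_tendsto)
  then show ?thesis unfolding cov_rate_def by (rule limI)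
qed

text \<open>Minkowski's inequality applied to \<open>Z\<^sub>2\<^sub>n\<close> as a product of two independent copies of \<open>Z\<^sub>n\<close>.\<close>

lemma linear_variance:
  obtains C where "0 < C" "\<And>p q k. admissible p \<Longrightarrow> admissible q \<Longrightarrow>
    sqrt (word_exp S p (2 ^ k) (\<lambda>xs. (gn q xs - mean p q (2 ^ k))\<^sup>2)) \<le> C * sqrt (2 ^ k)"
proof -
  obtain K where K: "0 < K" "\<And>p q n m. admissible p \<Longrightarrow> admissible q \<Longrightarrow> 1 \<le> n + m \<Longrightarrow>
    word_exp S p n (\<lambda>xs. word_exp S p m (\<lambda>ys. (defect q xs ys)\<^sup>2)) \<le> K * sqrt (real (n + m))"
    by (rule defect_second_moment) (rule that)
  obtain K1 where K1: "0 < K1" "\<And>q a. admissible q \<Longrightarrow> a \<in> S \<Longrightarrow> \<bar>gn q [a]\<bar> \<le> K1"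
    by (rule gn_single_bound) (rule that)
  define \<beta> where "\<beta> = sqrt (sqrt (2::real))"
  have \<beta>: "\<beta>\<^sup>2 = sqrt 2" "1 < \<beta>" by (auto simp: \<beta>_def)
  then have \<beta>2: "\<beta> < sqrt 2" unfolding \<beta>(1)[symmetric] by (simp add: power2_eq_square)
  \<comment> \<open>The defect adds an error of order \<open>\<beta> ^ k\<close> at scale
    \<open>2 ^ k\<close>, smaller than \<open>sqrt 2 ^ k\<close>. Subtracting
    \<open>D * \<beta> ^ k\<close> in the induction hypothesis absorbs it; \<open>D\<close> solves
    the resulting equation \<open>D'\<close>.\<close>
  define D where "D = sqrt K * \<beta> / (sqrt 2 - \<beta>)"
  have D: "0 < D" using K(1) \<beta> \<beta>2 by (simp add: D_def)
  have D': "sqrt 2 * D - sqrt K * \<beta> = \<beta> * D" using \<beta>2 by (simp add: D_def field_simps)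
  define C where "C = K1 + D"
  have main: "sqrt (word_exp S p (2 ^ k) (\<lambda>xs. (gn q xs - mean p q (2 ^ k))\<^sup>2)) \<le> C * sqrt 2 ^ k - D * \<beta> ^ k"
    if adm: "admissible p" "admissible q" for p q k
  proof (induction k)
    case 0
    interpret word_weights S p using adm admissible_weights by blast
    have "E 1 (\<lambda>xs. (gn q xs - mean p q 1)\<^sup>2) \<le> E 1 (\<lambda>xs. (gn q xs)\<^sup>2)"
      using word_exp_centered_square[of 1 "gn q"] by (simp add: mean_def)
    also have "\<dots> \<le> K1\<^sup>2"
    proof (rule word_exp_le_const)
      fix xs assume "length xs = 1" "set xs \<subseteq> S"
      then obtain a where "xs = [a]" "a \<in> S" by (cases xs) auto
      then show "(gn q xs)\<^sup>2 \<le> K1\<^sup>2" using power_mono[OF K1(2)[OF adm(2)] abs_ge_zero, of a 2] by simp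
    qed
    finally show ?case using K1(1) by (simp add: C_def real_le_lsqrt)
  next
    case (Suc k)
    interpret word_weights S p using adm admissible_weights by blast
    define n where "n = (2::nat) ^ k"
    have nn: "n + n = 2 ^ Suc k" by (simp add: n_def)
    define X where "X xs = gn q xs - mean p q n" for xs
    define s where "s = sqrt (E n (\<lambda>xs. (X xs)\<^sup>2))"
    have X0: "E n X = 0" unfolding X_def word_exp_diff word_exp_const mean_def by simp
    \<comment> \<open>\<open>- M\<close> is the mean of the defect, so the second summand below is a
      centred defect, and its variance is at most the second moment.\<close>
    define M where "M = mean p q (n + n) - 2 * mean p q n"
    have eq: "gn q zs - mean p q (n + n) = (X (take n zs) + X (drop n zs)) +
        (- 1) * (defect q (take n zs) (drop n zs) + M)" for zs
      using gn_append[of q "take n zs" "drop n zs"] by (simp add: X_def M_def)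
    have M: "E (n + n) (\<lambda>zs. defect q (take n zs) (drop n zs)) = - M"
    proof -
      have "mean p q (n + n) = E n (\<lambda>xs. E n (\<lambda>ys. gn q xs + gn q ys - defect q xs ys))"
        by (simp add: mean_def word_exp_append gn_append)
      then show ?thesis by (simp add: word_exp_pair word_exp_add word_exp_diff mean_def M_def)
    qed
    have "sqrt (E (n + n) (\<lambda>zs. (gn q zs - mean p q (n + n))\<^sup>2)) \<le>
        sqrt (E (n + n) (\<lambda>zs. (X (take n zs) + X (drop n zs))\<^sup>2)) +
        sqrt (E (n + n) (\<lambda>zs. ((- 1) * (defect q (take n zs) (drop n zs) + M))\<^sup>2))"
      unfolding eq by (rule Minkowski_word_exp)
    also have "E (n + n) (\<lambda>zs. (X (take n zs) + X (drop n zs))\<^sup>2) = 2 * E n (\<lambda>xs. (X xs)\<^sup>2)"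
    proof -
      have "E n (\<lambda>xs. E n (\<lambda>ys. (X xs + X ys)\<^sup>2)) = E n (\<lambda>xs. E n (\<lambda>ys. (X xs)\<^sup>2 + 2 * X xs * X ys + (X ys)\<^sup>2))"
        by (intro word_exp_cong) (simp add: power2_sum algebra_simps)
      also have "\<dots> = 2 * E n (\<lambda>xs. (X xs)\<^sup>2)"
        by (simp only: word_exp_add word_exp_cmult word_exp_const X0 mult_zero_right)
      finally show ?thesis by (simp add: word_exp_pair[where F = "\<lambda>xs ys. (X xs + X ys)\<^sup>2"])
    qed
    also have "E (n + n) (\<lambda>zs. ((- 1) * (defect q (take n zs) (drop n zs) + M))\<^sup>2) \<le> K * sqrt (real (n + n))"
    proof -
      have "E (n + n) (\<lambda>zs. ((- 1) * (defect q (take n zs) (drop n zs) + M))\<^sup>2) =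
          E (n + n) (\<lambda>zs. (defect q (take n zs) (drop n zs) + M)\<^sup>2)"
        by (intro word_exp_cong) (simp add: power2_eq_square algebra_simps)
      also have "\<dots> \<le> E (n + n) (\<lambda>zs. (defect q (take n zs) (drop n zs))\<^sup>2)"
        using word_exp_centered_square[of "n + n" "\<lambda>zs. defect q (take n zs) (drop n zs)"]
        by (simp add: M)
      also have "\<dots> \<le> K * sqrt (real (n + n))"
        unfolding word_exp_pair[where F = "\<lambda>xs ys. (defect q xs ys)\<^sup>2"]
        by (rule K(2)[OF adm]) (simp add: n_def trans_le_add1)
      finally show ?thesis .
    qed
    also have "sqrt (2 * E n (\<lambda>xs. (X xs)\<^sup>2)) = sqrt 2 * s" by (simp add: s_def real_sqrt_mult)
    also have "sqrt (K * sqrt (real (n + n))) = sqrt K * \<beta> ^ Suc k"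
      by (simp add: n_def real_sqrt_mult \<beta>_def real_sqrt_power mult_2[symmetric] flip: power_Suc)
    also have "sqrt 2 * s \<le> sqrt 2 * (C * sqrt 2 ^ k - D * \<beta> ^ k)"
      using Suc by (intro mult_left_mono) (auto simp: s_def X_def n_def)
    also have "sqrt 2 * (C * sqrt 2 ^ k - D * \<beta> ^ k) + sqrt K * \<beta> ^ Suc k =
        C * sqrt 2 ^ Suc k - (sqrt 2 * D - sqrt K * \<beta>) * \<beta> ^ k"
      by (simp add: algebra_simps)
    also have "\<dots> = C * sqrt 2 ^ Suc k - D * \<beta> ^ Suc k" by (simp add: D')
    finally show ?case unfolding nn by simp
  qed
  show ?thesis
  proof (rule that[of C])
    show "0 < C" using K1(1) D by (simp add: C_def)
    fix p q k assume "admissible p" "admissible q"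
    then have "sqrt (word_exp S p (2 ^ k) (\<lambda>xs. (gn q xs - mean p q (2 ^ k))\<^sup>2)) \<le> C * sqrt 2 ^ k - D * \<beta> ^ k"
      by (rule main)
    also have "\<dots> \<le> C * sqrt (2 ^ k)" using D \<beta> by (simp add: real_sqrt_power)
    finally show "sqrt (word_exp S p (2 ^ k) (\<lambda>xs. (gn q xs - mean p q (2 ^ k))\<^sup>2)) \<le> C * sqrt (2 ^ k)" .
  qed
qed

end

section \<open>Entropy and the comparison of Green speeds\<close>

context hyperbolic_walks
begin

definition entropy :: "('a \<Rightarrow> real) \<Rightarrow> nat \<Rightarrow> real" where
  "entropy p n = word_exp S p n (\<lambda>ws. - ln (u p n (word_prod G ws)))"

lemma step_prob_word_pos:
  assumes "admissible p" "set ws \<subseteq> S"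
  shows "0 < u p (length ws) (word_prod G ws)"
proof -
  interpret weighted_walk_group G S p
    using assms(1) by (simp add: admissible_walk)
  have "0 < \<epsilon> ^ length ws" using eps_pos by simp
  also have "\<dots> \<le> u p (length ws) (word_prod G ws)"
    using eps_pos eps_le[OF assms(1)] assms(2) by (intro step_prob_word_ge) auto
  finally show ?thesis .
qed

lemma mean_le_entropy:
  assumes adm: "admissible p"
  shows "mean p p n \<le> ln green_bound + entropy p n"
proof -
  interpret word_weights S p using adm admissible_weights by blast
  have "mean p p n \<le> E n (\<lambda>ws. ln green_bound + - ln (u p n (word_prod G ws)))"
    unfolding mean_def
  proof (rule word_exp_mono)
    fix ws assume ws: "length ws = n" "set ws \<subseteq> S"
    have "0 < u p n (word_prod G ws)" using step_prob_word_pos[OF adm ws(2)] ws(1) by simp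
    then have "ln (u p n (word_prod G ws)) \<le> ln (green G S p (word_prod G ws))"
      using step_prob_le_green[OF adm, of "word_prod G ws" n] ws by (intro ln_mono) auto
    moreover have "ln (green G S p \<one>) \<le> ln green_bound"
      using green_one_ge_1[OF adm] green_le[OF adm, of \<one>] by (intro ln_mono) auto
    ultimately show "gn p ws \<le> ln green_bound + - ln (u p n (word_prod G ws))"
      by (simp add: green_norm_def)
  qed
  then show ?thesis by (simp only: word_exp_add word_exp_const entropy_def)
qed

text \<open>Gibbs' inequality against the Green function normalised on the support of the \<open>n\<close>-step
  distribution, where its total mass is \<open>O(n)\<close> by transience.\<close>

lemma entropy_le_mean:
  assumes adm: "admissible p" "admissible q" and n: "1 \<le> n"
  shows "entropy p n \<le> mean p q n + ln (2 * (2 ^ truncation_factor * real n))"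
proof -
  interpret P: weighted_walk_group G S p
    using adm(1) by (simp add: admissible_walk)
  interpret Q: weighted_walk_group G S q
    using adm(2) by (simp add: admissible_walk)
  define W where "W = word_prod G ` {ws. set ws \<subseteq> S \<and> length ws = n}"
  define M where "M = 2 * (2 ^ truncation_factor * real n)"
  have M: "0 < M" using n by (simp add: M_def)
  have W: "finite W" unfolding W_def using finite_words by simp
  have up: "0 < u p n x" and car: "x \<in> carrier G" if "x \<in> W" for x
    using that step_prob_word_pos[OF adm(1)] by (auto simp: W_def)
  have mass: "(\<Sum>x\<in>W. green G S q x) \<le> M"
  proof -
    have "(\<Sum>x\<in>W. green G S q x) \<le> (\<Sum>x\<in>W. 2 * (\<Sum>i<2 ^ truncation_factor * n. u q i x))"
      using green_truncate[OF adm(2) n] by (intro sum_mono) (auto simp: W_def)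
    also have "\<dots> = 2 * (\<Sum>i<2 ^ truncation_factor * n. \<Sum>x\<in>W. u q i x)"
      by (simp add: sum_distrib_left) (rule sum.swap)
    also have "\<dots> \<le> 2 * (\<Sum>i<2 ^ truncation_factor * n. 1)"
      using Q.sum_step_prob_le_1[OF W] by (intro mult_left_mono sum_mono) auto
    finally show ?thesis by (simp add: M_def)
  qed
  have "entropy p n - mean p q n - ln M =
      P.E n (\<lambda>ws. - ln (u p n (word_prod G ws)) - gn q ws - ln M)"
    unfolding word_exp_diff P.word_exp_const by (simp add: entropy_def mean_def)
  also have "\<dots> \<le> P.E n (\<lambda>ws. green G S q (word_prod G ws) / (M * u p n (word_prod G ws)) - 1)"
  proof (rule P.word_exp_mono)
    fix ws assume "length ws = n" "set ws \<subseteq> S"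
    then have x: "word_prod G ws \<in> W" by (auto simp: W_def)
    have g: "0 < green G S q (word_prod G ws)" using green_pos[OF adm(2) car[OF x]] .
    have "- ln (u p n (word_prod G ws)) - gn q ws - ln M \<le>
        ln (green G S q (word_prod G ws)) - ln (M * u p n (word_prod G ws))"
      using green_one_ge_1[OF adm(2)] M up[OF x] by (simp add: green_norm_def ln_mult)
    also have "\<dots> = ln (green G S q (word_prod G ws) / (M * u p n (word_prod G ws)))"
      using g M up[OF x] by (subst ln_div) auto
    also have "\<dots> \<le> green G S q (word_prod G ws) / (M * u p n (word_prod G ws)) - 1"
      using g M up[OF x] by (intro ln_le_minus_one) auto
    finally show "- ln (u p n (word_prod G ws)) - gn q ws - ln M \<le>
      green G S q (word_prod G ws) / (M * u p n (word_prod G ws)) - 1" .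
  qed
  also have "\<dots> = (\<Sum>x\<in>W. u p n x * (green G S q x / (M * u p n x))) - 1"
    unfolding word_exp_diff P.word_exp_const
    by (subst word_exp_word_prod[OF W, where f = "\<lambda>x. green G S q x / (M * u p n x)"]) (auto simp: W_def)
  also have "(\<Sum>x\<in>W. u p n x * (green G S q x / (M * u p n x))) = (\<Sum>x\<in>W. green G S q x) / M"
    unfolding sum_divide_distrib
  proof (intro sum.cong refl)
    fix x assume "x \<in> W"
    then have "u p n x \<noteq> 0" using up by force
    then show "u p n x * (green G S q x / (M * u p n x)) = green G S q x / M" by simp
  qed
  also have "\<dots> - 1 \<le> 0" using mass M by simp
  finally show ?thesis by (simp add: M_def)
qed

lemma entropy_upper:
  assumes adm: "admissible p" "admissible q"
  defines "B n \<equiv> ln (2 * (2 ^ truncation_factor * real n)) / real n"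
  shows "\<forall>\<^sub>F n in sequentially. entropy p n / real n \<le> mean p q n / real n + B n"
    and "(\<lambda>n. mean p q n / real n + B n) \<longlonglongrightarrow> rate p q"
proof -
  show "\<forall>\<^sub>F n in sequentially. entropy p n / real n \<le> mean p q n / real n + B n"
  proof (rule eventually_sequentiallyI[of 1])
    fix n :: nat assume "1 \<le> n"
    from divide_right_mono[OF entropy_le_mean[OF adm this], of "real n"]
    show "entropy p n / real n \<le> mean p q n / real n + B n" by (simp add: B_def add_divide_distrib)
  qed
  have "(\<lambda>n. ln (2 * (A * real n)) / real n) \<longlonglongrightarrow> 0" if "0 < A" for A
    using that by real_asymp
  then have "B \<longlonglongrightarrow> 0" unfolding B_def by simp
  then show "(\<lambda>n. mean p q n / real n + B n) \<longlonglongrightarrow> rate p q"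
    using tendsto_add[OF mean_tendsto[OF adm]] by fastforce
qed

lemma entropy_tendsto:
  assumes adm: "admissible p"
  shows "(\<lambda>n. entropy p n / real n) \<longlonglongrightarrow> rate p p"
proof (rule tendsto_sandwich[OF _ entropy_upper(1)[OF adm adm] _ entropy_upper(2)[OF adm adm]])
  show "\<forall>\<^sub>F n in sequentially. mean p p n / real n - ln green_bound / real n \<le> entropy p n / real n"
  proof (rule always_eventually, rule allI)
    fix n
    have "(mean p p n - ln green_bound) / real n \<le> entropy p n / real n"
      using mean_le_entropy[OF adm, of n] by (intro divide_right_mono) auto
    then show "mean p p n / real n - ln green_bound / real n \<le> entropy p n / real n"
      by (simp add: diff_divide_distrib)
  qed
  show "(\<lambda>n. mean p p n / real n - ln green_bound / real n) \<longlonglongrightarrow> rate p p"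
    using tendsto_diff[OF mean_tendsto[OF adm adm] lim_const_over_n] by simp
qed

lemma rate_le:
  assumes adm: "admissible p" "admissible q"
  shows "rate p p \<le> rate p q"
  by (rule tendsto_le[OF sequentially_bot entropy_upper(2)[OF adm] entropy_tendsto[OF adm(1)] entropy_upper(1)[OF adm]])

section \<open>Perturbation of the step distribution\<close>

text \<open>The density of the perturbed words is \<open>1 + W\<close> plus a remainder of mean zero
  and norm at most \<open>n * B\<^sup>2\<close> in mean square; the term \<open>W\<close> produces
  the covariance. As the remainder is centred, the Green norm may be replaced by its deviation from
  the mean, so that only the standard deviation enters.\<close>

lemma mean_perturbation:
  obtains C where "0 < C" "\<And>p p' q w B k. admissible p \<Longrightarrow> admissible p' \<Longrightarrow> admissible q \<Longrightarrow>
    (\<forall>a\<in>S. p' a = p a * (1 + w a)) \<Longrightarrow> (\<forall>a\<in>S. \<bar>w a\<bar> \<le> B) \<Longrightarrow> 2 ^ k * B\<^sup>2 \<le> 1 \<Longrightarrow>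
    \<bar>mean p' q (2 ^ k) - mean p q (2 ^ k) - cov p q w (2 ^ k)\<bar> \<le> C * sqrt (2 ^ k) * (2 ^ k * B\<^sup>2)"
proof -
  obtain C where C: "0 < C" "\<And>p q k. admissible p \<Longrightarrow> admissible q \<Longrightarrow>
    sqrt (word_exp S p (2 ^ k) (\<lambda>xs. (gn q xs - mean p q (2 ^ k))\<^sup>2)) \<le> C * sqrt (2 ^ k)"
    by (rule linear_variance) (rule that)
  have "\<bar>mean p' q (2 ^ k) - mean p q (2 ^ k) - cov p q w (2 ^ k)\<bar> \<le> C * sqrt (2 ^ k) * (2 ^ k * B\<^sup>2)"
    if adm: "admissible p" "admissible p'" "admissible q" and p': "\<forall>a\<in>S. p' a = p a * (1 + w a)"
      and w: "\<forall>a\<in>S. \<bar>w a\<bar> \<le> B" and small: "2 ^ k * B\<^sup>2 \<le> 1" for p p' q w B k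
  proof -
    interpret P: word_weights S p using adm admissible_weights by blast
    define n where "n = (2::nat) ^ k"
    define \<Lambda> where "\<Lambda> xs = prod_list (map (\<lambda>a. 1 + w a) xs)" for xs
    define W where "W xs = (\<Sum>x\<leftarrow>xs. w x)" for xs
    define v where "v = (\<Sum>a\<in>S. p a * (w a)\<^sup>2)"
    have change: "word_exp S p' n F = P.E n (\<lambda>xs. \<Lambda> xs * F xs)" for F
      unfolding \<Lambda>_def using p' by (intro word_exp_change_weights) simp
    have w0: "(\<Sum>a\<in>S. p a * w a) = 0"
      by (rule P.density_centered[OF admissible_weights[OF adm(2)] p'])
    have L1: "P.E n \<Lambda> = 1" using change[of "\<lambda>_. 1"] word_weights.word_exp_const[OF admissible_weights[OF adm(2)]] by simp
    have W0: "P.E n W = 0" unfolding W_def by (simp add: P.word_exp_letters w0)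
    have v: "0 \<le> v" "v \<le> B\<^sup>2"
    proof -
      show "0 \<le> v" unfolding v_def by (intro sum_nonneg mult_nonneg_nonneg P.weights_nonneg) auto
      have "v \<le> (\<Sum>a\<in>S. p a * B\<^sup>2)"
        unfolding v_def using w P.weights_nonneg
        by (intro sum_mono mult_left_mono) (auto intro: power2_le_iff_abs_le[THEN iffD2] simp: abs_le_square_iff[symmetric])
      then show "v \<le> B\<^sup>2" by simp
    qed
    have nv: "0 \<le> real n * v" "real n * v \<le> real n * B\<^sup>2"
      using v by (auto intro: mult_left_mono)
    have "real n * B\<^sup>2 \<le> 1" using small by (simp add: n_def)
    then have nv1: "real n * v \<le> 1" using nv(2) by linarith
    have "(1 + v) ^ n \<le> exp v ^ n" using v by (intro power_mono) auto
    also have "\<dots> = exp (real n * v)" by (simp add: exp_of_nat_mult)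
    \<comment> \<open>Here the smallness of \<open>2 ^ k * B\<^sup>2\<close> is spent: the quadratic
      bound for the exponential holds on the unit interval.\<close>
    also have "\<dots> \<le> 1 + real n * v + (real n * v)\<^sup>2" by (rule exp_bound[OF nv(1) nv1])
    finally have rem: "sqrt (P.E n (\<lambda>xs. (\<Lambda> xs - 1 - W xs)\<^sup>2)) \<le> real n * v"
      unfolding \<Lambda>_def W_def P.word_exp_density_remainder[OF w0 v_def] using nv by (intro real_le_lsqrt) auto
    define m where "m = mean p q n"
    have "P.E n (\<lambda>xs. (gn q xs - m) * (\<Lambda> xs - 1 - W xs)) =
        P.E n (\<lambda>xs. \<Lambda> xs * gn q xs - gn q xs - gn q xs * W xs - (m * \<Lambda> xs - m - m * W xs))"
      by (intro word_exp_cong) (simp add: algebra_simps)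
    also have "\<dots> = mean p' q n - mean p q n - cov p q w n"
      unfolding word_exp_diff word_exp_cmult L1 W0 P.word_exp_const
      by (simp add: mean_def change cov_def W_def)
    finally have "\<bar>mean p' q n - mean p q n - cov p q w n\<bar> =
        \<bar>P.E n (\<lambda>xs. (gn q xs - m) * (\<Lambda> xs - 1 - W xs))\<bar>" by simp
    also have "\<dots> \<le> sqrt (P.E n (\<lambda>xs. (gn q xs - m)\<^sup>2)) * sqrt (P.E n (\<lambda>xs. (\<Lambda> xs - 1 - W xs)\<^sup>2))"
      by (rule P.word_exp_mult_le_sqrt)
    also have "\<dots> \<le> (C * sqrt (2 ^ k)) * (real n * B\<^sup>2)"
    proof (intro mult_mono)
      show "sqrt (P.E n (\<lambda>xs. (gn q xs - m)\<^sup>2)) \<le> C * sqrt (2 ^ k)"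
        unfolding m_def n_def by (rule C(2)[OF adm(1,3)])
      show "sqrt (P.E n (\<lambda>xs. (\<Lambda> xs - 1 - W xs)\<^sup>2)) \<le> real n * B\<^sup>2" using rem nv by linarith
    qed (use C(1) in \<open>auto intro!: P.word_exp_nonneg\<close>)
    finally show ?thesis by (simp add: n_def)
  qed
  then show ?thesis using that C(1) by blast
qed

text \<open>Means and covariances at time N are replaced by N times their rates and the result is
  divided by N. The three terms come from the two means, from the remainder of the density and from
  the covariance.\<close>

lemma rate_perturbation:
  obtains C where "0 < C" "\<And>p p' q w B k. admissible p \<Longrightarrow> admissible p' \<Longrightarrow> admissible q \<Longrightarrow>
    (\<forall>a\<in>S. p' a = p a * (1 + w a)) \<Longrightarrow> (\<forall>a\<in>S. \<bar>w a\<bar> \<le> B) \<Longrightarrow> 2 ^ k * B\<^sup>2 \<le> 1 \<Longrightarrow>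
    \<bar>rate p' q - rate p q - cov_rate p q w\<bar> \<le>
      C * ((2 ^ k) powr (- 3 / 4) + sqrt (2 ^ k) * B\<^sup>2 + B * (2 ^ k) powr (- 1 / 4))"
proof -
  obtain C1 where C1: "0 < C1" "\<And>p q n. admissible p \<Longrightarrow> admissible q \<Longrightarrow> 1 \<le> n \<Longrightarrow>
    \<bar>mean p q n - real n * rate p q\<bar> \<le> C1 * real n powr (1 / 4)"
    by (rule mean_rate) (rule that)
  obtain C2 where C2: "0 < C2" "\<And>p q w B n. admissible p \<Longrightarrow> admissible q \<Longrightarrow> (\<Sum>a\<in>S. p a * w a) = 0 \<Longrightarrow>
    (\<forall>a\<in>S. \<bar>w a\<bar> \<le> B) \<Longrightarrow> 1 \<le> n \<Longrightarrow>
    \<bar>cov p q w n - real n * cov_rate p q w\<bar> \<le> C2 * B * real n powr (3 / 4)"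
    by (rule cov_rate_bound) (rule that)
  obtain C3 where C3: "0 < C3" "\<And>p p' q w B k. admissible p \<Longrightarrow> admissible p' \<Longrightarrow> admissible q \<Longrightarrow>
    (\<forall>a\<in>S. p' a = p a * (1 + w a)) \<Longrightarrow> (\<forall>a\<in>S. \<bar>w a\<bar> \<le> B) \<Longrightarrow> 2 ^ k * B\<^sup>2 \<le> 1 \<Longrightarrow>
    \<bar>mean p' q (2 ^ k) - mean p q (2 ^ k) - cov p q w (2 ^ k)\<bar> \<le> C3 * sqrt (2 ^ k) * (2 ^ k * B\<^sup>2)"
    by (rule mean_perturbation) (rule that)
  define C where "C = 2 * C1 + C2 + C3"
  have "\<bar>rate p' q - rate p q - cov_rate p q w\<bar> \<le>
      C * ((2 ^ k) powr (- 3 / 4) + sqrt (2 ^ k) * B\<^sup>2 + B * (2 ^ k) powr (- 1 / 4))"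
    if adm: "admissible p" "admissible p'" "admissible q" and p': "\<forall>a\<in>S. p' a = p a * (1 + w a)"
      and w: "\<forall>a\<in>S. \<bar>w a\<bar> \<le> B" and small: "2 ^ k * B\<^sup>2 \<le> 1" for p p' q w B k
  proof -
    interpret P: word_weights S p using adm admissible_weights by blast
    have w0: "(\<Sum>a\<in>S. p a * w a) = 0"
      by (rule P.density_centered[OF admissible_weights[OF adm(2)] p'])
    have "S \<noteq> {}" using P.weights_sum by auto
    then have B: "0 \<le> B" using w by fastforce
    define N where "N = (2::real) ^ k"
    have N: "0 < N" "real (2 ^ k) = N" by (simp_all add: N_def)
    have n1: "(1::nat) \<le> 2 ^ k" by simp
    have "\<bar>N * (rate p' q - rate p q - cov_rate p q w)\<bar> \<le>
        2 * (C1 * N powr (1 / 4)) + C2 * B * N powr (3 / 4) + C3 * sqrt N * (N * B\<^sup>2)"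
      using C1(2)[OF adm(1,3) n1] C1(2)[OF adm(2,3) n1] C2(2)[OF adm(1,3) w0 w n1]
        C3(2)[OF adm p' w small] unfolding N(2) N_def[symmetric] by (simp add: algebra_simps)
    also have "\<dots> \<le> C * (N powr (1 / 4) + B * N powr (3 / 4) + sqrt N * (N * B\<^sup>2))"
      unfolding C_def using C1(1) C2(1) C3(1) B N
      by (simp add: algebra_simps add_nonneg_nonneg)
    also have "\<dots> = N * (C * (N powr (- 3 / 4) + sqrt N * B\<^sup>2 + B * N powr (- 1 / 4)))"
    proof -
      have "N powr (1 / 4) = N * N powr (- 3 / 4)" "N powr (3 / 4) = N * N powr (- 1 / 4)"
        using N(1) by (simp_all add: powr_mult_base)
      then show ?thesis by (simp add: algebra_simps)
    qed
    finally show ?thesis using N(1) unfolding N_def[symmetric] by (simp add: abs_mult)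
  qed
  moreover have "0 < C" using C1(1) C2(1) C3(1) by (simp add: C_def)
  ultimately show ?thesis using that by blast
qed

section \<open>Continuity in the law of the Green metric, and the derivative\<close>

text \<open>Each term is a polynomial in the weights, and the common geometric bound of admissible
  laws dominates the series.\<close>

lemma tendsto_green:
  assumes adm0: "admissible p" and adm: "\<forall>\<^sub>F t in F. admissible (q t)"
    and q: "\<And>a. a \<in> S \<Longrightarrow> ((\<lambda>t. q t a) \<longlongrightarrow> p a) F" and x: "x \<in> carrier G" and F: "F \<noteq> bot"
  shows "((\<lambda>t. green G S (q t) x) \<longlongrightarrow> green G S p x) F"
proof -
  have "((\<lambda>t. \<Sum>n. u (q t) n x) \<longlongrightarrow> (\<Sum>n. u p n x)) F"
  proof (rule tannerys_theorem[THEN conjunct2, THEN conjunct2])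
    show "((\<lambda>t. u (q t) n x) \<longlongrightarrow> u p n x) F" for n
      unfolding step_prob_def by (intro tendsto_word_exp q) auto
    have "\<forall>\<^sub>F z in sequentially \<times>\<^sub>F F. True \<and> admissible (q (snd z))"
      using eventually_prodI[OF always_eventually adm, of "\<lambda>_. True" sequentially] by simp
    then show "\<forall>\<^sub>F (n, t) in sequentially \<times>\<^sub>F F. norm (u (q t) n x) \<le> C\<^sub>0 * \<rho> ^ n"
    proof (rule eventually_mono)
      fix z :: "nat \<times> _" assume z: "True \<and> admissible (q (snd z))"
      obtain n t where nt: "z = (n, t)" by fastforce
      interpret weighted_walk_group G S "q t"
        using z nt by (simp add: admissible_walk)
      show "(case z of (n, t) \<Rightarrow> norm (u (q t) n x) \<le> C\<^sub>0 * \<rho> ^ n)"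
        using step_prob_le[of "q t" x n] x z nt step_prob_nonneg[of n x] by simp
    qed
    show "summable (\<lambda>n. C\<^sub>0 * \<rho> ^ n)" by (rule geometric_summable[OF adm0])
  qed (rule F)
  then show ?thesis by (simp add: green_def)
qed

text \<open>At a fixed time the covariance depends continuously on the Green metric, and by
  \<open>cov_rate_bound\<close> it is close to its rate uniformly in the law of the metric.\<close>

lemma tendsto_cov_rate:
  assumes adm0: "admissible p" and adm: "\<forall>\<^sub>F t in F. admissible (q t)"
    and q: "\<And>a. a \<in> S \<Longrightarrow> ((\<lambda>t. q t a) \<longlongrightarrow> p a) F" and F: "F \<noteq> bot"
    and w: "(\<Sum>a\<in>S. p a * w a) = 0"
  shows "((\<lambda>t. cov_rate p (q t) w) \<longlongrightarrow> cov_rate p p w) F"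
proof (rule tendstoI)
  fix e :: real assume e: "0 < e"
  obtain C where C: "0 < C" "\<And>p q w B n. admissible p \<Longrightarrow> admissible q \<Longrightarrow> (\<Sum>a\<in>S. p a * w a) = 0 \<Longrightarrow>
    (\<forall>a\<in>S. \<bar>w a\<bar> \<le> B) \<Longrightarrow> 1 \<le> n \<Longrightarrow>
    \<bar>cov p q w n - real n * cov_rate p q w\<bar> \<le> C * B * real n powr (3 / 4)"
    by (rule cov_rate_bound) (rule that)
  define B where "B = (\<Sum>a\<in>S. \<bar>w a\<bar>)"
  have B: "\<forall>a\<in>S. \<bar>w a\<bar> \<le> B"
    unfolding B_def using finite_S by (auto intro: member_le_sum)
  have "(\<lambda>n. C * B * (real n powr (3 / 4) / real n)) \<longlonglongrightarrow> C * B * 0"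
    by (intro tendsto_mult tendsto_const) real_asymp
  then have "\<forall>\<^sub>F n in sequentially. C * B * (real n powr (3 / 4) / real n) < e / 3"
    using e by (intro order_tendstoD) auto
  then have "\<forall>\<^sub>F n in sequentially. C * B * (real n powr (3 / 4) / real n) < e / 3 \<and> 1 \<le> n"
    by (intro eventually_conj eventually_ge_at_top)
  then obtain n where n: "C * B * (real n powr (3 / 4) / real n) < e / 3" "1 \<le> n"
    using eventually_happens'[OF sequentially_bot] by blast
  have close: "\<bar>cov p q' w n / real n - cov_rate p q' w\<bar> < e / 3" if "admissible q'" for q'
  proof -
    have "cov p q' w n / real n - cov_rate p q' w = (cov p q' w n - real n * cov_rate p q' w) / real n"
      using n(2) by (simp add: field_simps)
    then have "\<bar>cov p q' w n / real n - cov_rate p q' w\<bar> = \<bar>cov p q' w n - real n * cov_rate p q' w\<bar> / real n"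
      by (simp add: abs_divide)
    also have "\<dots> \<le> C * B * real n powr (3 / 4) / real n"
      by (intro divide_right_mono C(2)[OF adm0 that w B n(2)]) auto
    finally show ?thesis using n(1) unfolding times_divide_eq_right by linarith
  qed
  have "((\<lambda>t. cov p (q t) w n) \<longlongrightarrow> cov p p w n) F"
    unfolding cov_def
  proof (intro tendsto_word_exp tendsto_const)
    fix xs assume "set xs \<subseteq> S"
    then have "word_prod G xs \<in> carrier G" by simp
    then show "((\<lambda>t. gn (q t) xs * (\<Sum>x\<leftarrow>xs. w x)) \<longlongrightarrow> gn p xs * (\<Sum>x\<leftarrow>xs. w x)) F"
      unfolding green_norm_def using green_pos[OF adm0]
      by (intro tendsto_mult tendsto_diff tendsto_ln tendsto_green[OF adm0 adm q] F tendsto_const)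
        (auto simp: less_imp_neq[symmetric])
  qed
  then have "((\<lambda>t. cov p (q t) w n / real n) \<longlongrightarrow> cov p p w n / real n) F"
    using n(2) by (intro tendsto_divide tendsto_const) auto
  then have "\<forall>\<^sub>F t in F. dist (cov p (q t) w n / real n) (cov p p w n / real n) < e / 3"
    using e by (intro tendstoD) auto
  with adm show "\<forall>\<^sub>F t in F. dist (cov_rate p (q t) w) (cov_rate p p w) < e"
  proof eventually_elim
    case (elim t)
    then show ?case using close[OF elim(1)] close[OF adm0] unfolding dist_real_def by linarith
  qed
qed

text \<open>The comparison \<open>rate p p \<le> rate p q\<close> squeezes the increment of the entropy between the increments
  of the rates of escape in the Green metrics of the perturbed and of the unperturbed walk.\<close>

lemma has_derivative_rate:
  fixes q :: "real \<Rightarrow> 'a \<Rightarrow> real"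
  assumes adm0: "admissible (q 0)" and adm: "\<forall>\<^sub>F t in at 0. admissible (q t)"
    and \<nu>: "\<And>a. a \<in> S \<Longrightarrow> ((\<lambda>t. (q t a / q 0 a - 1) / t) \<longlongrightarrow> \<nu> a) (at 0)"
  shows "((\<lambda>t. rate (q t) (q t)) has_real_derivative cov_rate (q 0) (q 0) \<nu>) (at 0)"
    and "(\<Sum>a\<in>S. q 0 a * \<nu> a) = 0"
proof -
  define w where "w t a = q t a / q 0 a - 1" for t a
  have q0: "0 < q 0 a" if "a \<in> S" for a using eps_le[OF adm0 that] eps_pos by simp
  have qw: "q t a = q 0 a * (1 + w t a)" if "a \<in> S" for t a
    using q0[OF that] by (simp add: w_def)
  have w0: "(\<Sum>a\<in>S. q 0 a * w t a) = 0" if "admissible (q t)" for t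
    using word_weights.density_centered[OF admissible_weights[OF adm0] admissible_weights[OF that]] qw by blast
  have "((\<lambda>t. \<Sum>a\<in>S. q 0 a * (w t a / t)) \<longlongrightarrow> (\<Sum>a\<in>S. q 0 a * \<nu> a)) (at 0)"
    unfolding w_def by (intro tendsto_sum tendsto_mult tendsto_const \<nu>)
  moreover have "((\<lambda>t. \<Sum>a\<in>S. q 0 a * (w t a / t)) \<longlongrightarrow> 0) (at 0)"
  proof (rule tendsto_eventually)
    show "\<forall>\<^sub>F t in at 0. (\<Sum>a\<in>S. q 0 a * (w t a / t)) = 0"
      using adm by eventually_elim (simp add: sum_divide_distrib[symmetric] w0)
  qed
  ultimately show \<nu>0: "(\<Sum>a\<in>S. q 0 a * \<nu> a) = 0" by (rule tendsto_unique[OF trivial_limit_at])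
  have qlim: "((\<lambda>t. q t a) \<longlongrightarrow> q 0 a) (at 0)" if "a \<in> S" for a
  proof -
    have "((\<lambda>t. q 0 a * (1 + (w t a / t) * t)) \<longlongrightarrow> q 0 a * (1 + \<nu> a * 0)) (at 0)"
      unfolding w_def by (intro tendsto_intros \<nu> that)
    moreover have "\<forall>\<^sub>F t in at 0. q 0 a * (1 + (w t a / t) * t) = q t a"
      unfolding eventually_at_filter by (rule always_eventually) (simp add: qw[OF that, symmetric])
    ultimately show ?thesis by (simp add: tendsto_cong)
  qed
  define f where "f t = rate (q t) (q t)" for t
  define \<sigma> where "\<sigma> t = cov_rate (q 0) (q t) \<nu>" for t
  have \<sigma>: "(\<sigma> \<longlongrightarrow> \<sigma> 0) (at 0)"
    unfolding \<sigma>_def by (rule tendsto_cov_rate[OF adm0 adm qlim _ \<nu>0]) auto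
  define \<eta> where "\<eta> t = (\<Sum>a\<in>S. \<bar>w t a / t - \<nu> a\<bar>)" for t
  have "(\<eta> \<longlongrightarrow> (\<Sum>a\<in>S. \<bar>\<nu> a - \<nu> a\<bar>)) (at 0)"
    unfolding \<eta>_def w_def by (intro tendsto_sum tendsto_rabs tendsto_diff tendsto_const \<nu>)
  then have \<eta>: "(\<eta> \<longlongrightarrow> 0) (at 0)" by simp
  \<comment> \<open>The summand 1 absorbs \<open>\<eta> t \<le> 1\<close>, so that
    \<open>M * \<bar>t\<bar>\<close> bounds every \<open>w t a\<close>.\<close>
  define M where "M = (\<Sum>a\<in>S. \<bar>\<nu> a\<bar>) + 1"
  have M: "1 \<le> M" by (simp add: M_def sum_nonneg)
  obtain C where C: "0 < C" "\<And>p p' q w B k. admissible p \<Longrightarrow> admissible p' \<Longrightarrow> admissible q \<Longrightarrow>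
    (\<forall>a\<in>S. p' a = p a * (1 + w a)) \<Longrightarrow> (\<forall>a\<in>S. \<bar>w a\<bar> \<le> B) \<Longrightarrow> 2 ^ k * B\<^sup>2 \<le> 1 \<Longrightarrow>
    \<bar>rate p' q - rate p q - cov_rate p q w\<bar> \<le>
      C * ((2 ^ k) powr (- 3 / 4) + sqrt (2 ^ k) * B\<^sup>2 + B * (2 ^ k) powr (- 1 / 4))"
    by (rule rate_perturbation) (rule that)
  obtain D where D: "0 < D" "\<And>p q w B. admissible p \<Longrightarrow> admissible q \<Longrightarrow> (\<Sum>a\<in>S. p a * w a) = 0 \<Longrightarrow>
    (\<forall>a\<in>S. \<bar>w a\<bar> \<le> B) \<Longrightarrow> \<bar>cov_rate p q w\<bar> \<le> D * B"
    by (rule cov_rate_le) (rule that)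
  \<comment> \<open>The exponent has to lie strictly between -2 and -4/3, so that all three terms of
    \<open>err x\<close> are \<open>o(x)\<close>.\<close>
  define y where "y x = x powr (- 3 / 2)" for x :: real
  define err where "err x = C * ((y x / 2) powr (- 3 / 4) + sqrt (2 * y x) * (M * x)\<^sup>2 +
    (M * x) * (y x / 2) powr (- 1 / 4))" for x
  have increment: "\<bar>rate (q t) q' - rate (q 0) q' - t * cov_rate (q 0) q' \<nu>\<bar> \<le> err \<bar>t\<bar> + D * (\<bar>t\<bar> * \<eta> t)"
    if t: "t \<noteq> 0" "\<bar>t\<bar> < 1" "2 * y \<bar>t\<bar> * (M * \<bar>t\<bar>)\<^sup>2 \<le> 1" "\<eta> t \<le> 1"
      and admt: "admissible (q t)" "admissible q'" for t q'
  proof -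
    have y1: "1 \<le> y \<bar>t\<bar>"
      using t powr_mono2'[of "- 3 / 2" "\<bar>t\<bar>" 1] by (simp add: y_def)
    \<comment> \<open>The variance is controlled along powers of two only, so the time is rounded to
      one; this costs a factor 2 in either direction.\<close>
    define N where "N = nat \<lfloor>y \<bar>t\<bar>\<rfloor>"
    have fl: "1 \<le> \<lfloor>y \<bar>t\<bar>\<rfloor>" using y1 by (simp add: le_floor_iff)
    then have "real N = of_int \<lfloor>y \<bar>t\<bar>\<rfloor>" by (simp add: N_def)
    then have N: "1 \<le> N" "real N \<le> y \<bar>t\<bar>" "y \<bar>t\<bar> \<le> 2 * real N"
      using fl by linarith+
    obtain k where k: "N \<le> 2 ^ k" "2 ^ k \<le> 2 * N" using dyadic_sandwich[OF N(1)] by blast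
    have "real N \<le> 2 ^ k" "2 ^ k \<le> 2 * real N"
      using k by (metis of_nat_le_iff of_nat_mult of_nat_numeral of_nat_power)+
    then have k': "y \<bar>t\<bar> / 2 \<le> 2 ^ k" "2 ^ k \<le> 2 * y \<bar>t\<bar>" using N by linarith+
    have dev: "\<bar>w t a - t * \<nu> a\<bar> \<le> \<bar>t\<bar> * \<eta> t" if "a \<in> S" for a
    proof -
      have "w t a - t * \<nu> a = t * (w t a / t - \<nu> a)" using t by (simp add: field_simps)
      then have "\<bar>w t a - t * \<nu> a\<bar> = \<bar>t\<bar> * \<bar>w t a / t - \<nu> a\<bar>" by (simp add: abs_mult)
      also have "\<dots> \<le> \<bar>t\<bar> * \<eta> t"
        unfolding \<eta>_def using that finite_S by (intro mult_left_mono member_le_sum) auto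
      finally show ?thesis .
    qed
    have wB: "\<forall>a\<in>S. \<bar>w t a\<bar> \<le> M * \<bar>t\<bar>"
    proof
      fix a assume a: "a \<in> S"
      have "\<bar>\<nu> a\<bar> \<le> (\<Sum>a\<in>S. \<bar>\<nu> a\<bar>)" using a finite_S by (intro member_le_sum) auto
      then have "\<bar>t\<bar> * \<bar>\<nu> a\<bar> \<le> \<bar>t\<bar> * (\<Sum>a\<in>S. \<bar>\<nu> a\<bar>)" by (intro mult_left_mono) auto
      moreover have "\<bar>t\<bar> * \<eta> t \<le> \<bar>t\<bar> * 1" using t by (intro mult_left_mono) auto
      moreover have "\<bar>w t a\<bar> \<le> \<bar>w t a - t * \<nu> a\<bar> + \<bar>t\<bar> * \<bar>\<nu> a\<bar>"
        unfolding abs_mult[symmetric] by linarith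
      ultimately show "\<bar>w t a\<bar> \<le> M * \<bar>t\<bar>" using dev[OF a] by (simp add: M_def algebra_simps)
    qed
    have small: "2 ^ k * (M * \<bar>t\<bar>)\<^sup>2 \<le> 1"
      using mult_right_mono[OF k'(2) zero_le_power2, of "M * \<bar>t\<bar>"] t(3) by linarith
    have qw': "\<forall>a\<in>S. q t a = q 0 a * (1 + w t a)" using qw by blast
    have "\<bar>rate (q t) q' - rate (q 0) q' - cov_rate (q 0) q' (w t)\<bar> \<le>
        C * ((2 ^ k) powr (- 3 / 4) + sqrt (2 ^ k) * (M * \<bar>t\<bar>)\<^sup>2 + (M * \<bar>t\<bar>) * (2 ^ k) powr (- 1 / 4))"
      by (rule C(2)[OF adm0 admt qw' wB small])
    also have "\<dots> \<le> err \<bar>t\<bar>"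
      unfolding err_def using C(1) M y1 k'
      by (intro mult_left_mono add_mono mult_right_mono powr_mono2' real_sqrt_le_mono) auto
    finally have 1: "\<bar>rate (q t) q' - rate (q 0) q' - cov_rate (q 0) q' (w t)\<bar> \<le> err \<bar>t\<bar>" .
    have "(\<Sum>a\<in>S. q 0 a * (w t a - t * \<nu> a)) = (\<Sum>a\<in>S. q 0 a * w t a) - t * (\<Sum>a\<in>S. q 0 a * \<nu> a)"
      by (simp add: sum_distrib_left sum_subtractf algebra_simps)
    then have "(\<Sum>a\<in>S. q 0 a * (w t a - t * \<nu> a)) = 0" using w0[OF admt(1)] \<nu>0 by simp
    \<comment> \<open>The increment \<open>w t\<close> differs from its linear part by at most
      \<open>\<bar>t\<bar> * \<eta> t\<close>, and the covariance is linear and bounded in the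
      weight, uniformly in \<open>q'\<close>.\<close>
    then have "\<bar>cov_rate (q 0) q' (\<lambda>a. w t a - t * \<nu> a)\<bar> \<le> D * (\<bar>t\<bar> * \<eta> t)"
      using dev by (intro D(2)[OF adm0 admt(2)]) auto
    then have "\<bar>cov_rate (q 0) q' (w t) - t * cov_rate (q 0) q' \<nu>\<bar> \<le> D * (\<bar>t\<bar> * \<eta> t)"
      using cov_rate_diff_scaled[OF adm0 admt(2) w0[OF admt(1)] \<nu>0] by simp
    with 1 show ?thesis by linarith
  qed
  have "((\<lambda>t::real. \<bar>t\<bar>) \<longlongrightarrow> \<bar>0\<bar>) (at 0)" by (intro tendsto_intros)
  then have xlim: "filterlim (\<lambda>t::real. \<bar>t\<bar>) (at_right 0) (at 0)"
    unfolding filterlim_at by (simp add: eventually_at_filter)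
  have err: "((\<lambda>x. err x / x) \<longlongrightarrow> 0) (at_right 0)"
  proof -
    have "((\<lambda>x. C * ((y x / 2) powr (- 3 / 4) / x + M\<^sup>2 * (sqrt (2 * y x) * x) +
        M * (y x / 2) powr (- 1 / 4))) \<longlongrightarrow> C * (0 + M\<^sup>2 * 0 + M * 0)) (at_right 0)"
      unfolding y_def by (intro tendsto_intros; real_asymp)
    moreover have "\<forall>\<^sub>F x in at_right 0. C * ((y x / 2) powr (- 3 / 4) / x + M\<^sup>2 * (sqrt (2 * y x) * x) +
        M * (y x / 2) powr (- 1 / 4)) = err x / x"
      unfolding eventually_at_filter
      by (rule always_eventually) (simp add: err_def power2_eq_square field_simps)
    ultimately show ?thesis by (simp add: tendsto_cong)
  qed
  have "((\<lambda>x. 2 * M\<^sup>2 * (y x * x\<^sup>2)) \<longlongrightarrow> 2 * M\<^sup>2 * 0) (at_right 0)"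
    unfolding y_def by (intro tendsto_mult tendsto_const) real_asymp
  then have "\<forall>\<^sub>F x in at_right 0. 2 * M\<^sup>2 * (y x * x\<^sup>2) < 1" by (intro order_tendstoD) auto
  then have ev1: "\<forall>\<^sub>F t in at 0. 2 * M\<^sup>2 * (y \<bar>t\<bar> * \<bar>t\<bar>\<^sup>2) < 1" by (rule eventually_compose_filterlim[OF _ xlim])
  have ev2: "\<forall>\<^sub>F t in at 0. \<eta> t < 1" by (rule order_tendstoD(2)[OF \<eta>]) simp
  have ev3: "\<forall>\<^sub>F t::real in at 0. t \<noteq> 0 \<and> \<bar>t\<bar> < 1"
    unfolding eventually_at by (rule exI[of _ 1]) auto
  define bound where "bound t = err \<bar>t\<bar> / \<bar>t\<bar> + D * \<eta> t + \<bar>\<sigma> t - \<sigma> 0\<bar>" for t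
  have bound: "(bound \<longlongrightarrow> 0 + D * 0 + \<bar>\<sigma> 0 - \<sigma> 0\<bar>) (at 0)"
    unfolding bound_def by (intro tendsto_intros \<eta> \<sigma> filterlim_compose[OF err xlim])
  have "\<forall>\<^sub>F t in at 0. norm ((f t - f 0) / t - \<sigma> 0) \<le> bound t"
    using ev1 ev2 ev3 adm
  proof eventually_elim
    case (elim t)
    have t: "t \<noteq> 0" "\<bar>t\<bar> < 1" "2 * y \<bar>t\<bar> * (M * \<bar>t\<bar>)\<^sup>2 \<le> 1" "\<eta> t \<le> 1"
      using elim by (auto simp: power_mult_distrib mult_ac)
    have up: "\<bar>rate (q t) (q 0) - rate (q 0) (q 0) - t * \<sigma> 0\<bar> \<le> err \<bar>t\<bar> + D * (\<bar>t\<bar> * \<eta> t)"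
      unfolding \<sigma>_def by (rule increment[OF t elim(4) adm0])
    have low: "\<bar>rate (q t) (q t) - rate (q 0) (q t) - t * \<sigma> t\<bar> \<le> err \<bar>t\<bar> + D * (\<bar>t\<bar> * \<eta> t)"
      unfolding \<sigma>_def by (rule increment[OF t elim(4) elim(4)])
    have "\<bar>t * \<sigma> t - t * \<sigma> 0\<bar> = \<bar>t\<bar> * \<bar>\<sigma> t - \<sigma> 0\<bar>"
      by (simp add: abs_mult[symmetric] algebra_simps)
    then have "\<bar>f t - f 0 - t * \<sigma> 0\<bar> \<le> err \<bar>t\<bar> + D * (\<bar>t\<bar> * \<eta> t) + \<bar>t\<bar> * \<bar>\<sigma> t - \<sigma> 0\<bar>"
      using up low rate_le[OF elim(4) adm0] rate_le[OF adm0 elim(4)] abs_ge_zero[of "t * \<sigma> t - t * \<sigma> 0"]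
      unfolding f_def by linarith
    also have "\<dots> = \<bar>t\<bar> * bound t" using t(1) by (simp add: bound_def field_simps)
    finally have "\<bar>f t - f 0 - t * \<sigma> 0\<bar> \<le> \<bar>t\<bar> * bound t" .
    moreover have "(f t - f 0) / t - \<sigma> 0 = (f t - f 0 - t * \<sigma> 0) / t" using t(1) by (simp add: field_simps)
    ultimately show ?case using t(1) by (simp add: abs_divide divide_le_eq mult.commute)
  qed
  then have "((\<lambda>t. (f t - f 0) / t - \<sigma> 0) \<longlongrightarrow> 0) (at 0)"
    by (rule Lim_null_comparison) (use bound in simp)
  then have "((\<lambda>t. (f t - f 0) / (t - 0)) \<longlongrightarrow> \<sigma> 0) (at 0)" by (simp add: LIM_zero_iff)
  then show "((\<lambda>t. rate (q t) (q t)) has_real_derivative cov_rate (q 0) (q 0) \<nu>) (at 0)"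
    unfolding has_field_derivative_iff f_def \<sigma>_def .
qed

end

section \<open>Exponential decay of step probabilities on nonamenable groups\<close>

text \<open>Tychonoff's theorem for the product of unit intervals. Convergence along a filter finer
  than the image of the sequence replaces a subsequence, since the index set may be uncountable;
  what holds along the whole sequence still holds along the filter.\<close>

lemma pointwise_cluster:
  fixes f :: "nat \<Rightarrow> 'b \<Rightarrow> real"
  assumes "\<And>k A. f k A \<in> {0..1}"
  obtains F m where "F \<noteq> bot" "F \<le> filtermap f sequentially" "\<And>A. ((\<lambda>\<phi>. \<phi> A) \<longlongrightarrow> m A) F"
proof -
  have "compactin (product_topology (\<lambda>i::'b. euclidean :: real topology) UNIV) (Pi\<^sub>E UNIV (\<lambda>_. {0..1}))"
    by (simp add: compactin_PiE)
  then have "compact (Pi\<^sub>E UNIV (\<lambda>_. {0..1}) :: ('b \<Rightarrow> real) set)"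
    by (simp add: euclidean_product_topology)
  moreover have "filtermap f sequentially \<noteq> bot" by (simp add: filtermap_bot_iff)
  moreover have "eventually (\<lambda>\<phi>. \<phi> \<in> Pi\<^sub>E UNIV (\<lambda>_. {0..1})) (filtermap f sequentially)"
    using assms by (simp add: eventually_filtermap PiE_def)
  ultimately obtain m where m: "inf (nhds m) (filtermap f sequentially) \<noteq> bot"
    unfolding compact_filter by blast
  show ?thesis
  proof (rule that[OF m])
    show "((\<lambda>\<phi>. \<phi> A) \<longlongrightarrow> m A) (inf (nhds m) (filtermap f sequentially))" for A
    proof -
      have "open ((\<lambda>\<phi>::'b \<Rightarrow> real. \<phi> A) -` U)" if "open U" for U
        using open_vimage[OF that continuous_on_product_coordinates] .
      then have "((\<lambda>\<phi>. \<phi> A) \<longlongrightarrow> m A) (nhds m)"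
        by (intro topological_tendstoI) (auto simp: eventually_nhds intro!: exI[of _ "(\<lambda>\<phi>. \<phi> A) -` U" for U])
      then show ?thesis by (rule tendsto_mono[rotated]) simp
    qed
  qed simp
qed

context weighted_walk_group
begin

lemma step_prob_Suc_right:
  assumes "x \<in> carrier G"
  shows "u p (Suc n) x = (\<Sum>a\<in>S. p a * u p n (x \<otimes> inv a))"
  using assms
proof (induction n arbitrary: x)
  case 0
  have "(\<Sum>a\<in>S. p a * u p 0 (inv a \<otimes> x)) = (\<Sum>a\<in>S. p a * u p 0 (x \<otimes> inv a))"
  proof (rule sum.cong)
    fix a assume "a \<in> S"
    then have a: "a \<in> carrier G" using S_carrier by blast
    have "inv a \<otimes> x = \<one> \<longleftrightarrow> x \<otimes> inv a = \<one>"
      using a 0 by (metis inv_closed inv_comm)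
    then show "p a * u p 0 (inv a \<otimes> x) = p a * u p 0 (x \<otimes> inv a)" by (simp add: step_prob_0)
  qed simp
  then show ?case using step_prob_Suc[OF 0] by simp
next
  case (Suc n)
  have "u p (Suc (Suc n)) x = (\<Sum>b\<in>S. p b * u p (Suc n) (inv b \<otimes> x))" by (rule step_prob_Suc[OF Suc.prems])
  also have "\<dots> = (\<Sum>b\<in>S. p b * (\<Sum>a\<in>S. p a * u p n (inv b \<otimes> x \<otimes> inv a)))"
  proof (rule sum.cong)
    fix b assume "b \<in> S"
    then show "p b * u p (Suc n) (inv b \<otimes> x) = p b * (\<Sum>a\<in>S. p a * u p n (inv b \<otimes> x \<otimes> inv a))"
      using Suc.IH[of "inv b \<otimes> x"] Suc.prems S_carrier by auto
  qed simp
  also have "\<dots> = (\<Sum>a\<in>S. p a * (\<Sum>b\<in>S. p b * u p n (inv b \<otimes> (x \<otimes> inv a))))"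
    unfolding sum_distrib_left
    using S_carrier Suc.prems by (subst sum.swap) (intro sum.cong; auto simp: m_assoc subset_iff)
  also have "\<dots> = (\<Sum>a\<in>S. p a * u p (Suc n) (x \<otimes> inv a))"
  proof (rule sum.cong)
    fix a assume "a \<in> S"
    then show "p a * (\<Sum>b\<in>S. p b * u p n (inv b \<otimes> (x \<otimes> inv a))) = p a * u p (Suc n) (x \<otimes> inv a)"
      using step_prob_Suc[of "x \<otimes> inv a"] Suc.prems S_carrier by auto
  qed simp
  finally show ?case .
qed

definition reach :: "nat \<Rightarrow> 'a set" where
  "reach n = word_prod G ` {ws. set ws \<subseteq> S \<and> length ws = n}"

lemma finite_reach: "finite (reach n)" and reach_carrier: "reach n \<subseteq> carrier G"
  unfolding reach_def using finite_words by auto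

lemma step_prob_outside_reach: "x \<notin> reach n \<Longrightarrow> u p n x = 0"
  by (rule step_prob_eq_0) (auto simp: reach_def)

lemma Chapman_Kolmogorov:
  assumes "z \<in> carrier G" "finite A" "reach n \<subseteq> A"
  shows "u p (n + m) z = (\<Sum>x\<in>A. u p n x * u p m (inv x \<otimes> z))"
  unfolding step_prob_split[OF assms(1)]
  by (rule word_exp_word_prod[OF assms(2)]) (use assms(3) in \<open>auto simp: reach_def\<close>)

end

section \<open>Kesten's theorem for symmetric walks\<close>

locale symmetric_walk_group = weighted_walk_group +
  fixes \<epsilon> :: real
  assumes sym_p: "a \<in> S \<Longrightarrow> p (inv a) = p a" and eps: "0 < \<epsilon>" "a \<in> S \<Longrightarrow> \<epsilon> \<le> p a"
begin

text \<open>Reversing a word and inverting its letters preserves its weight; in the induction this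
  exchanges the decompositions by the first and by the last step.\<close>

lemma step_prob_inv: "x \<in> carrier G \<Longrightarrow> u p n (inv x) = u p n x"
proof (induction n arbitrary: x)
  case 0
  then show ?case by (simp add: step_prob_0)
next
  case (Suc n)
  have bij: "bij_betw (m_inv G) S S"
    by (rule bij_betw_byWitness[where f' = "m_inv G"]) (use inv_S S_carrier in auto)
  have "u p (Suc n) (inv x) = (\<Sum>a\<in>S. p a * u p n (inv a \<otimes> inv x))"
    using Suc.prems by (intro step_prob_Suc) simp
  also have "\<dots> = (\<Sum>a\<in>S. p (inv a) * u p n (x \<otimes> inv (inv a)))"
  proof (rule sum.cong)
    fix a assume a: "a \<in> S"
    then have "a \<in> carrier G" using S_carrier by blast
    then show "p a * u p n (inv a \<otimes> inv x) = p (inv a) * u p n (x \<otimes> inv (inv a))"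
      using Suc.IH[of "x \<otimes> a"] Suc.prems a sym_p by (simp add: inv_mult_group)
  qed simp
  also have "\<dots> = (\<Sum>a\<in>S. p a * u p n (x \<otimes> inv a))"
    by (rule sum.reindex_bij_betw[OF bij])
  also have "\<dots> = u p (Suc n) x" by (rule step_prob_Suc_right[OF Suc.prems, symmetric])
  finally show ?case .
qed

text \<open>By symmetry the return probability at time \<open>2 n\<close> is the squared l2 norm of
  the \<open>n\<close>-step law, see \<open>energy_eq\<close>.\<close>

abbreviation energy :: "nat \<Rightarrow> real" where "energy n \<equiv> u p (n + n) \<one>"

lemma energy_eq:
  assumes "finite A" "reach n \<subseteq> A" "A \<subseteq> carrier G"
  shows "energy n = (\<Sum>x\<in>A. (u p n x)\<^sup>2)"
proof -
  have "energy n = (\<Sum>x\<in>A. u p n x * u p n (inv x \<otimes> \<one>))"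
    by (rule Chapman_Kolmogorov) (use assms in auto)
  also have "\<dots> = (\<Sum>x\<in>A. (u p n x)\<^sup>2)"
    using assms(3) by (intro sum.cong) (auto simp: step_prob_inv power2_eq_square subset_iff)
  finally show ?thesis .
qed

lemma sum_squares_le_energy:
  assumes "finite A" "inj_on f A" "f ` A \<subseteq> carrier G"
  shows "(\<Sum>x\<in>A. (u p n (f x))\<^sup>2) \<le> energy n"
proof -
  have "(\<Sum>x\<in>A. (u p n (f x))\<^sup>2) = (\<Sum>y\<in>f ` A. (u p n y)\<^sup>2)"
    by (simp add: sum.reindex[OF assms(2)])
  also have "\<dots> \<le> (\<Sum>y\<in>f ` A \<union> reach n. (u p n y)\<^sup>2)"
    using assms(1) finite_reach by (intro sum_mono2) auto
  also have "\<dots> = energy n"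
    using assms finite_reach reach_carrier by (intro energy_eq[symmetric]) auto
  finally show ?thesis .
qed

text \<open>Split at half time and bound each product by the mean of the squares; both sums of
  squares are at most the energy.\<close>

lemma step_prob_le_energy:
  assumes x: "x \<in> carrier G"
  shows "u p (n + n) x \<le> energy n"
proof -
  have inj: "inj_on (\<lambda>y. inv y \<otimes> x) (reach n)"
    using x reach_carrier[of n] by (intro inj_onI) (metis inv_closed inv_inv right_cancel subsetD)
  have sub: "(\<lambda>y. inv y \<otimes> x) ` reach n \<subseteq> carrier G" using x reach_carrier[of n] by (auto simp: subset_iff)
  have "u p (n + n) x = (\<Sum>y\<in>reach n. u p n y * u p n (inv y \<otimes> x))"
    by (rule Chapman_Kolmogorov[OF x finite_reach]) simp
  also have "\<dots> \<le> (\<Sum>y\<in>reach n. ((u p n y)\<^sup>2 + (u p n (inv y \<otimes> x))\<^sup>2) / 2)"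
  proof (rule sum_mono)
    fix y show "u p n y * u p n (inv y \<otimes> x) \<le> ((u p n y)\<^sup>2 + (u p n (inv y \<otimes> x))\<^sup>2) / 2"
      using sum_squares_bound[of "u p n y" "u p n (inv y \<otimes> x)"] by simp
  qed
  also have "\<dots> = ((\<Sum>y\<in>reach n. (u p n y)\<^sup>2) + (\<Sum>y\<in>reach n. (u p n (inv y \<otimes> x))\<^sup>2)) / 2"
    by (simp add: sum_divide_distrib[symmetric] sum.distrib)
  also have "\<dots> \<le> (energy n + energy n) / 2"
    using energy_eq[OF finite_reach order_refl reach_carrier, of n] sum_squares_le_energy[OF finite_reach inj sub, of n]
    by (intro divide_right_mono add_mono) auto
  finally show ?thesis by simp
qed

lemma step_prob_le_energy_div_2:
  assumes x: "x \<in> carrier G"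
  shows "u p n x \<le> energy (n div 2)"
proof (cases "even n")
  case True
  then have "n = n div 2 + n div 2" by (simp flip: mult_2)
  then show ?thesis using step_prob_le_energy[OF x, of "n div 2"] by simp
next
  case False
  then have n: "n = Suc (n div 2 + n div 2)" by (simp flip: mult_2)
  have "u p n x = (\<Sum>a\<in>S. p a * u p (n div 2 + n div 2) (inv a \<otimes> x))"
    by (subst n) (rule step_prob_Suc[OF x])
  also have "\<dots> \<le> (\<Sum>a\<in>S. p a * energy (n div 2))"
    using x S_carrier by (intro sum_mono mult_left_mono weights_nonneg step_prob_le_energy) auto
  finally show ?thesis by simp
qed

lemma energy_pos: "0 < energy n"
proof -
  obtain a where a: "a \<in> S" using weights_sum by fastforce
  let ?ws = "replicate n a"
  have ws: "set ?ws \<subseteq> S" using a by auto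
  then have x: "word_prod G ?ws \<in> reach n" by (auto simp: reach_def)
  have "0 < \<epsilon> ^ length ?ws" using eps by simp
  also have "\<dots> \<le> u p (length ?ws) (word_prod G ?ws)"
    using eps ws by (intro step_prob_word_ge) auto
  finally have "0 < (u p n (word_prod G ?ws))\<^sup>2" by simp
  also have "\<dots> \<le> (\<Sum>x\<in>reach n. (u p n x)\<^sup>2)"
    using x finite_reach by (intro member_le_sum) auto
  also have "\<dots> = energy n" by (rule energy_eq[OF finite_reach order_refl reach_carrier, symmetric])
  finally show ?thesis .
qed

text \<open>The drop of the energy is the average, over two further letters, of the differences on
  the left. These are nonnegative by \<open>step_prob_le_energy\<close>, and each pair of letters
  has weight at least \<open>\<epsilon>\<^sup>2\<close>.\<close>

lemma energy_defect:
  assumes a: "a \<in> S" and b: "b \<in> S"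
  shows "\<epsilon>\<^sup>2 * (energy n - u p (n + n) (a \<otimes> b)) \<le> energy n - energy (Suc n)"
proof -
  let ?m = "n + n"
  have car: "x \<in> carrier G" if "x \<in> S" for x using that S_carrier by blast
  have "energy (Suc n) = u p (Suc (Suc ?m)) \<one>" by simp
  also have "\<dots> = (\<Sum>a\<in>S. p a * u p (Suc ?m) (inv a))"
    unfolding step_prob_Suc[OF one_closed, of _ "Suc ?m"] using car by (intro sum.cong) auto
  also have "\<dots> = (\<Sum>a\<in>S. p a * (\<Sum>b\<in>S. p b * u p ?m (a \<otimes> b)))"
  proof (rule sum.cong)
    fix a assume a: "a \<in> S"
    have "u p (Suc ?m) (inv a) = (\<Sum>b\<in>S. p b * u p ?m (inv b \<otimes> inv a))"
      using car[OF a] by (intro step_prob_Suc) simp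
    also have "\<dots> = (\<Sum>b\<in>S. p b * u p ?m (a \<otimes> b))"
    proof (rule sum.cong)
      fix b assume "b \<in> S"
      then show "p b * u p ?m (inv b \<otimes> inv a) = p b * u p ?m (a \<otimes> b)"
        using car[OF a] car step_prob_inv[of "a \<otimes> b" ?m] by (simp add: inv_mult_group)
    qed simp
    finally show "p a * u p (Suc ?m) (inv a) = p a * (\<Sum>b\<in>S. p b * u p ?m (a \<otimes> b))" by simp
  qed simp
  finally have E1: "energy (Suc n) = (\<Sum>a\<in>S. p a * (\<Sum>b\<in>S. p b * u p ?m (a \<otimes> b)))" .
  define d where "d a b = energy n - u p ?m (a \<otimes> b)" for a b
  have d: "0 \<le> d a b" if "a \<in> S" "b \<in> S" for a b
    using step_prob_le_energy[of "a \<otimes> b" n] car that by (simp add: d_def)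
  have "(\<Sum>a\<in>S. p a * (\<Sum>b\<in>S. p b * d a b)) = energy n - energy (Suc n)"
    unfolding E1 d_def by (simp add: right_diff_distrib sum_subtractf)
  moreover have "\<epsilon> * (\<epsilon> * d a b) \<le> (\<Sum>a\<in>S. p a * (\<Sum>b\<in>S. p b * d a b))"
  proof -
    have "\<epsilon> * (\<epsilon> * d a b) \<le> p a * (p b * d a b)"
      using eps a b d[OF a b] by (intro mult_mono mult_nonneg_nonneg) (auto intro: weights_nonneg)
    also have "\<dots> \<le> p a * (\<Sum>b\<in>S. p b * d a b)"
      using a b d finite_S by (intro mult_left_mono member_le_sum) (auto intro!: mult_nonneg_nonneg weights_nonneg)
    also have "\<dots> \<le> (\<Sum>a\<in>S. p a * (\<Sum>b\<in>S. p b * d a b))"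
      using a d finite_S by (intro member_le_sum[where f = "\<lambda>a. p a * (\<Sum>b\<in>S. p b * d a b)"])
        (auto intro!: mult_nonneg_nonneg sum_nonneg weights_nonneg)
    finally show ?thesis .
  qed
  ultimately show ?thesis by (simp add: d_def power2_eq_square)
qed

section \<open>From slow decay of the energy to an invariant mean\<close>

text \<open>Normalised squares turn an almost invariant vector of l2 into an almost invariant
  probability measure.\<close>

definition energy_measure :: "nat \<Rightarrow> 'a set \<Rightarrow> real" where
  "energy_measure n A = (\<Sum>x\<in>A \<inter> reach n. (u p n x)\<^sup>2) / energy n"

lemma energy_measure_eq:
  assumes "finite D" "reach n \<subseteq> D"
  shows "energy_measure n A = (\<Sum>x\<in>A \<inter> D. (u p n x)\<^sup>2) / energy n"
  unfolding energy_measure_def using assms step_prob_outside_reach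
  by (intro arg_cong[where f = "\<lambda>s. s / energy n"] sum.mono_neutral_left) auto

lemma energy_measure_range: "energy_measure n A \<in> {0..1}"
proof -
  have "(\<Sum>x\<in>A \<inter> reach n. (u p n x)\<^sup>2) \<le> energy n"
    using finite_reach reach_carrier by (intro sum_squares_le_energy[where f = id, simplified]) auto
  then show ?thesis using energy_pos[of n] by (auto simp: energy_measure_def sum_nonneg)
qed

lemma energy_measure_carrier: "energy_measure n (carrier G) = 1"
proof -
  have "carrier G \<inter> reach n = reach n" using reach_carrier by blast
  then show ?thesis
    using energy_pos[of n] energy_eq[OF finite_reach order_refl reach_carrier, of n]
    by (simp add: energy_measure_def)
qed

lemma energy_measure_Un: "A \<inter> B = {} \<Longrightarrow> energy_measure n (A \<union> B) = energy_measure n A + energy_measure n B"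
  unfolding energy_measure_def using finite_reach
  by (subst add_divide_distrib[symmetric], subst sum.union_disjoint[symmetric]) (auto simp: Int_Un_distrib2)

text \<open>With \<open>v\<close> the translate of the \<open>n\<close>-step law, the sum of the
  squares of \<open>v - u\<close> is twice the energy minus twice the inner product, that is at most
  \<open>2 * \<kappa> * energy n\<close>, while that of \<open>v + u\<close> is at most
  \<open>4 * energy n\<close>. A weighted inequality between the means, with the parameter
  \<open>\<tau>\<close> left free, combines the two.\<close>

lemma energy_measure_translate:
  assumes g: "g \<in> carrier G" and A: "A \<subseteq> carrier G" and \<tau>: "0 < \<tau>"
    and small: "energy n - u p (n + n) g \<le> \<kappa> * energy n"
  shows "\<bar>energy_measure n (g <# A) - energy_measure n A\<bar> \<le> \<tau> * \<kappa> + 2 / \<tau>"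
proof -
  \<comment> \<open>A finite set that contains the support of the \<open>n\<close>-step law and that
    of its translate.\<close>
  define D where "D = reach n \<union> (\<lambda>x. inv g \<otimes> x) ` reach n"
  have D: "finite D" "D \<subseteq> carrier G" "reach n \<subseteq> D"
    using finite_reach reach_carrier g by (auto simp: D_def)
  define v where "v x = u p n (g \<otimes> x)" for x
  have gA: "energy_measure n (g <# A) = (\<Sum>x\<in>A \<inter> D. (v x)\<^sup>2) / energy n"
  proof -
    have inj: "inj_on (\<lambda>x. g \<otimes> x) (A \<inter> D)" using g D(2) by (intro inj_onI) (auto simp: subset_iff)
    have sub: "(g <# A) \<inter> reach n \<subseteq> (\<lambda>x. g \<otimes> x) ` (A \<inter> D)"
    proof
      fix y assume y: "y \<in> (g <# A) \<inter> reach n"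
      then obtain x where x: "x \<in> A" "y = g \<otimes> x" by (auto simp: l_coset_def)
      then have "x = inv g \<otimes> y" using g A by (auto simp: m_assoc[symmetric] subset_iff)
      then show "y \<in> (\<lambda>x. g \<otimes> x) ` (A \<inter> D)" using x y by (auto simp: D_def)
    qed
    have "(\<Sum>x\<in>A \<inter> D. (v x)\<^sup>2) = (\<Sum>y\<in>(\<lambda>x. g \<otimes> x) ` (A \<inter> D). (u p n y)\<^sup>2)"
      by (simp add: sum.reindex[OF inj] v_def)
    also have "\<dots> = (\<Sum>y\<in>(g <# A) \<inter> reach n. (u p n y)\<^sup>2)"
      using D(1) sub step_prob_outside_reach
      by (intro sum.mono_neutral_right) (auto simp: l_coset_def)
    finally show ?thesis by (simp add: energy_measure_def)
  qed
  have sq: "(\<Sum>x\<in>D. (v x)\<^sup>2) \<le> energy n" "(\<Sum>x\<in>D. (u p n x)\<^sup>2) \<le> energy n"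
    unfolding v_def using D g
    by (auto intro!: sum_squares_le_energy[where f = "\<lambda>x. g \<otimes> x"] sum_squares_le_energy[where f = "\<lambda>x. x"]
        inj_onI simp: subset_iff)
  have cross: "(\<Sum>x\<in>D. u p n x * v x) = u p (n + n) g"
  proof -
    have "(\<Sum>x\<in>D. u p n x * v x) = (\<Sum>x\<in>D. u p n x * u p n (inv x \<otimes> inv g))"
      unfolding v_def
    proof (rule sum.cong)
      fix x assume "x \<in> D"
      then have "x \<in> carrier G" using D(2) by blast
      then show "u p n x * u p n (g \<otimes> x) = u p n x * u p n (inv x \<otimes> inv g)"
        using g step_prob_inv[of "g \<otimes> x" n] by (simp add: inv_mult_group)
    qed simp
    also have "\<dots> = u p (n + n) (inv g)"
      by (rule Chapman_Kolmogorov[symmetric]) (use D g in auto)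
    finally show ?thesis by (simp add: step_prob_inv g)
  qed
  have E: "0 < energy n" by (rule energy_pos)
  have "\<bar>(\<Sum>x\<in>A \<inter> D. (v x)\<^sup>2) - (\<Sum>x\<in>A \<inter> D. (u p n x)\<^sup>2)\<bar> \<le> (\<Sum>x\<in>A \<inter> D. \<bar>(v x)\<^sup>2 - (u p n x)\<^sup>2\<bar>)"
    unfolding sum_subtractf[symmetric] by (rule sum_abs)
  also have "\<dots> \<le> (\<Sum>x\<in>D. \<bar>(v x)\<^sup>2 - (u p n x)\<^sup>2\<bar>)"
    using D(1) by (intro sum_mono2) auto
  also have "\<dots> \<le> (\<Sum>x\<in>D. (\<tau> * (v x - u p n x)\<^sup>2 + (v x + u p n x)\<^sup>2 / \<tau>) / 2)"
  proof (rule sum_mono)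
    fix x
    define s t where "s = \<bar>v x - u p n x\<bar>" and "t = \<bar>v x + u p n x\<bar>"
    \<comment> \<open>A difference of squares is the product \<open>s * t\<close>, which is split
      with weights \<open>\<tau>\<close> and \<open>1 / \<tau>\<close>.\<close>
    have "0 \<le> (\<tau> * s - t)\<^sup>2 / \<tau>" using \<tau> by simp
    also have "\<dots> = \<tau> * s\<^sup>2 + t\<^sup>2 / \<tau> - 2 * (s * t)" using \<tau> by (simp add: power2_eq_square field_simps)
    finally have "s * t \<le> (\<tau> * s\<^sup>2 + t\<^sup>2 / \<tau>) / 2" by simp
    moreover have "\<bar>(v x)\<^sup>2 - (u p n x)\<^sup>2\<bar> = s * t"
      unfolding s_def t_def abs_mult[symmetric] by (simp add: power2_eq_square algebra_simps)
    ultimately show "\<bar>(v x)\<^sup>2 - (u p n x)\<^sup>2\<bar> \<le> (\<tau> * (v x - u p n x)\<^sup>2 + (v x + u p n x)\<^sup>2 / \<tau>) / 2"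
      by (simp add: s_def t_def)
  qed
  also have "\<dots> = (\<tau> * (\<Sum>x\<in>D. (v x - u p n x)\<^sup>2) + (\<Sum>x\<in>D. (v x + u p n x)\<^sup>2) / \<tau>) / 2"
    by (simp add: sum_divide_distrib[symmetric] sum.distrib sum_distrib_left)
  also have "\<dots> \<le> (\<tau> * (2 * \<kappa> * energy n) + (4 * energy n) / \<tau>) / 2"
  proof (intro divide_right_mono add_mono mult_left_mono)
    have "(\<Sum>x\<in>D. (v x - u p n x)\<^sup>2) = (\<Sum>x\<in>D. (v x)\<^sup>2 + (u p n x)\<^sup>2 - 2 * (u p n x * v x))"
      by (intro sum.cong) (auto simp: power2_diff)
    also have "\<dots> = (\<Sum>x\<in>D. (v x)\<^sup>2) + (\<Sum>x\<in>D. (u p n x)\<^sup>2) - 2 * u p (n + n) g"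
      by (simp add: sum.distrib sum_subtractf sum_distrib_left[symmetric] cross)
    finally show "(\<Sum>x\<in>D. (v x - u p n x)\<^sup>2) \<le> 2 * \<kappa> * energy n" using sq small by linarith
    have "(\<Sum>x\<in>D. (v x + u p n x)\<^sup>2) \<le> (\<Sum>x\<in>D. 2 * (v x)\<^sup>2 + 2 * (u p n x)\<^sup>2)"
    proof (rule sum_mono)
      fix x show "(v x + u p n x)\<^sup>2 \<le> 2 * (v x)\<^sup>2 + 2 * (u p n x)\<^sup>2"
        using sum_squares_bound[of "v x" "u p n x"] by (simp add: power2_sum)
    qed
    also have "\<dots> = 2 * (\<Sum>x\<in>D. (v x)\<^sup>2) + 2 * (\<Sum>x\<in>D. (u p n x)\<^sup>2)"
      by (simp add: sum.distrib sum_distrib_left)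
    finally show "(\<Sum>x\<in>D. (v x + u p n x)\<^sup>2) \<le> 4 * energy n" using sq by linarith
  qed (use \<tau> in auto)
  also have "\<dots> = (\<tau> * \<kappa> + 2 / \<tau>) * energy n" by (simp add: field_simps)
  finally have *: "\<bar>(\<Sum>x\<in>A \<inter> D. (v x)\<^sup>2) - (\<Sum>x\<in>A \<inter> D. (u p n x)\<^sup>2)\<bar> \<le> (\<tau> * \<kappa> + 2 / \<tau>) * energy n" .
  have "\<bar>energy_measure n (g <# A) - energy_measure n A\<bar> =
      \<bar>(\<Sum>x\<in>A \<inter> D. (v x)\<^sup>2) - (\<Sum>x\<in>A \<inter> D. (u p n x)\<^sup>2)\<bar> / energy n"
    unfolding gA energy_measure_eq[OF D(1,3), of A] diff_divide_distrib[symmetric] abs_divide using E by simp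
  also have "\<dots> \<le> \<tau> * \<kappa> + 2 / \<tau>" using * E by (simp add: pos_divide_le_eq)
  finally show ?thesis .
qed

text \<open>If the energies do not decay exponentially, the squared \<open>n\<close>-step distributions are asymptotically
  invariant under \<open>S \<cdot> S\<close>. A pointwise cluster point is then invariant under the subgroup of words of even
  length, and averaging over its at most two cosets gives an invariant mean.\<close>

lemma amenable_if_no_decay:
  assumes no_decay: "\<And>\<theta>. 0 < \<theta> \<Longrightarrow> \<theta> < 1 \<Longrightarrow> \<exists>n. \<theta> * energy n < energy (Suc n)"
  shows "amenable_group G"
proof -
  \<comment> \<open>The offset 2 keeps the ratio strictly between 0 and 1 already for
    \<open>k = 0\<close>. The times \<open>N k\<close> need not increase; only the ratios of
    energies tend to 1.\<close>
  have "\<exists>n. (1 - 1 / (real k + 2)) * energy n < energy (Suc n)" for k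
    by (rule no_decay) (auto simp: field_simps)
  then obtain N where N: "\<And>k. (1 - 1 / (real k + 2)) * energy (N k) < energy (Suc (N k))" by metis
  obtain F m where F: "F \<noteq> bot" "F \<le> filtermap (\<lambda>k. energy_measure (N k)) sequentially"
    "\<And>A. ((\<lambda>\<phi>. \<phi> A) \<longlongrightarrow> m A) F"
    using pointwise_cluster[of "\<lambda>k. energy_measure (N k)"] energy_measure_range by blast
  have ev: "\<forall>\<^sub>F \<phi> in F. P \<phi>" if "\<And>k. P (energy_measure (N k))" for P
    by (rule filter_leD[OF F(2)]) (simp add: eventually_filtermap that)
  have m1: "m (carrier G) = 1"
  proof (rule tendsto_unique[OF F(1) F(3)])
    show "((\<lambda>\<phi>. \<phi> (carrier G)) \<longlongrightarrow> 1) F"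
      by (rule tendsto_eventually, rule ev) (rule energy_measure_carrier)
  qed
  have m0: "0 \<le> m A" for A
    using F(1) F(3) by (rule tendsto_lowerbound[rotated 2], intro ev) (use energy_measure_range in auto)
  have mU: "m (A \<union> B) = m A + m B" if "A \<inter> B = {}" for A B
  proof (rule tendsto_unique[OF F(1) F(3)])
    have "((\<lambda>\<phi>. \<phi> A + \<phi> B) \<longlongrightarrow> m A + m B) F" by (intro tendsto_add F)
    moreover have "\<forall>\<^sub>F \<phi> in F. \<phi> A + \<phi> B = \<phi> (A \<union> B)"
      by (rule ev) (simp add: energy_measure_Un[OF that])
    ultimately show "((\<lambda>\<phi>. \<phi> (A \<union> B)) \<longlongrightarrow> m A + m B) F" by (simp add: tendsto_cong)
  qed
  have car: "a \<in> carrier G" if "a \<in> S" for a using that S_carrier by blast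
  have even_inv: "m ((a \<otimes> b) <# A) = m A" if a: "a \<in> S" and b: "b \<in> S" and A: "A \<subseteq> carrier G" for a b A
  proof -
    let ?g = "a \<otimes> b"
    have near: "\<bar>energy_measure (N k) (?g <# A) - energy_measure (N k) A\<bar> \<le> (1 / \<epsilon>\<^sup>2 + 2) / sqrt (real k + 2)" for k
    proof -
      have "\<epsilon>\<^sup>2 * (energy (N k) - u p (N k + N k) ?g) \<le> energy (N k) - energy (Suc (N k))"
        by (rule energy_defect[OF a b])
      also have "\<dots> \<le> 1 / (real k + 2) * energy (N k)" using N[of k] by (simp add: left_diff_distrib)
      finally have "\<epsilon>\<^sup>2 * (energy (N k) - u p (N k + N k) ?g) / \<epsilon>\<^sup>2 \<le> 1 / (real k + 2) * energy (N k) / \<epsilon>\<^sup>2"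
        by (rule divide_right_mono) simp
      then have "energy (N k) - u p (N k + N k) ?g \<le> 1 / (\<epsilon>\<^sup>2 * (real k + 2)) * energy (N k)"
        using eps(1) by (simp add: mult.commute)
      \<comment> \<open>The free parameter is \<open>\<tau> = sqrt (real k + 2)\<close>, against a
        relative defect of order \<open>1 / (real k + 2)\<close>; both error terms are then of order
        \<open>1 / sqrt (real k + 2)\<close>.\<close>
      then have "\<bar>energy_measure (N k) (?g <# A) - energy_measure (N k) A\<bar> \<le>
          sqrt (real k + 2) * (1 / (\<epsilon>\<^sup>2 * (real k + 2))) + 2 / sqrt (real k + 2)"
        using car[OF a] car[OF b] A by (intro energy_measure_translate) auto
      also have "sqrt (real k + 2) * (1 / (\<epsilon>\<^sup>2 * (real k + 2))) = 1 / \<epsilon>\<^sup>2 / sqrt (real k + 2)"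
        using real_div_sqrt[of "real k + 2"] by (simp add: divide_simps)
      finally show ?thesis by (simp add: add_divide_distrib)
    qed
    have null: "(\<lambda>k. (1 / \<epsilon>\<^sup>2 + 2) / sqrt (real k + 2)) \<longlonglongrightarrow> 0"
      by (rule tendsto_divide_0[OF tendsto_const]) (rule filterlim_at_top_imp_at_infinity, real_asymp)
    have "(\<lambda>k. energy_measure (N k) (?g <# A) - energy_measure (N k) A) \<longlonglongrightarrow> 0"
      by (rule Lim_null_comparison[OF _ null]) (use near in simp)
    then have "((\<lambda>\<phi>. \<phi> (?g <# A) - \<phi> A) \<longlongrightarrow> 0) F"
      by (intro tendsto_mono[OF F(2)]) (simp add: filterlim_filtermap)
    moreover have "((\<lambda>\<phi>. \<phi> (?g <# A) - \<phi> A) \<longlongrightarrow> m (?g <# A) - m A) F" by (intro tendsto_diff F)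
    ultimately have "m (?g <# A) - m A = 0" using tendsto_unique[OF F(1)] by blast
    then show ?thesis by simp
  qed
  obtain s where s: "s \<in> S" using weights_sum by fastforce
  note sc = car[OF s] car[OF inv_S[OF s]]
  \<comment> \<open>A letter \<open>a\<close> exchanges the two summands:
    \<open>inv s \<otimes> a\<close> and \<open>a \<otimes> s\<close> are products of two letters,
    under which \<open>m\<close> is invariant.\<close>
  define M where "M A = (m A + m (inv s <# A)) / 2" for A
  have letter: "M (a <# A) = M A" if a: "a \<in> S" and A: "A \<subseteq> carrier G" for a A
  proof -
    have "m (inv s <# (a <# A)) = m A"
      using even_inv[OF inv_S[OF s] a A] lcos_m_assoc[OF A] sc car[OF a] by simp
    moreover have "a <# A = (a \<otimes> s) <# (inv s <# A)"
    proof -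
      have "(a \<otimes> s) <# (inv s <# A) = (a \<otimes> s \<otimes> inv s) <# A"
        using lcos_m_assoc[OF A] sc car[OF a] by simp
      also have "a \<otimes> s \<otimes> inv s = a" using sc car[OF a] by (simp add: m_assoc)
      finally show ?thesis by simp
    qed
    then have "m (a <# A) = m (inv s <# A)"
      using even_inv[OF a s, of "inv s <# A"] l_coset_subset_G[OF A sc(2)] by simp
    ultimately show ?thesis by (simp add: M_def)
  qed
  have word: "M (word_prod G ws <# A) = M A" if "set ws \<subseteq> S" "A \<subseteq> carrier G" for ws A
    using that
  proof (induction ws)
    case Nil
    then show ?case by (simp add: lcos_mult_one)
  next
    case (Cons a ws)
    then have c: "a \<in> S" "a \<in> carrier G" "word_prod G ws \<in> carrier G" using car by auto
    have "word_prod G (a # ws) <# A = a <# (word_prod G ws <# A)"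
      using lcos_m_assoc[OF Cons.prems(2)] c by simp
    then show ?case using letter[OF c(1) l_coset_subset_G[OF Cons.prems(2) c(3)]] Cons by simp
  qed
  have "M (carrier G) = 1"
  proof -
    have "inv s <# carrier G = carrier G"
      using sc by (auto simp: l_coset_def intro!: bexI[of _ "s \<otimes> x" for x] simp: m_assoc[symmetric])
    then show ?thesis by (simp add: M_def m1)
  qed
  moreover have "0 \<le> M A" for A by (simp add: M_def m0)
  moreover have "M (A \<union> B) = M A + M B" if "A \<subseteq> carrier G" "B \<subseteq> carrier G" "A \<inter> B = {}" for A B
  proof -
    have "inv s <# (A \<union> B) = (inv s <# A) \<union> (inv s <# B)" by (auto simp: l_coset_def)
    moreover have "(inv s <# A) \<inter> (inv s <# B) = {}"
    proof -
      have "x = y" if "x \<in> A" "y \<in> B" "inv s \<otimes> x = inv s \<otimes> y" for x y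
        using that \<open>A \<subseteq> carrier G\<close> \<open>B \<subseteq> carrier G\<close> sc by (metis Units_eq Units_l_cancel subsetD)
      then show ?thesis using that(3) by (auto simp: l_coset_def)
    qed
    ultimately show ?thesis using mU that(3) by (simp add: M_def add_divide_distrib)
  qed
  moreover have "M (x <# A) = M A" if "x \<in> carrier G" "A \<subseteq> carrier G" for x A
    using word that by (metis word_over_S)
  ultimately show ?thesis
    unfolding amenable_group_def using group_axioms by blast
qed

theorem exponential_decay:
  assumes "\<not> amenable_group G"
  obtains \<rho> where "0 < \<rho>" "\<rho> < 1" "\<And>n x. x \<in> carrier G \<Longrightarrow> u p n x \<le> 1 / \<rho> * \<rho> ^ n"
proof -
  obtain \<theta> where \<theta>: "0 < \<theta>" "\<theta> < 1" "\<And>n. energy (Suc n) \<le> \<theta> * energy n"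
    using amenable_if_no_decay assms by (meson not_le)
  have E: "energy n \<le> \<theta> ^ n" for n
  proof (induction n)
    case (Suc n)
    have "energy (Suc n) \<le> \<theta> * energy n" by (rule \<theta>(3))
    also have "\<dots> \<le> \<theta> * \<theta> ^ n" using Suc \<theta> by (intro mult_left_mono) auto
    finally show ?case by simp
  qed (simp add: step_prob_0)
  \<comment> \<open>The energy at index \<open>n\<close> concerns \<open>2 n\<close> steps, hence
    the square root; the factor \<open>1 / \<rho>\<close> pays for odd times.\<close>
  define \<rho> where "\<rho> = sqrt \<theta>"
  have \<rho>: "0 < \<rho>" "\<rho> < 1" "\<theta> = \<rho>\<^sup>2" using \<theta> by (auto simp: \<rho>_def)
  have "u p n x \<le> 1 / \<rho> * \<rho> ^ n" if "x \<in> carrier G" for n x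
  proof -
    have "u p n x \<le> \<theta> ^ (n div 2)" using step_prob_le_energy_div_2[OF that, of n] E[of "n div 2"] by simp
    also have "\<dots> = \<rho> ^ (2 * (n div 2))" by (simp add: \<rho>(3) power_mult)
    also have "\<dots> = 1 / \<rho> * \<rho> ^ Suc (2 * (n div 2))" using \<rho> by simp
    also have "\<dots> \<le> 1 / \<rho> * \<rho> ^ n" using \<rho> by (intro mult_left_mono power_decreasing) auto
    finally show ?thesis .
  qed
  then show ?thesis using that \<rho> by blast
qed

end

section \<open>The random walk and its words\<close>

lemma word_exp_point:
  assumes "finite S" "set ws \<subseteq> S"
  shows "word_exp S p (length ws) (\<lambda>xs. of_bool (xs = ws)) = prod_list (map p ws)"
  using assms(2)
proof (induction ws)
  case (Cons a ws)
  have "word_exp S p (length ws) (\<lambda>xs. of_bool (b # xs = a # ws)) =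
      (if b = a then prod_list (map p ws) else 0)" for b
    using Cons by (cases "b = a") auto
  then have "word_exp S p (length (a # ws)) (\<lambda>xs. of_bool (xs = a # ws)) =
      (\<Sum>b\<in>S. if b = a then p b * prod_list (map p ws) else 0)"
    unfolding length_Cons word_exp.simps by (intro sum.cong) auto
  then show ?case using Cons.prems assms(1) by (simp add: sum.delta')
qed simp

lemma word_exp_eq_sum:
  assumes "finite S"
  shows "word_exp S p n F = (\<Sum>ws | set ws \<subseteq> S \<and> length ws = n. prod_list (map p ws) * F ws)"
proof -
  let ?W = "{ws. set ws \<subseteq> S \<and> length ws = n}"
  have fin: "finite ?W" by (rule finite_lists_length_eq[OF assms])
  have "word_exp S p n F = word_exp S p n (\<lambda>xs. \<Sum>ws\<in>?W. of_bool (xs = ws) * F ws)"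
  proof (rule word_exp_cong)
    fix xs assume xs: "length xs = n" "set xs \<subseteq> S"
    have "(\<Sum>ws\<in>?W. of_bool (xs = ws) * F ws) = (\<Sum>ws\<in>?W. if xs = ws then F ws else 0)"
      by (intro sum.cong) auto
    then show "F xs = (\<Sum>ws\<in>?W. of_bool (xs = ws) * F ws)" using xs fin by simp
  qed
  also have "\<dots> = (\<Sum>ws\<in>?W. word_exp S p n (\<lambda>xs. of_bool (xs = ws)) * F ws)"
    unfolding word_exp_sum word_exp_cmult_right ..
  also have "\<dots> = (\<Sum>ws\<in>?W. prod_list (map p ws) * F ws)"
    using word_exp_point[OF assms] by (intro sum.cong) auto
  finally show ?thesis .
qed

text \<open>Domination by a factor \<open>c\<close> per letter becomes \<open>c ^ n\<close> for
  words. With \<open>c\<close> slightly above 1 an exponential bound for the step probabilities of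
  one law passes to all nearby laws, at a slightly worse rate.\<close>

lemma word_exp_mono_weights:
  assumes "\<And>a. a \<in> S \<Longrightarrow> 0 \<le> q a" "\<And>a. a \<in> S \<Longrightarrow> q a \<le> c * p a" "0 \<le> c" and "\<And>xs. 0 \<le> F xs"
  shows "0 \<le> word_exp S q n F \<and> word_exp S q n F \<le> c ^ n * word_exp S p n F"
  using assms(4)
proof (induction n arbitrary: F)
  case (Suc n)
  have IH: "0 \<le> word_exp S q n (\<lambda>xs. F (a # xs))"
    "word_exp S q n (\<lambda>xs. F (a # xs)) \<le> c ^ n * word_exp S p n (\<lambda>xs. F (a # xs))" for a
    using Suc.IH[of "\<lambda>xs. F (a # xs)"] Suc.prems by auto
  have "q a * word_exp S q n (\<lambda>xs. F (a # xs)) \<le> (c * p a) * (c ^ n * word_exp S p n (\<lambda>xs. F (a # xs)))"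
    if "a \<in> S" for a
    using that assms IH by (intro mult_mono) (auto intro: order_trans)
  then have "word_exp S q (Suc n) F \<le> (\<Sum>a\<in>S. (c * p a) * (c ^ n * word_exp S p n (\<lambda>xs. F (a # xs))))"
    unfolding word_exp.simps by (intro sum_mono)
  also have "\<dots> = c ^ Suc n * word_exp S p (Suc n) F" by (simp add: sum_distrib_left mult_ac)
  finally show ?case using IH assms(1) by (auto intro!: sum_nonneg mult_nonneg_nonneg)
qed simp

lemma word_weights_pmf: "finite S \<Longrightarrow> set_pmf \<mu> = S \<Longrightarrow> word_weights S (pmf \<mu>)"
  by unfold_locales (auto simp: sum_pmf_eq_1)

context walk_group
begin

context
  fixes \<mu> :: "'a pmf"
  assumes set_pmf: "set_pmf \<mu> = S"
begin

lemma expectation_convolution_power: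
  fixes f :: "'a \<Rightarrow> real"
  shows "finite (set_pmf (convolution_power G \<mu> n))"
    and "measure_pmf.expectation (convolution_power G \<mu> n) f = word_exp S (pmf \<mu>) n (\<lambda>ws. f (word_prod G ws))"
proof -
  show fin: "finite (set_pmf (convolution_power G \<mu> n))" for n
    by (induction n) (simp_all add: convolution_pmf_def set_pmf finite_S)
  show "measure_pmf.expectation (convolution_power G \<mu> n) f = word_exp S (pmf \<mu>) n (\<lambda>ws. f (word_prod G ws))"
  proof (induction n arbitrary: f)
    case (Suc n)
    have step: "measure_pmf.expectation (map_pmf (\<lambda>y. x \<otimes> y) \<mu>) f = (\<Sum>a\<in>S. pmf \<mu> a * f (x \<otimes> a))" for x
      using integral_measure_pmf[OF finite_S, of \<mu> "\<lambda>y. f (x \<otimes> y)"] by (simp add: set_pmf)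
    have "convolution_power G \<mu> (Suc n) = convolution_power G \<mu> n \<bind> (\<lambda>x. map_pmf (\<lambda>y. x \<otimes> y) \<mu>)"
      by (simp add: convolution_pmf_def pair_pmf_def map_bind_pmf map_pmf_def bind_assoc_pmf bind_return_pmf)
    then have "measure_pmf.expectation (convolution_power G \<mu> (Suc n)) f =
        (\<Sum>x\<in>set_pmf (convolution_power G \<mu> n). pmf (convolution_power G \<mu> n) x * (\<Sum>a\<in>S. pmf \<mu> a * f (x \<otimes> a)))"
      using pmf_expectation_bind[OF fin[of n], of "\<lambda>x. map_pmf (\<lambda>y. x \<otimes> y) \<mu>" "convolution_power G \<mu> n" f] finite_S
      by (simp only: step) (simp add: set_pmf)
    also have "\<dots> = measure_pmf.expectation (convolution_power G \<mu> n) (\<lambda>x. \<Sum>a\<in>S. pmf \<mu> a * f (x \<otimes> a))"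
      using integral_measure_pmf[OF fin[of n], of "convolution_power G \<mu> n" "\<lambda>x. \<Sum>a\<in>S. pmf \<mu> a * f (x \<otimes> a)"] by simp
    also have "\<dots> = word_exp S (pmf \<mu>) n (\<lambda>ws. \<Sum>a\<in>S. pmf \<mu> a * f (word_prod G ws \<otimes> a))" by (rule Suc)
    \<comment> \<open>Convolution powers grow at the right end and the recursion of
      \<open>word_exp\<close> at the left end; splitting off the last letter reconciles
      them.\<close>
    also have "\<dots> = word_exp S (pmf \<mu>) (n + 1) (\<lambda>ws. f (word_prod G ws))"
      unfolding word_exp_append
    proof (rule word_exp_cong)
      fix xs assume "set xs \<subseteq> S"
      then have "word_prod G (xs @ [a]) = word_prod G xs \<otimes> a" if "a \<in> S" for a
        using that S_carrier by (subst word_prod_append) auto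
      then show "(\<Sum>a\<in>S. pmf \<mu> a * f (word_prod G xs \<otimes> a)) =
          word_exp S (pmf \<mu>) 1 (\<lambda>ys. f (word_prod G (xs @ ys)))" by simp
    qed
    finally show ?case by simp
  qed simp
qed

lemma pmf_convolution_power: "pmf (convolution_power G \<mu> n) x = u (pmf \<mu>) n x"
proof -
  let ?A = "insert x (set_pmf (convolution_power G \<mu> n))"
  have "measure_pmf.expectation (convolution_power G \<mu> n) (\<lambda>y. of_bool (y = x)) =
      (\<Sum>y\<in>?A. of_bool (y = x) * pmf (convolution_power G \<mu> n) y)"
    by (rule integral_measure_pmf_real) (auto simp: expectation_convolution_power(1))
  also have "\<dots> = (\<Sum>y\<in>?A. if y = x then pmf (convolution_power G \<mu> n) y else 0)"
    by (intro sum.cong) auto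
  also have "\<dots> = pmf (convolution_power G \<mu> n) x"
    by (simp add: expectation_convolution_power(1))
  finally show ?thesis by (simp add: expectation_convolution_power(2) step_prob_def)
qed

lemma green_function_eq: "green_function G \<mu> = green G S (pmf \<mu>)"
  by (rule ext) (simp add: green_function_def green_def pmf_convolution_power)

lemma infsum_entropy:
  "(\<Sum>\<^sub>\<infinity>x\<in>carrier G. - ln (pmf (convolution_power G \<mu> n) x) * pmf (convolution_power G \<mu> n) x) =
    word_exp S (pmf \<mu>) n (\<lambda>ws. - ln (u (pmf \<mu>) n (word_prod G ws)))"
proof -
  define A where "A = word_prod G ` {ws. set ws \<subseteq> S \<and> length ws = n}"
  have A: "finite A" "A \<subseteq> carrier G" unfolding A_def using finite_words by auto
  have "(\<Sum>\<^sub>\<infinity>x\<in>carrier G. - ln (u (pmf \<mu>) n x) * u (pmf \<mu>) n x) = (\<Sum>\<^sub>\<infinity>x\<in>A. - ln (u (pmf \<mu>) n x) * u (pmf \<mu>) n x)"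
  proof (rule infsum_cong_neutral)
    fix x assume "x \<in> carrier G - A"
    then have "u (pmf \<mu>) n x = 0" by (intro step_prob_eq_0) (auto simp: A_def)
    then show "- ln (u (pmf \<mu>) n x) * u (pmf \<mu>) n x = 0" by simp
  qed (use A in auto)
  also have "\<dots> = (\<Sum>x\<in>A. u (pmf \<mu>) n x * - ln (u (pmf \<mu>) n x))"
    using A by (simp add: mult.commute)
  also have "\<dots> = word_exp S (pmf \<mu>) n (\<lambda>ws. - ln (u (pmf \<mu>) n (word_prod G ws)))"
    by (rule word_exp_word_prod[OF A(1), symmetric]) (auto simp: A_def)
  finally show ?thesis by (simp add: pmf_convolution_power)
qed

text \<open>The bridge from the infinite product measure to finite sums. The first \<open>n\<close>
  increments form a random word, the probability of a given word is that of a cylinder and hence a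
  product of weights, and the finitely many words over \<open>S\<close> already have total mass
  1.\<close>

lemma integral_increments:
  fixes F :: "'a list \<Rightarrow> real"
  shows "(\<integral>\<omega>. F (map \<omega> [1..<Suc n]) \<partial>increments_law G \<mu>) = word_exp S (pmf \<mu>) n F"
proof -
  define M where "M = (\<lambda>_::nat. restrict_space (measure_pmf \<mu>) (carrier G))"
  have "emeasure (measure_pmf \<mu>) (carrier G) = 1"
    using S_carrier by (intro measure_pmf.emeasure_eq_1_AE) (auto simp: AE_measure_pmf_iff set_pmf)
  then have "prob_space (M i)" for i
    unfolding M_def by (intro prob_space_restrict_space) auto
  then interpret product_prob_space M "{1..}" by (rule product_prob_spaceI)
  define P where "P = Pi\<^sub>M {1..} M"
  have law: "increments_law G \<mu> = P" by (simp add: increments_law_def P_def M_def)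
  interpret Q: prob_space P unfolding P_def by (rule P.prob_space_axioms)
  define X where "X \<omega> = map \<omega> [1..<Suc n]" for \<omega> :: "nat \<Rightarrow> 'a"
  have sets_M: "A \<in> sets (M i) \<longleftrightarrow> A \<subseteq> carrier G" for A i
    by (auto simp: M_def sets_restrict_space image_iff)
  have space_M: "space (M i) = carrier G" for i by (simp add: M_def space_restrict_space)
  have space_P: "\<omega> i \<in> carrier G" if "\<omega> \<in> space P" "1 \<le> i" for \<omega> i
    using that by (auto simp: P_def space_PiM space_M)
  define cyl where "cyl xs = prod_emb {1..} M {1..n} (Pi\<^sub>E {1..n} (\<lambda>j. {xs ! (j - 1)}))" for xs
  have cyl: "X -` {xs} \<inter> space P = cyl xs" if "length xs = n" for xs
  proof -
    have "X \<omega> = xs \<longleftrightarrow> (\<forall>j\<in>{1..n}. \<omega> j = xs ! (j - 1))" for \<omega>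
    proof -
      have "X \<omega> = xs \<longleftrightarrow> (\<forall>i<n. \<omega> (Suc i) = xs ! i)"
        using that by (auto simp: X_def list_eq_iff_nth_eq simp del: upt_Suc)
      also have "\<dots> \<longleftrightarrow> (\<forall>j\<in>{1..n}. \<omega> j = xs ! (j - 1))"
        by (metis (no_types, lifting) One_nat_def Suc_le_D atLeastAtMost_iff diff_Suc_1 le_add1 less_eq_Suc_le plus_1_eq_Suc)
      finally show ?thesis .
    qed
    then have "X -` {xs} = {\<omega>. \<forall>j\<in>{1..n}. \<omega> j = xs ! (j - 1)}" by blast
    then show ?thesis
      by (simp only:) (auto simp: cyl_def prod_emb_def P_def space_PiM PiE_iff)
  qed
  have cyl_sets: "cyl xs \<in> sets P" if "set xs \<subseteq> carrier G" "length xs = n" for xs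
    unfolding cyl_def P_def using that
    by (intro sets_PiM_I) (auto simp: sets_M subset_iff)
  have cyl_prob: "measure P (cyl xs) = prod_list (map (pmf \<mu>) xs)"
    if xs: "set xs \<subseteq> carrier G" "length xs = n" for xs
  proof -
    have c: "xs ! (j - 1) \<in> carrier G" if "j \<in> {1..n}" for j
      using that xs nth_mem[of "j - 1" xs] by auto
    have "measure P (cyl xs) = (\<Prod>j\<in>{1..n}. measure (M j) {xs ! (j - 1)})"
      unfolding cyl_def P_def using c by (intro measure_PiM_emb) (auto simp: sets_M)
    also have "\<dots> = (\<Prod>j\<in>{1..n}. pmf \<mu> (xs ! (j - 1)))"
      using c by (intro prod.cong refl) (simp add: M_def measure_restrict_space measure_pmf_single)
    also have "\<dots> = prod_list (map (pmf \<mu>) xs)"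
      unfolding prod.list_conv_set_nth using xs by (simp add: prod.atLeast1_atMost_eq atLeast0LessThan)
    finally show ?thesis .
  qed
  \<comment> \<open>Countability of the carrier reduces measurability to singletons; as the target
    is discrete, an arbitrary \<open>F\<close> of the word is then measurable.\<close>
  have X: "X \<in> measurable P (count_space (lists (carrier G)))"
  proof (subst measurable_count_space_eq_countable, intro countable_lists countable_carrier, intro conjI ballI)
    show "X \<in> space P \<rightarrow> lists (carrier G)" using space_P by (auto simp: X_def)
    fix xs assume xs: "xs \<in> lists (carrier G)"
    show "X -` {xs} \<inter> space P \<in> sets P"
    proof (cases "length xs = n")
      case True
      then show ?thesis using cyl[OF True] cyl_sets[of xs] xs by auto
    next
      case False
      then have "X -` {xs} = {}" by (auto simp: X_def simp del: upt_Suc)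
      then show ?thesis by simp
    qed
  qed
  define W where "W = {ws. set ws \<subseteq> S \<and> length ws = n}"
  have W: "finite W" unfolding W_def by (rule finite_words)
  have WX: "X -` {ws} \<inter> space P \<in> sets P" "measure P (X -` {ws} \<inter> space P) = prod_list (map (pmf \<mu>) ws)"
    if "ws \<in> W" for ws
    using that cyl[of ws] cyl_sets[of ws] cyl_prob[of ws] by (auto simp: W_def)
  interpret word_weights S "pmf \<mu>" by (rule word_weights_pmf[OF finite_S set_pmf])
  have "X -` W \<inter> space P = (\<Union>ws\<in>W. X -` {ws} \<inter> space P)" by auto
  then have "measure P (X -` W \<inter> space P) = (\<Sum>ws\<in>W. measure P (X -` {ws} \<inter> space P))"
    using W WX(1) by (simp only:) (intro Q.finite_measure_finite_Union, auto simp: disjoint_family_on_def)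
  also have "\<dots> = (\<Sum>ws\<in>W. prod_list (map (pmf \<mu>) ws) * 1)" using WX(2) by simp
  also have "\<dots> = 1"
    using word_exp_eq_sum[OF finite_S, of "pmf \<mu>" n "\<lambda>_. 1"] by (simp add: W_def)
  finally have "AE \<omega> in P. \<omega> \<in> X -` W \<inter> space P" by (rule Q.AE_prob_1)
  then have AE: "AE \<omega> in P. F (X \<omega>) = (\<Sum>ws\<in>W. F ws * indicator (X -` {ws} \<inter> space P) \<omega>)"
  proof eventually_elim
    case (elim \<omega>)
    have "(\<Sum>ws\<in>W. F ws * indicator (X -` {ws} \<inter> space P) \<omega>) = (\<Sum>ws\<in>W. if X \<omega> = ws then F ws else 0)"
      using elim by (intro sum.cong) (auto simp: indicator_def)
    then show ?case using elim W by simp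
  qed
  have "(\<integral>\<omega>. F (X \<omega>) \<partial>P) = (\<integral>\<omega>. (\<Sum>ws\<in>W. F ws * indicator (X -` {ws} \<inter> space P) \<omega>) \<partial>P)"
  proof (rule integral_cong_AE[OF _ _ AE])
    show "(\<lambda>\<omega>. F (X \<omega>)) \<in> borel_measurable P"
      by (rule measurable_compose[OF X]) simp
    show "(\<lambda>\<omega>. \<Sum>ws\<in>W. F ws * indicator (X -` {ws} \<inter> space P) \<omega>) \<in> borel_measurable P"
      using WX(1) by (intro borel_measurable_sum borel_measurable_times borel_measurable_indicator) auto
  qed
  also have "\<dots> = (\<Sum>ws\<in>W. F ws * measure P (X -` {ws} \<inter> space P))"
    using WX(1) Q.emeasure_finite
    by (subst Bochner_Integration.integral_sum) (auto simp: less_top[symmetric] intro!: integrable_mult_right sum.cong)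
  also have "\<dots> = word_exp S (pmf \<mu>) n F"
    unfolding word_exp_eq_sum[OF finite_S] W_def[symmetric] using WX(2) by (intro sum.cong) auto
  finally show ?thesis by (simp add: law X_def)
qed

lemma mean_covariance_eq:
  "mean_covariance G \<nu> \<mu> (green_metric G \<mu>) n =
    word_exp S (pmf \<mu>) n (\<lambda>xs. green_norm G S (pmf \<mu>) (word_prod G xs) * (\<Sum>x\<leftarrow>xs. \<nu> x)) / real n"
proof -
  have "(\<integral>\<omega>. green_metric G \<mu> \<one> (walk G n \<omega>) * walk_martingale \<nu> n \<omega> \<partial>increments_law G \<mu>) =
      (\<integral>\<omega>. green_norm G S (pmf \<mu>) (word_prod G (map \<omega> [1..<Suc n])) * (\<Sum>x\<leftarrow>map \<omega> [1..<Suc n]. \<nu> x) \<partial>increments_law G \<mu>)"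
  proof (rule Bochner_Integration.integral_cong[OF refl])
    fix \<omega> assume \<omega>: "\<omega> \<in> space (increments_law G \<mu>)"
    have car: "\<omega> i \<in> carrier G" if "1 \<le> i" for i
      using \<omega> that by (auto simp: increments_law_def space_PiM space_restrict_space PiE_iff)
    have w: "walk G n \<omega> = word_prod G (map \<omega> [1..<Suc n])" for n
    proof (induction n)
      case (Suc n)
      have "word_prod G (map \<omega> [1..<Suc n] @ [\<omega> (Suc n)]) =
          word_prod G (map \<omega> [1..<Suc n]) \<otimes> word_prod G [\<omega> (Suc n)]"
        using car by (intro word_prod_append) auto
      then show ?case using Suc car[of "Suc n"] by simp
    qed simp
    have "walk_martingale \<nu> n \<omega> = (\<Sum>x\<leftarrow>map \<omega> [1..<Suc n]. \<nu> x)" for n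
      by (induction n) (simp_all add: walk_martingale_def)
    moreover have "word_prod G (map \<omega> [1..<Suc n]) \<in> carrier G" using car by (intro word_prod_closed) auto
    ultimately show "green_metric G \<mu> \<one> (walk G n \<omega>) * walk_martingale \<nu> n \<omega> =
        green_norm G S (pmf \<mu>) (word_prod G (map \<omega> [1..<Suc n])) * (\<Sum>x\<leftarrow>map \<omega> [1..<Suc n]. \<nu> x)"
      unfolding w by (simp add: green_metric_def green_norm_def green_function_eq del: upt_Suc)
  qed
  also have "\<dots> = word_exp S (pmf \<mu>) n (\<lambda>xs. green_norm G S (pmf \<mu>) (word_prod G xs) * (\<Sum>x\<leftarrow>xs. \<nu> x))"
    by (rule integral_increments)
  finally show ?thesis by (simp add: mean_covariance_def)
qed

end

end

section \<open>Transfer to the given measures and conclusion\<close>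

lemma (in hyperbolic_walks) asymptotic_entropy_eq_rate:
  assumes "set_pmf \<mu> = S" "admissible (pmf \<mu>)"
  shows "asymptotic_entropy G \<mu> = rate (pmf \<mu>) (pmf \<mu>)"
proof -
  have "(\<lambda>n. 1 / real n * entropy (pmf \<mu>) n) \<longlonglongrightarrow> rate (pmf \<mu>) (pmf \<mu>)"
    using entropy_tendsto[OF assms(2)] by simp
  then show ?thesis
    unfolding asymptotic_entropy_def infsum_entropy[OF assms(1)] entropy_def[symmetric] by (rule limI)
qed

lemma (in hyperbolic_walks) mean_covariance_tendsto:
  assumes "set_pmf \<mu> = S" "admissible (pmf \<mu>)" "(\<Sum>a\<in>S. pmf \<mu> a * \<nu> a) = 0"
  shows "mean_covariance G \<nu> \<mu> (green_metric G \<mu>) \<longlonglongrightarrow> cov_rate (pmf \<mu>) (pmf \<mu>) \<nu>"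
  using cov_tendsto[OF assms(2,2,3)] unfolding mean_covariance_eq[OF assms(1)] cov_def .

lemma hyperbolic_group_metric:
  assumes "hyperbolic_group G"
  obtains T \<delta> where "hyperbolic_word_metric G T \<delta>"
proof -
  obtain T d where T: "group G" "finite T" "T \<subseteq> carrier G" "generate G T = carrier G"
    and d: "\<And>w x y z. w \<in> carrier G \<Longrightarrow> x \<in> carrier G \<Longrightarrow> y \<in> carrier G \<Longrightarrow> z \<in> carrier G \<Longrightarrow>
      gromov_product (word_dist G T) w x z \<ge>
        min (gromov_product (word_dist G T) w x y) (gromov_product (word_dist G T) w y z) - d"
    using assms unfolding hyperbolic_group_def gromov_hyperbolic_on_def by metis
  have "d \<le> real (nat \<lceil>d\<rceil>)" by (rule real_nat_ceiling_ge)
  then have "hyperbolic_word_metric G T (nat \<lceil>d\<rceil>)"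
    using T d unfolding hyperbolic_word_metric_def hyperbolic_word_metric_axioms_def
      word_metric_group_def word_metric_group_axioms_def
    by (meson diff_left_mono order_trans)
  then show ?thesis using that by blast
qed

text \<open>Exponentiate the increment of the logarithm; this returns the quotient of the values
  wherever \<open>f\<close> is positive, in particular near 0.\<close>

lemma log_derivative_ratio:
  fixes f :: "real \<Rightarrow> real"
  assumes "((\<lambda>t. ln (f t)) has_real_derivative D) (at 0)" and pos: "\<And>t. t \<in> {-1..1} \<Longrightarrow> 0 < f t"
  shows "((\<lambda>t. (f t / f 0 - 1) / t) \<longlongrightarrow> D) (at 0)" and "(f \<longlongrightarrow> f 0) (at 0)"
proof -
  have "((\<lambda>t. exp (ln (f t) - ln (f 0))) has_real_derivative exp (ln (f 0) - ln (f 0)) * D) (at 0)"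
    by (rule derivative_eq_intros assms refl | simp)+
  then have "((\<lambda>t. (exp (ln (f t) - ln (f 0)) - 1) / t) \<longlongrightarrow> D) (at 0)"
    by (simp add: has_field_derivative_iff)
  moreover have "\<forall>\<^sub>F t in at 0. t \<in> {-1..1::real}"
    unfolding eventually_at by (rule exI[of _ 1]) (auto simp: abs_le_iff)
  then have "\<forall>\<^sub>F t in at 0. (exp (ln (f t) - ln (f 0)) - 1) / t = (f t / f 0 - 1) / t"
    by eventually_elim (use pos[of 0] in \<open>simp add: exp_diff pos\<close>)
  ultimately show lim: "((\<lambda>t. (f t / f 0 - 1) / t) \<longlongrightarrow> D) (at 0)" by (simp add: tendsto_cong)
  have "((\<lambda>t. f 0 * (1 + (f t / f 0 - 1) / t * t)) \<longlongrightarrow> f 0 * (1 + D * 0)) (at 0)"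
    by (intro tendsto_intros lim)
  moreover have "\<forall>\<^sub>F t in at 0. f 0 * (1 + (f t / f 0 - 1) / t * t) = f t"
    unfolding eventually_at_filter using pos[of 0] by (intro always_eventually) simp
  ultimately show "(f \<longlongrightarrow> f 0) (at 0)" by (simp add: tendsto_cong)
qed

text \<open>Convergence is part of the conclusion because \<open>asymptotic_covariance\<close> is
  defined by \<open>lim\<close>, whose value is only meaningful when the limit exists.\<close>

theorem theorem2p2:
  fixes G :: "('a, 'b) monoid_scheme"
    and S :: "'a set"
    and \<mu> :: "real \<Rightarrow> 'a pmf"
    and \<nu> :: "'a \<Rightarrow> real"
  assumes "nonelementary_hyperbolic_group G"
    and "finite S" and "S \<subseteq> carrier G" and "symmetric_set G S"
    and "generate G S = carrier G"
    and "\<And>t. t \<in> {-1..1} \<Longrightarrow> \<mu> t \<in> sym_prob_measures G S"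
    and "\<And>a. a \<in> S \<Longrightarrow> ((\<lambda>t. ln (pmf (\<mu> t) a)) has_real_derivative \<nu> a) (at 0)"
  shows "convergent (mean_covariance G \<nu> (\<mu> 0) (green_metric G (\<mu> 0))) \<and>
    ((\<lambda>t. asymptotic_entropy G (\<mu> t)) has_real_derivative
      asymptotic_covariance G \<nu> (\<mu> 0) (green_metric G (\<mu> 0))) (at 0)"
proof -
  have "hyperbolic_group G" and nonamenable: "\<not> amenable_group G"
    using assms(1) by (auto simp: nonelementary_hyperbolic_group_def)
  then obtain T \<delta> where hyp: "hyperbolic_word_metric G T \<delta>" by (metis hyperbolic_group_metric)
  then have grp: "group G" by (simp add: hyperbolic_word_metric_def word_metric_group_def)
  have walk: "walk_group G S"
    using grp assms(2-5) by (simp add: walk_group_def walk_group_axioms_def symmetric_set_def)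
  have set: "set_pmf (\<mu> t) = S" if "t \<in> {-1..1}" for t
    using assms(6)[OF that] by (simp add: sym_prob_measures_def)
  have sym: "pmf (\<mu> t) (inv\<^bsub>G\<^esub> x) = pmf (\<mu> t) x" if "t \<in> {-1..1}" "x \<in> carrier G" for t x
    using assms(6)[OF that(1)] that(2) by (simp add: sym_prob_measures_def)
  have weights: "word_weights S (pmf (\<mu> t))" if "t \<in> {-1..1}" for t
    by (rule word_weights_pmf[OF assms(2) set[OF that]])
  have pos: "0 < pmf (\<mu> t) a" if "t \<in> {-1..1}" "a \<in> S" for t a
    using that set[OF that(1)] by (simp add: pmf_positive)
  have "S \<noteq> {}" using set[of 0] set_pmf_not_empty[of "\<mu> 0"] by auto
  define e where "e = Min (pmf (\<mu> 0) ` S)"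
  have e: "0 < e" "\<And>a. a \<in> S \<Longrightarrow> e \<le> pmf (\<mu> 0) a"
    using assms(2) \<open>S \<noteq> {}\<close> pos[of 0] by (auto simp: e_def)
  interpret sym: symmetric_walk_group G S "pmf (\<mu> 0)" e
    using walk weights[of 0] e sym[of 0] assms(3)
    by (auto simp: symmetric_walk_group_def weighted_walk_group_def symmetric_walk_group_axioms_def)
  obtain r where r: "0 < r" "r < 1"
    "\<And>n x. x \<in> carrier G \<Longrightarrow> step_prob G S (pmf (\<mu> 0)) n x \<le> 1 / r * r ^ n"
    using sym.exponential_decay[OF nonamenable] by blast
  \<comment> \<open>Any rate strictly between \<open>r\<close> and 1 would do: the quotient
    \<open>\<rho> / r > 1\<close> is the room left for perturbing the weights.\<close>
  define \<rho> where "\<rho> = (1 + r) / 2"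
  have \<rho>: "r < \<rho>" "0 < \<rho>" "\<rho> < 1" using r by (auto simp: \<rho>_def)
  \<comment> \<open>Half of the minimal weight of \<open>\<mu> 0\<close> and the worse rate
    \<open>\<rho>\<close> define a class that contains \<open>\<mu> t\<close> for all
    \<open>t\<close> near 0.\<close>
  interpret hyperbolic_walks G S "e / 2" "1 / r" \<rho> T \<delta>
    using hyp walk e r \<rho>
    by (simp add: hyperbolic_walks_def transient_walks_def transient_walks_axioms_def)
  define q where "q t = pmf (\<mu> t)" for t
  have admissible: "admissible (q t)"
    if t: "t \<in> {-1..1}" and near: "\<And>a. a \<in> S \<Longrightarrow> e / 2 \<le> q t a \<and> q t a \<le> \<rho> / r * q 0 a" for t
    unfolding admissible_def
  proof (intro conjI ballI allI)
    show "word_weights S (q t)" using weights[OF t] by (simp add: q_def)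
    show "e / 2 \<le> q t a" if "a \<in> S" for a using near[OF that] by simp
    fix n x assume x: "x \<in> carrier G"
    have "step_prob G S (q t) n x \<le> (\<rho> / r) ^ n * step_prob G S (q 0) n x"
      unfolding step_prob_def using near r \<rho>
      by (intro word_exp_mono_weights[THEN conjunct2]) (auto simp: q_def)
    also have "\<dots> \<le> (\<rho> / r) ^ n * (1 / r * r ^ n)"
      using r(3)[OF x, of n] r \<rho> by (intro mult_left_mono) (auto simp: q_def)
    also have "\<dots> = 1 / r * \<rho> ^ n" using r by (simp add: power_divide)
    finally show "step_prob G S (q t) n x \<le> 1 / r * \<rho> ^ n" .
  qed
  have ratio: "((\<lambda>t. (q t a / q 0 a - 1) / t) \<longlongrightarrow> \<nu> a) (at 0)" "((\<lambda>t. q t a) \<longlongrightarrow> q 0 a) (at 0)"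
    if "a \<in> S" for a
    using log_derivative_ratio[OF assms(7)[OF that] pos[OF _ that]] by (simp_all add: q_def)
  have adm0: "admissible (q 0)"
  proof (rule admissible)
    fix a assume a: "a \<in> S"
    have "1 * q 0 a \<le> \<rho> / r * q 0 a" using \<rho> r by (intro mult_right_mono) (auto simp: q_def)
    then show "e / 2 \<le> q 0 a \<and> q 0 a \<le> \<rho> / r * q 0 a" using e(1) e(2)[OF a] by (simp add: q_def)
  qed simp
  have "\<forall>\<^sub>F t in at 0. \<forall>a\<in>S. e / 2 < q t a \<and> q t a < \<rho> / r * q 0 a"
  proof (intro eventually_ball_finite[OF assms(2)] ballI eventually_conj)
    fix a assume a: "a \<in> S"
    have "0 < q 0 a" using pos[of 0] a by (simp add: q_def)
    then have "1 * q 0 a < \<rho> / r * q 0 a" using \<rho> r by (intro mult_strict_right_mono) auto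
    then show "\<forall>\<^sub>F t in at 0. q t a < \<rho> / r * q 0 a" using ratio(2)[OF a] by (intro order_tendstoD) auto
    have "e / 2 < q 0 a" using e(1) e(2)[OF a] by (simp add: q_def)
    then show "\<forall>\<^sub>F t in at 0. e / 2 < q t a" using ratio(2)[OF a] by (intro order_tendstoD) auto
  qed
  moreover have interval: "\<forall>\<^sub>F t in at 0. t \<in> {-1..1::real}"
    unfolding eventually_at by (rule exI[of _ 1]) (auto simp: abs_le_iff)
  ultimately have adm: "\<forall>\<^sub>F t in at 0. admissible (q t)"
    by eventually_elim (rule admissible; force)
  have derivative: "((\<lambda>t. rate (q t) (q t)) has_real_derivative cov_rate (q 0) (q 0) \<nu>) (at 0)"
    and centered: "(\<Sum>a\<in>S. q 0 a * \<nu> a) = 0"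
    by (rule has_derivative_rate[OF adm0 adm ratio(1)]; simp)+
  have conv: "mean_covariance G \<nu> (\<mu> 0) (green_metric G (\<mu> 0)) \<longlonglongrightarrow> cov_rate (q 0) (q 0) \<nu>"
    unfolding q_def using set[of 0] adm0 centered
    by (intro mean_covariance_tendsto) (auto simp: q_def)
  have "\<forall>\<^sub>F t in at 0. asymptotic_entropy G (\<mu> t) = rate (q t) (q t)"
    using adm interval by eventually_elim (simp add: asymptotic_entropy_eq_rate set q_def)
  moreover have "asymptotic_entropy G (\<mu> 0) = rate (q 0) (q 0)"
    using adm0 set[of 0] by (simp add: asymptotic_entropy_eq_rate q_def)
  ultimately have agree: "\<forall>\<^sub>F t in nhds 0. asymptotic_entropy G (\<mu> t) = rate (q t) (q t)"
    by (simp add: eventually_nhds_conv_at)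
  have "((\<lambda>t. asymptotic_entropy G (\<mu> t)) has_real_derivative cov_rate (q 0) (q 0) \<nu>) (at 0)"
    by (rule DERIV_cong_ev[OF refl agree refl, THEN iffD2, OF derivative])
  then show ?thesis
    using conv by (auto simp: asymptotic_covariance_def limI convergent_def)
qed

end
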